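(* Suppose that $\mathcal C$ is a pointed category with binary coproducts, that $\mathcal X$ is a semi-abelian category, and that $F\colon\mathcal C\to\mathcal X$ is a functor which preserves zero and coequalisers of reflexive graphs. Consider an object $X$ of $\mathcal C$ and a cokernel $$K\xrightarrow{k}B\xrightarrow{f}A\to0$$ in $\mathcal C$ (that is, $f$ is a cokernel of $k$). Then $$F(X|K|B)\rtimes F(X|K)\longrightarrow F(X|B)\xrightarrow{F(1_X|f)}F(X|A)\to0$$ is a right exact sequence in $\mathcal X$, where the first arrow is the morphism which restricts to $S_{1,2}^{X,B}\circ F(1_X|k|1_B)$ on $F(X|K|B)$ and to $F(1_X|k)$ on $F(X|K)$.
   Context: A semi-abelian category is a pointed, Barr-exact, Bourn-protomodular category with finite coproducts. **Right exactness.** A sequence $K\xrightarrow{k}B\xrightarrow{f}A\to0$ in $\mathcal X$ is right exact if $k$ is proper (its image is a normal subobject of its codomain) and $f$ is a cokernel of $k$. **Cross-effects.** Let $F$ be a functor preserving zero. For objects $X_1,\dots,X_n$ of $\mathcal C$ ($n\ge2$), $F(X_1|\cdots|X_n)$ is the kernel, with inclusion $\iota_{X_1,\dots,X_n}$, of the morphism $F(X_1+\cdots+X_n)\to\prod_{j=1}^nF(X_1+\cdots+\widehat{X_j}+\cdots+X_n)$ whose $j$-th component is $F(r_j)$, where $r_j$ is zero on $X_j$ and the coproduct inclusion on $X_i$ for $i\ne j$. It is functorial in all variables. For objects $X,Y$, the folding operation $S_{1,2}^{X,Y}\colon F(X|Y|Y)\to F(X|Y)$ is the morphism with $\iota_{X,Y}\circ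 S_{1,2}^{X,Y}=F(1_X+\nabla_Y)\circ\iota_{X,Y,Y}$, where $\nabla_Y\colon Y+Y\to Y$ is the codiagonal. **The semi-direct product.** The functor $G=F(X|-)$ preserves zero, and its second cross-effect $G(K|B)=\mathrm{Ker}\bigl(G(K+B)\to G(K)\times G(B)\bigr)$ is canonically isomorphic to $F(X|K|B)$. The object $F(X|K|B)\rtimes F(X|K)$ denotes the kernel $V$ of the morphism $F(X|K+B)\to F(X|B)$ induced by $K+B\to B$ (zero on $K$, identity on $B$). It fits into a split short exact sequence $0\to F(X|K|B)\to V\rightleftarrows F(X|K)\to 0$, the splitting being induced by the coproduct inclusion $K\to K+B$ and the retraction by $K+B\to K$. A morphism out of $V$ is determined by its restrictions to $F(X|K|B)$ and, along the splitting, to $F(X|K)$. *)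

theory Defs
  imports Main
begin

section \<open>Categories\<close>

record ('o, 'm) cat =
  Obj :: "'o set"
  Arr :: "'m set"
  Dom :: "'m \<Rightarrow> 'o"
  Cod :: "'m \<Rightarrow> 'o"
  Ident :: "'o \<Rightarrow> 'm"
  Comp :: "'m \<Rightarrow> 'm \<Rightarrow> 'm"  (infixl "\<cdot>\<index>" 70)

text \<open>Composition is written in the usual order: in \<open>g \<cdot>\<^bsub>C\<^esub> f\<close> the morphism \<open>f\<close> comes first.\<close>

definition hom :: "('o, 'm) cat \<Rightarrow> 'o \<Rightarrow> 'o \<Rightarrow> 'm set"
  where "hom C X Y = {f \<in> Arr C. Dom C f = X \<and> Cod C f = Y}"

locale category =
  fixes C :: "('o, 'm) cat"
  assumes dom_obj: "f \<in> Arr C \<Longrightarrow> Dom C f \<in> Obj C"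
    and cod_obj: "f \<in> Arr C \<Longrightarrow> Cod C f \<in> Obj C"
    and ident_hom: "X \<in> Obj C \<Longrightarrow> Ident C X \<in> hom C X X"
    and comp_hom: "f \<in> hom C X Y \<Longrightarrow> g \<in> hom C Y Z \<Longrightarrow> g \<cdot>\<^bsub>C\<^esub> f \<in> hom C X Z"
    and ident_left: "f \<in> hom C X Y \<Longrightarrow> Ident C Y \<cdot>\<^bsub>C\<^esub> f = f"
    and ident_right: "f \<in> hom C X Y \<Longrightarrow> f \<cdot>\<^bsub>C\<^esub> Ident C X = f"
    and comp_assoc: "f \<in> hom C W X \<Longrightarrow> g \<in> hom C X Y \<Longrightarrow> h \<in> hom C Y Z \<Longrightarrow>
      (h \<cdot>\<^bsub>C\<^esub> g) \<cdot>\<^bsub>C\<^esub> f = h \<cdot>\<^bsub>C\<^esub> (g \<cdot>\<^bsub>C\<^esub> f)"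

definition is_iso :: "('o, 'm) cat \<Rightarrow> 'm \<Rightarrow> bool"
  where "is_iso C f \<longleftrightarrow> f \<in> Arr C \<and>
    (\<exists>g \<in> hom C (Cod C f) (Dom C f).
      g \<cdot>\<^bsub>C\<^esub> f = Ident C (Dom C f) \<and> f \<cdot>\<^bsub>C\<^esub> g = Ident C (Cod C f))"

definition is_mono :: "('o, 'm) cat \<Rightarrow> 'm \<Rightarrow> bool"
  where "is_mono C m \<longleftrightarrow> m \<in> Arr C \<and>
    (\<forall>W. \<forall>u \<in> hom C W (Dom C m). \<forall>v \<in> hom C W (Dom C m). m \<cdot>\<^bsub>C\<^esub> u = m \<cdot>\<^bsub>C\<^esub> v \<longrightarrow> u = v)"


section \<open>Limits and colimits\<close>

definition is_equaliser :: "('o, 'm) cat \<Rightarrow> 'm \<Rightarrow> 'm \<Rightarrow> 'm \<Rightarrow> bool"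
  where "is_equaliser C f g e \<longleftrightarrow>
    f \<in> Arr C \<and> g \<in> hom C (Dom C f) (Cod C f) \<and>
    e \<in> Arr C \<and> Cod C e = Dom C f \<and> f \<cdot>\<^bsub>C\<^esub> e = g \<cdot>\<^bsub>C\<^esub> e \<and>
    (\<forall>W. \<forall>h \<in> hom C W (Dom C f). f \<cdot>\<^bsub>C\<^esub> h = g \<cdot>\<^bsub>C\<^esub> h \<longrightarrow>
      (\<exists>!u. u \<in> hom C W (Dom C e) \<and> e \<cdot>\<^bsub>C\<^esub> u = h))"

definition is_coequaliser :: "('o, 'm) cat \<Rightarrow> 'm \<Rightarrow> 'm \<Rightarrow> 'm \<Rightarrow> bool"
  where "is_coequaliser C f g q \<longleftrightarrow>
    f \<in> Arr C \<and> g \<in> hom C (Dom C f) (Cod C f) \<and>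
    q \<in> Arr C \<and> Dom C q = Cod C f \<and> q \<cdot>\<^bsub>C\<^esub> f = q \<cdot>\<^bsub>C\<^esub> g \<and>
    (\<forall>Z. \<forall>h \<in> hom C (Cod C f) Z. h \<cdot>\<^bsub>C\<^esub> f = h \<cdot>\<^bsub>C\<^esub> g \<longrightarrow>
      (\<exists>!u. u \<in> hom C (Cod C q) Z \<and> u \<cdot>\<^bsub>C\<^esub> q = h))"

definition is_pullback :: "('o, 'm) cat \<Rightarrow> 'm \<Rightarrow> 'm \<Rightarrow> 'm \<Rightarrow> 'm \<Rightarrow> bool"
  where "is_pullback C f g p q \<longleftrightarrow>
    f \<in> Arr C \<and> g \<in> Arr C \<and> Cod C f = Cod C g \<and>
    p \<in> Arr C \<and> q \<in> hom C (Dom C p) (Dom C g) \<and> Cod C p = Dom C f \<and>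
    f \<cdot>\<^bsub>C\<^esub> p = g \<cdot>\<^bsub>C\<^esub> q \<and>
    (\<forall>W. \<forall>a \<in> hom C W (Dom C f). \<forall>b \<in> hom C W (Dom C g). f \<cdot>\<^bsub>C\<^esub> a = g \<cdot>\<^bsub>C\<^esub> b \<longrightarrow>
      (\<exists>!u. u \<in> hom C W (Dom C p) \<and> p \<cdot>\<^bsub>C\<^esub> u = a \<and> q \<cdot>\<^bsub>C\<^esub> u = b))"

definition is_coproduct :: "('o, 'm) cat \<Rightarrow> 'o list \<Rightarrow> 'o \<Rightarrow> 'm list \<Rightarrow> bool"
  where "is_coproduct C Xs P is \<longleftrightarrow>
    P \<in> Obj C \<and> list_all2 (\<lambda>X i. i \<in> hom C X P) Xs is \<and>
    (\<forall>Z \<in> Obj C. \<forall>gs. list_all2 (\<lambda>X g. g \<in> hom C X Z) Xs gs \<longrightarrow>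
      (\<exists>!h. h \<in> hom C P Z \<and> map (\<lambda>i. h \<cdot>\<^bsub>C\<^esub> i) is = gs))"

definition is_product :: "('o, 'm) cat \<Rightarrow> 'o list \<Rightarrow> 'o \<Rightarrow> 'm list \<Rightarrow> bool"
  where "is_product C Xs P ps \<longleftrightarrow>
    P \<in> Obj C \<and> list_all2 (\<lambda>X p. p \<in> hom C P X) Xs ps \<and>
    (\<forall>W \<in> Obj C. \<forall>gs. list_all2 (\<lambda>X g. g \<in> hom C W X) Xs gs \<longrightarrow>
      (\<exists>!h. h \<in> hom C W P \<and> map (\<lambda>p. p \<cdot>\<^bsub>C\<^esub> h) ps = gs))"

definition has_binary_coproducts :: "('o, 'm) cat \<Rightarrow> bool"
  where "has_binary_coproducts C \<longleftrightarrow>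
    (\<forall>X \<in> Obj C. \<forall>Y \<in> Obj C. \<exists>P is. is_coproduct C [X, Y] P is)"

definition has_finite_coproducts :: "('o, 'm) cat \<Rightarrow> bool"
  where "has_finite_coproducts C \<longleftrightarrow> (\<forall>Xs. set Xs \<subseteq> Obj C \<longrightarrow> (\<exists>P is. is_coproduct C Xs P is))"

definition has_finite_products :: "('o, 'm) cat \<Rightarrow> bool"
  where "has_finite_products C \<longleftrightarrow> (\<forall>Xs. set Xs \<subseteq> Obj C \<longrightarrow> (\<exists>P ps. is_product C Xs P ps))"

definition has_equalisers :: "('o, 'm) cat \<Rightarrow> bool"
  where "has_equalisers C \<longleftrightarrow>
    (\<forall>f \<in> Arr C. \<forall>g \<in> hom C (Dom C f) (Cod C f). \<exists>e. is_equaliser C f g e)"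

text \<open>
  A choice of (co)products, with their (co)projections, and the morphisms given by the
  universal properties.
\<close>

definition coprod_cocone :: "('o, 'm) cat \<Rightarrow> 'o list \<Rightarrow> 'o \<times> 'm list"
  where "coprod_cocone C Xs = (SOME (P, is). is_coproduct C Xs P is)"

definition coprod :: "('o, 'm) cat \<Rightarrow> 'o list \<Rightarrow> 'o"
  where "coprod C Xs = fst (coprod_cocone C Xs)"

definition injs :: "('o, 'm) cat \<Rightarrow> 'o list \<Rightarrow> 'm list"
  where "injs C Xs = snd (coprod_cocone C Xs)"

definition cotuple :: "('o, 'm) cat \<Rightarrow> 'o list \<Rightarrow> 'o \<Rightarrow> 'm list \<Rightarrow> 'm"
  where "cotuple C Xs Z gs =
    (THE h. h \<in> hom C (coprod C Xs) Z \<and> map (\<lambda>i. h \<cdot>\<^bsub>C\<^esub> i) (injs C Xs) = gs)"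

text \<open>The morphism \<open>f\<^sub>1 + \<dots> + f\<^sub>n\<close>.\<close>

definition coprod_map :: "('o, 'm) cat \<Rightarrow> 'm list \<Rightarrow> 'm"
  where "coprod_map C fs =
    (let Ys = map (Cod C) fs
     in cotuple C (map (Dom C) fs) (coprod C Ys) (map2 (\<lambda>i f. i \<cdot>\<^bsub>C\<^esub> f) (injs C Ys) fs))"

definition prod_cone :: "('o, 'm) cat \<Rightarrow> 'o list \<Rightarrow> 'o \<times> 'm list"
  where "prod_cone C Xs = (SOME (P, ps). is_product C Xs P ps)"

definition product :: "('o, 'm) cat \<Rightarrow> 'o list \<Rightarrow> 'o"
  where "product C Xs = fst (prod_cone C Xs)"

definition projs :: "('o, 'm) cat \<Rightarrow> 'o list \<Rightarrow> 'm list"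
  where "projs C Xs = snd (prod_cone C Xs)"

definition tuple :: "('o, 'm) cat \<Rightarrow> 'o list \<Rightarrow> 'o \<Rightarrow> 'm list \<Rightarrow> 'm"
  where "tuple C Xs W gs =
    (THE h. h \<in> hom C W (product C Xs) \<and> map (\<lambda>p. p \<cdot>\<^bsub>C\<^esub> h) (projs C Xs) = gs)"


section \<open>Pointed categories, kernels and cokernels\<close>

definition is_zero :: "('o, 'm) cat \<Rightarrow> 'o \<Rightarrow> bool"
  where "is_zero C Z \<longleftrightarrow> Z \<in> Obj C \<and>
    (\<forall>X \<in> Obj C. (\<exists>!f. f \<in> hom C X Z) \<and> (\<exists>!f. f \<in> hom C Z X))"

locale pointed_category = category +
  assumes ex_zero: "\<exists>Z. is_zero C Z"

definition zero_map :: "('o, 'm) cat \<Rightarrow> 'o \<Rightarrow> 'o \<Rightarrow> 'm"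
  where "zero_map C X Y =
    (THE h. \<exists>Z u v. is_zero C Z \<and> u \<in> hom C X Z \<and> v \<in> hom C Z Y \<and> h = v \<cdot>\<^bsub>C\<^esub> u)"

text \<open>\<open>is_kernel C k f\<close>: the morphism \<open>k\<close> is a kernel of \<open>f\<close>.\<close>

definition is_kernel :: "('o, 'm) cat \<Rightarrow> 'm \<Rightarrow> 'm \<Rightarrow> bool"
  where "is_kernel C k f \<longleftrightarrow>
    f \<in> Arr C \<and> k \<in> Arr C \<and> Cod C k = Dom C f \<and>
    f \<cdot>\<^bsub>C\<^esub> k = zero_map C (Dom C k) (Cod C f) \<and>
    (\<forall>W. \<forall>h \<in> hom C W (Dom C f). f \<cdot>\<^bsub>C\<^esub> h = zero_map C W (Cod C f) \<longrightarrow>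
      (\<exists>!u. u \<in> hom C W (Dom C k) \<and> k \<cdot>\<^bsub>C\<^esub> u = h))"

text \<open>\<open>is_cokernel C f k\<close>: the morphism \<open>f\<close> is a cokernel of \<open>k\<close>.\<close>

definition is_cokernel :: "('o, 'm) cat \<Rightarrow> 'm \<Rightarrow> 'm \<Rightarrow> bool"
  where "is_cokernel C f k \<longleftrightarrow>
    k \<in> Arr C \<and> f \<in> Arr C \<and> Dom C f = Cod C k \<and>
    f \<cdot>\<^bsub>C\<^esub> k = zero_map C (Dom C k) (Cod C f) \<and>
    (\<forall>Z. \<forall>h \<in> hom C (Cod C k) Z. h \<cdot>\<^bsub>C\<^esub> k = zero_map C (Dom C k) Z \<longrightarrow>
      (\<exists>!u. u \<in> hom C (Cod C f) Z \<and> u \<cdot>\<^bsub>C\<^esub> f = h))"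

text \<open>A chosen kernel of \<open>f\<close>, as a morphism; the kernel object is its domain.\<close>

definition kernel :: "('o, 'm) cat \<Rightarrow> 'm \<Rightarrow> 'm"
  where "kernel C f = (SOME k. is_kernel C k f)"


section \<open>Semi-abelian categories\<close>

definition is_regular_epi :: "('o, 'm) cat \<Rightarrow> 'm \<Rightarrow> bool"
  where "is_regular_epi C q \<longleftrightarrow> (\<exists>f g. is_coequaliser C f g q)"

locale regular_category = category +
  assumes finite_products: "has_finite_products C"
    and equalisers: "has_equalisers C"
    and kernel_pair_coequaliser: "is_pullback C f f r s \<Longrightarrow> \<exists>q. is_coequaliser C r s q"
    and regular_epi_stable: "is_pullback C f g p q \<Longrightarrow> is_regular_epi C g \<Longrightarrow> is_regular_epi C p"

text \<open>
  An internal equivalence relation on \<open>X\<close>, given by its two projections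
  \<open>r\<^sub>1\<close>, \<open>r\<^sub>2\<close> from \<open>R\<close> to \<open>X\<close>.  For transitivity, the pullback of \<open>r\<^sub>2\<close>
  and \<open>r\<^sub>1\<close> is the object of composable pairs.
\<close>

definition is_equivalence_relation :: "('o, 'm) cat \<Rightarrow> 'o \<Rightarrow> 'm \<Rightarrow> 'm \<Rightarrow> bool"
  where "is_equivalence_relation C X r\<^sub>1 r\<^sub>2 \<longleftrightarrow>
    (\<exists>R. r\<^sub>1 \<in> hom C R X \<and> r\<^sub>2 \<in> hom C R X \<and>
      (\<forall>W. \<forall>u \<in> hom C W R. \<forall>v \<in> hom C W R.
        r\<^sub>1 \<cdot>\<^bsub>C\<^esub> u = r\<^sub>1 \<cdot>\<^bsub>C\<^esub> v \<and> r\<^sub>2 \<cdot>\<^bsub>C\<^esub> u = r\<^sub>2 \<cdot>\<^bsub>C\<^esub> v \<longrightarrow> u = v) \<and>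
      (\<exists>e \<in> hom C X R. r\<^sub>1 \<cdot>\<^bsub>C\<^esub> e = Ident C X \<and> r\<^sub>2 \<cdot>\<^bsub>C\<^esub> e = Ident C X) \<and>
      (\<exists>s \<in> hom C R R. r\<^sub>1 \<cdot>\<^bsub>C\<^esub> s = r\<^sub>2 \<and> r\<^sub>2 \<cdot>\<^bsub>C\<^esub> s = r\<^sub>1) \<and>
      (\<forall>p q. is_pullback C r\<^sub>2 r\<^sub>1 p q \<longrightarrow>
        (\<exists>t \<in> hom C (Dom C p) R. r\<^sub>1 \<cdot>\<^bsub>C\<^esub> t = r\<^sub>1 \<cdot>\<^bsub>C\<^esub> p \<and> r\<^sub>2 \<cdot>\<^bsub>C\<^esub> t = r\<^sub>2 \<cdot>\<^bsub>C\<^esub> q)))"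

locale barr_exact_category = regular_category +
  assumes equivalence_relation_effective:
    "is_equivalence_relation C X r\<^sub>1 r\<^sub>2 \<Longrightarrow> \<exists>q. is_pullback C q q r\<^sub>1 r\<^sub>2"

text \<open>
  A point over \<open>B\<close> is a split epimorphism \<open>p\<close> with codomain \<open>B\<close> and a chosen section \<open>s\<close>.
  Bourn protomodularity: for every \<open>v\<close> with codomain \<open>B\<close>, the change-of-base
  functor \<open>v\<^sup>*\<close> from points over \<open>B\<close> to points over the domain of \<open>v\<close> reflects
  isomorphisms.  Below \<open>h\<close> is a morphism of points from \<open>(p, s)\<close> to \<open>(p', s')\<close>, and
  \<open>w\<close> is the morphism induced between their pullbacks along \<open>v\<close>.
\<close>

definition is_point :: "('o, 'm) cat \<Rightarrow> 'o \<Rightarrow> 'm \<Rightarrow> 'm \<Rightarrow> bool"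
  where "is_point C B p s \<longleftrightarrow>
    (\<exists>E. p \<in> hom C E B \<and> s \<in> hom C B E \<and> p \<cdot>\<^bsub>C\<^esub> s = Ident C B)"

definition protomodular :: "('o, 'm) cat \<Rightarrow> bool"
  where "protomodular C \<longleftrightarrow>
    (\<forall>B v p s p' s' h a b a' b' w.
      is_point C B p s \<and> is_point C B p' s' \<and>
      h \<in> hom C (Dom C p) (Dom C p') \<and> p' \<cdot>\<^bsub>C\<^esub> h = p \<and> h \<cdot>\<^bsub>C\<^esub> s = s' \<and>
      is_pullback C v p a b \<and> is_pullback C v p' a' b' \<and>
      w \<in> hom C (Dom C a) (Dom C a') \<and> a' \<cdot>\<^bsub>C\<^esub> w = a \<and> b' \<cdot>\<^bsub>C\<^esub> w = h \<cdot>\<^bsub>C\<^esub> b \<and>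
      is_iso C w
      \<longrightarrow> is_iso C h)"

locale semi_abelian_category = pointed_category + barr_exact_category +
  assumes protomodular: "protomodular C"
    and finite_coproducts: "has_finite_coproducts C"

text \<open>
  A morphism is proper when the mono part of its (regular epi, mono) factorisation, its image,
  is a normal subobject, i.e. a kernel of some morphism.
\<close>

definition is_image :: "('o, 'm) cat \<Rightarrow> 'm \<Rightarrow> 'm \<Rightarrow> bool"
  where "is_image C f m \<longleftrightarrow> is_mono C m \<and>
    (\<exists>e. is_regular_epi C e \<and> Cod C e = Dom C m \<and> f = m \<cdot>\<^bsub>C\<^esub> e)"

definition is_normal_subobject :: "('o, 'm) cat \<Rightarrow> 'm \<Rightarrow> bool"
  where "is_normal_subobject C m \<longleftrightarrow> (\<exists>g. is_kernel C m g)"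

definition is_proper :: "('o, 'm) cat \<Rightarrow> 'm \<Rightarrow> bool"
  where "is_proper C k \<longleftrightarrow> (\<exists>m. is_image C k m \<and> is_normal_subobject C m)"

definition right_exact :: "('o, 'm) cat \<Rightarrow> 'm \<Rightarrow> 'm \<Rightarrow> bool"
  where "right_exact C k f \<longleftrightarrow> is_proper C k \<and> is_cokernel C f k"


section \<open>Functors\<close>

record ('a, 'f, 'b, 'g) funct =
  onObj :: "'a \<Rightarrow> 'b"
  onArr :: "'f \<Rightarrow> 'g"

locale cat_functor = C: category C + D: category D
  for C :: "('a, 'f) cat" and D :: "('b, 'g) cat" +
  fixes F :: "('a, 'f, 'b, 'g) funct"
  assumes obj_functor: "X \<in> Obj C \<Longrightarrow> onObj F X \<in> Obj D"
    and hom_functor: "f \<in> hom C X Y \<Longrightarrow> onArr F f \<in> hom D (onObj F X) (onObj F Y)"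
    and ident_functor: "X \<in> Obj C \<Longrightarrow> onArr F (Ident C X) = Ident D (onObj F X)"
    and comp_functor: "f \<in> hom C X Y \<Longrightarrow> g \<in> hom C Y Z \<Longrightarrow>
      onArr F (g \<cdot>\<^bsub>C\<^esub> f) = onArr F g \<cdot>\<^bsub>D\<^esub> onArr F f"

definition preserves_zero ::
  "('a, 'f) cat \<Rightarrow> ('b, 'g) cat \<Rightarrow> ('a, 'f, 'b, 'g) funct \<Rightarrow> bool"
  where "preserves_zero C D F \<longleftrightarrow> (\<forall>Z. is_zero C Z \<longrightarrow> is_zero D (onObj F Z))"

definition is_reflexive_graph :: "('o, 'm) cat \<Rightarrow> 'm \<Rightarrow> 'm \<Rightarrow> 'm \<Rightarrow> bool"
  where "is_reflexive_graph C d c e \<longleftrightarrow>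
    (\<exists>X Y. d \<in> hom C Y X \<and> c \<in> hom C Y X \<and> e \<in> hom C X Y \<and>
      d \<cdot>\<^bsub>C\<^esub> e = Ident C X \<and> c \<cdot>\<^bsub>C\<^esub> e = Ident C X)"

definition preserves_reflexive_coequalisers ::
  "('a, 'f) cat \<Rightarrow> ('b, 'g) cat \<Rightarrow> ('a, 'f, 'b, 'g) funct \<Rightarrow> bool"
  where "preserves_reflexive_coequalisers C D F \<longleftrightarrow>
    (\<forall>d c e q. is_reflexive_graph C d c e \<and> is_coequaliser C d c q \<longrightarrow>
      is_coequaliser D (onArr F d) (onArr F c) (onArr F q))"


section \<open>Cross-effects\<close>

definition omit :: "nat \<Rightarrow> 'a list \<Rightarrow> 'a list"
  where "omit j xs = take j xs @ drop (Suc j) xs"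

text \<open>
  The morphism \<open>r\<^sub>j\<close>: zero on the \<open>j\<close>-th summand (counted from 0) and the coproduct inclusion
  on the other ones.
\<close>

definition omit_map :: "('o, 'm) cat \<Rightarrow> 'o list \<Rightarrow> nat \<Rightarrow> 'm"
  where "omit_map C Xs j =
    (let Ys = omit j Xs; P = coprod C Ys
     in cotuple C Xs P (take j (injs C Ys) @ [zero_map C (Xs ! j) P] @ drop j (injs C Ys)))"

definition cross_comparison ::
  "('a, 'f) cat \<Rightarrow> ('b, 'g) cat \<Rightarrow> ('a, 'f, 'b, 'g) funct \<Rightarrow> 'a list \<Rightarrow> 'g"
  where "cross_comparison C D F Xs =
    tuple D (map (\<lambda>j. onObj F (coprod C (omit j Xs))) [0..<length Xs])
      (onObj F (coprod C Xs))
      (map (\<lambda>j. onArr F (omit_map C Xs j)) [0..<length Xs])"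

text \<open>
  For \<open>Xs = [X\<^sub>1, \<dots>, X\<^sub>n]\<close>, \<open>cross_incl C D F Xs\<close> is the inclusion \<open>\<iota>\<close> and
  \<open>cross C D F Xs\<close> the object \<open>F(X\<^sub>1|\<dots>|X\<^sub>n)\<close>; \<open>cross_map\<close> is the action on morphisms.
\<close>

definition cross_incl ::
  "('a, 'f) cat \<Rightarrow> ('b, 'g) cat \<Rightarrow> ('a, 'f, 'b, 'g) funct \<Rightarrow> 'a list \<Rightarrow> 'g"
  where "cross_incl C D F Xs = kernel D (cross_comparison C D F Xs)"

definition cross ::
  "('a, 'f) cat \<Rightarrow> ('b, 'g) cat \<Rightarrow> ('a, 'f, 'b, 'g) funct \<Rightarrow> 'a list \<Rightarrow> 'b"
  where "cross C D F Xs = Dom D (cross_incl C D F Xs)"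

definition cross_map ::
  "('a, 'f) cat \<Rightarrow> ('b, 'g) cat \<Rightarrow> ('a, 'f, 'b, 'g) funct \<Rightarrow> 'f list \<Rightarrow> 'g"
  where "cross_map C D F fs =
    (let Xs = map (Dom C) fs; Ys = map (Cod C) fs
     in THE h. h \<in> hom D (cross C D F Xs) (cross C D F Ys) \<and>
          cross_incl C D F Ys \<cdot>\<^bsub>D\<^esub> h = onArr F (coprod_map C fs) \<cdot>\<^bsub>D\<^esub> cross_incl C D F Xs)"

text \<open>The canonical isomorphism from \<open>X + Y + Z\<close> to \<open>X + (Y + Z)\<close>.\<close>

definition coprod_assoc :: "('o, 'm) cat \<Rightarrow> 'o \<Rightarrow> 'o \<Rightarrow> 'o \<Rightarrow> 'm"
  where "coprod_assoc C X Y Z =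
    (let S = coprod C [Y, Z]; i = injs C [X, S]; j = injs C [Y, Z]
     in cotuple C [X, Y, Z] (coprod C [X, S]) [i ! 0, i ! 1 \<cdot>\<^bsub>C\<^esub> j ! 0, i ! 1 \<cdot>\<^bsub>C\<^esub> j ! 1])"

definition codiagonal :: "('o, 'm) cat \<Rightarrow> 'o \<Rightarrow> 'm"
  where "codiagonal C Y = cotuple C [Y, Y] Y [Ident C Y, Ident C Y]"

text \<open>The folding operation \<open>S\<^sub>1\<^sub>,\<^sub>2\<close> from \<open>F(X|Y|Y)\<close> to \<open>F(X|Y)\<close>.\<close>

definition folding ::
  "('a, 'f) cat \<Rightarrow> ('b, 'g) cat \<Rightarrow> ('a, 'f, 'b, 'g) funct \<Rightarrow> 'a \<Rightarrow> 'a \<Rightarrow> 'g"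
  where "folding C D F X Y =
    (THE S. S \<in> hom D (cross C D F [X, Y, Y]) (cross C D F [X, Y]) \<and>
      cross_incl C D F [X, Y] \<cdot>\<^bsub>D\<^esub> S =
      onArr F (coprod_map C [Ident C X, codiagonal C Y] \<cdot>\<^bsub>C\<^esub> coprod_assoc C X Y Y)
        \<cdot>\<^bsub>D\<^esub> cross_incl C D F [X, Y, Y])"


section \<open>The semi-direct product\<close>

text \<open>
  \<open>semidirect_incl\<close> is the inclusion into \<open>F(X|K+B)\<close> of the kernel \<open>V\<close> of the morphism
  \<open>F(X|K+B) \<rightarrow> F(X|B)\<close> induced by the retraction of \<open>K + B\<close> onto \<open>B\<close>.
\<close>

definition semidirect_incl ::
  "('a, 'f) cat \<Rightarrow> ('b, 'g) cat \<Rightarrow> ('a, 'f, 'b, 'g) funct \<Rightarrow> 'a \<Rightarrow> 'a \<Rightarrow> 'a \<Rightarrow> 'g"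
  where "semidirect_incl C D F X K B =
    kernel D (cross_map C D F
      [Ident C X, cotuple C [K, B] B [zero_map C K B, Ident C B]])"

definition semidirect ::
  "('a, 'f) cat \<Rightarrow> ('b, 'g) cat \<Rightarrow> ('a, 'f, 'b, 'g) funct \<Rightarrow> 'a \<Rightarrow> 'a \<Rightarrow> 'a \<Rightarrow> 'b"
  where "semidirect C D F X K B = Dom D (semidirect_incl C D F X K B)"

text \<open>
  The kernel part \<open>F(X|K|B) \<rightarrow> V\<close> of the split short exact sequence.  Under the
  identification of \<open>F(X|K|B)\<close> with the second cross-effect \<open>G(K|B)\<close> of \<open>G = F(X|-)\<close>, the
  composite of the inclusions of \<open>G(K|B)\<close> into \<open>G(K + B) = F(X|K+B)\<close> and of the latter into
  \<open>F(X + (K + B))\<close> is, up to associativity of the coproduct, the inclusion of \<open>F(X|K|B)\<close>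
  into \<open>F(X + K + B)\<close>; this determines the map.
\<close>

definition semidirect_left ::
  "('a, 'f) cat \<Rightarrow> ('b, 'g) cat \<Rightarrow> ('a, 'f, 'b, 'g) funct \<Rightarrow> 'a \<Rightarrow> 'a \<Rightarrow> 'a \<Rightarrow> 'g"
  where "semidirect_left C D F X K B =
    (THE h. h \<in> hom D (cross C D F [X, K, B]) (semidirect C D F X K B) \<and>
      cross_incl C D F [X, coprod C [K, B]] \<cdot>\<^bsub>D\<^esub> (semidirect_incl C D F X K B \<cdot>\<^bsub>D\<^esub> h) =
      onArr F (coprod_assoc C X K B) \<cdot>\<^bsub>D\<^esub> cross_incl C D F [X, K, B])"

text \<open>The splitting \<open>F(X|K) \<rightarrow> V\<close>, induced by the coproduct inclusion of \<open>K\<close> into \<open>K + B\<close>.\<close>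

definition semidirect_splitting ::
  "('a, 'f) cat \<Rightarrow> ('b, 'g) cat \<Rightarrow> ('a, 'f, 'b, 'g) funct \<Rightarrow> 'a \<Rightarrow> 'a \<Rightarrow> 'a \<Rightarrow> 'g"
  where "semidirect_splitting C D F X K B =
    (THE h. h \<in> hom D (cross C D F [X, K]) (semidirect C D F X K B) \<and>
      semidirect_incl C D F X K B \<cdot>\<^bsub>D\<^esub> h = cross_map C D F [Ident C X, injs C [K, B] ! 0])"

definition restricts_to ::
  "('a, 'f) cat \<Rightarrow> ('b, 'g) cat \<Rightarrow> ('a, 'f, 'b, 'g) funct \<Rightarrow> 'a \<Rightarrow> 'a \<Rightarrow> 'a \<Rightarrow>
    'g \<Rightarrow> 'g \<Rightarrow> 'g \<Rightarrow> bool"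
  where "restricts_to C D F X K B \<phi> l r \<longleftrightarrow>
    \<phi> \<cdot>\<^bsub>D\<^esub> semidirect_left C D F X K B = l \<and>
    \<phi> \<cdot>\<^bsub>D\<^esub> semidirect_splitting C D F X K B = r"

end

theory Submission
  imports Defs
begin

text \<open>
  The maps \<open>(0, 1)\<close> and \<open>(k, 1)\<close> from \<open>K + B\<close> to \<open>B\<close> form a reflexive graph with coequaliser
  \<open>f\<close>, which remains so after adding \<open>X\<close>; hence \<open>F(X + A)\<close> is the coequaliser of
  \<open>F(X + (K + B)) \<rightrightarrows> F(X + B)\<close>.  In a semi-abelian category the image in the product of a
  reflexive graph is an equivalence relation, hence effective; so the second leg maps the kernel
  \<open>N\<^sub>1\<close> of the first leg by a regular epimorphism onto the kernel \<open>N\<^sub>0\<close> of the coequaliser.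
  Both \<open>V\<close> and the kernel of \<open>F(X|B) \<rightarrow> F(X|A)\<close> are kernels of split epimorphisms, out of
  \<open>N\<^sub>1\<close> and \<open>N\<^sub>0\<close> respectively, and a regular epimorphism of split epimorphisms restricts to a
  regular epimorphism between their kernels.  Thus \<open>V \<rightarrow> F(X|B)\<close> has a normal image, the kernel of
  \<open>F(X|B) \<rightarrow> F(X|A)\<close>, and the latter is a regular epimorphism for the same reason.  Uniqueness
  holds as \<open>F(X|K|B)\<close> and \<open>F(X|K)\<close> are the kernel and the section of a split epimorphism out
  of \<open>V\<close>, thus jointly epimorphic.
\<close>

section \<open>Categories and regular categories\<close>

text \<open>The reason for passing through \<open>F(X + -)\<close>: the hypothesis on
  \<open>F\<close> concerns coequalisers, whereas \<open>F(X|-)\<close> is defined by kernels, and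
  kernels do not commute with coequalisers in general. What protomodularity preserves is regularity
  of a morphism between kernels of split epimorphisms; hence the effort spent on exhibiting
  cross-effects, and the kernels of maps between them, as kernels of split epimorphisms compatible
  with the maps in question. The semi-direct product enters because \<open>V\<close> is by
  definition the kernel of \<open>F(X|(0,1))\<close>, and \<open>(0,1)\<close> is the first leg of
  the graph. Accordingly the arrow to \<open>F(X|B)\<close> is taken to be the restriction of
  \<open>F(X|(k,1))\<close> to \<open>V\<close>; two prescribed restrictions alone would determine
  an arrow without providing it. The folding operation appears because \<open>(k,1)\<close> is the
  codiagonal after \<open>k + 1\<close>.\<close>

lemma hom_iff: "f \<in> hom C X Y \<longleftrightarrow> f \<in> Arr C \<and> Dom C f = X \<and> Cod C f = Y"
  by (simp add: hom_def)

context category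
begin

lemma comp_simps [simp]:
  assumes "f \<in> Arr C" "g \<in> Arr C" "Cod C f = Dom C g"
  shows "g \<cdot>\<^bsub>C\<^esub> f \<in> Arr C" "Dom C (g \<cdot>\<^bsub>C\<^esub> f) = Dom C f" "Cod C (g \<cdot>\<^bsub>C\<^esub> f) = Cod C g"
  using comp_hom[of f "Dom C f" "Cod C f" g "Cod C g"] assms by (auto simp: hom_iff)

lemma ident_simps [simp]:
  assumes "X \<in> Obj C"
  shows "Ident C X \<in> Arr C" "Dom C (Ident C X) = X" "Cod C (Ident C X) = X"
  using ident_hom[OF assms] by (auto simp: hom_iff)

lemma ident_comp [simp]:
  assumes "f \<in> Arr C"
  shows "Cod C f = Y \<Longrightarrow> Ident C Y \<cdot>\<^bsub>C\<^esub> f = f" "Dom C f = X \<Longrightarrow> f \<cdot>\<^bsub>C\<^esub> Ident C X = f"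
  using assms ident_left ident_right by (auto simp: hom_iff)

declare dom_obj [simp] cod_obj [simp]

lemma assoc:
  assumes "f \<in> Arr C" "g \<in> Arr C" "h \<in> Arr C" "Cod C f = Dom C g" "Cod C g = Dom C h"
  shows "(h \<cdot>\<^bsub>C\<^esub> g) \<cdot>\<^bsub>C\<^esub> f = h \<cdot>\<^bsub>C\<^esub> (g \<cdot>\<^bsub>C\<^esub> f)"
  using comp_assoc[of f "Dom C f" "Cod C f" g "Cod C g" h "Cod C h"] assms by (auto simp: hom_iff)

text \<open>Applies an equation between two adjacent factors inside a composite that is associated
  to the right; meant to be used through \<open>THEN\<close>.\<close>

lemma reassoc:
  assumes "h \<cdot>\<^bsub>C\<^esub> g = t"
    and "f \<in> Arr C" "g \<in> Arr C" "h \<in> Arr C" "Cod C f = Dom C g" "Cod C g = Dom C h"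
  shows "h \<cdot>\<^bsub>C\<^esub> (g \<cdot>\<^bsub>C\<^esub> f) = t \<cdot>\<^bsub>C\<^esub> f"
  using assms assoc by metis

lemma hom_obj: "f \<in> hom C X Y \<Longrightarrow> X \<in> Obj C" "f \<in> hom C X Y \<Longrightarrow> Y \<in> Obj C"
  by (auto simp: hom_iff)

lemma monoD:
  assumes "is_mono C m" "m \<cdot>\<^bsub>C\<^esub> u = m \<cdot>\<^bsub>C\<^esub> v" "u \<in> hom C W (Dom C m)" "v \<in> hom C W (Dom C m)"
  shows "u = v"
  using assms by (auto simp: is_mono_def)

lemma coequaliserI:
  assumes f: "f \<in> hom C X Y" "g \<in> hom C X Y" and q: "q \<in> hom C Y Q"
    and eq: "q \<cdot>\<^bsub>C\<^esub> f = q \<cdot>\<^bsub>C\<^esub> g"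
    and univ: "\<And>Z h. h \<in> hom C Y Z \<Longrightarrow> h \<cdot>\<^bsub>C\<^esub> f = h \<cdot>\<^bsub>C\<^esub> g \<Longrightarrow>
      \<exists>!u. u \<in> hom C Q Z \<and> u \<cdot>\<^bsub>C\<^esub> q = h"
  shows "is_coequaliser C f g q"
proof -
  have d: "Cod C f = Y" "Dom C f = X" "Cod C q = Q" using f q by (auto simp: hom_iff)
  show ?thesis
    unfolding is_coequaliser_def d
  proof (intro conjI allI ballI impI)
    show "\<exists>!u. u \<in> hom C Q Z \<and> u \<cdot>\<^bsub>C\<^esub> q = h"
      if "h \<in> hom C Y Z" "h \<cdot>\<^bsub>C\<^esub> f = h \<cdot>\<^bsub>C\<^esub> g" for Z h
      using univ[OF that] .
  qed (use f q eq in \<open>auto simp: hom_iff\<close>)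
qed

lemma coequaliser_univ:
  assumes "is_coequaliser C f g q" "h \<in> hom C (Cod C f) Z" "h \<cdot>\<^bsub>C\<^esub> f = h \<cdot>\<^bsub>C\<^esub> g"
  shows "\<exists>!u. u \<in> hom C (Cod C q) Z \<and> u \<cdot>\<^bsub>C\<^esub> q = h"
  using assms(1)[unfolded is_coequaliser_def] assms(2-3) by blast

lemma regular_epi_arr: "is_regular_epi C q \<Longrightarrow> q \<in> Arr C"
  by (auto simp: is_regular_epi_def is_coequaliser_def)

text \<open>The uniqueness half of the universal property of a coequaliser. Every cancellation of a
  cover rests on it.\<close>

lemma regular_epi_cancel:
  assumes q: "is_regular_epi C q" and u: "u \<in> hom C (Cod C q) Z" and v: "v \<in> hom C (Cod C q) Z"
    and uv: "u \<cdot>\<^bsub>C\<^esub> q = v \<cdot>\<^bsub>C\<^esub> q"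
  shows "u = v"
proof -
  obtain f g where fg: "is_coequaliser C f g q" using q by (auto simp: is_regular_epi_def)
  have "u \<cdot>\<^bsub>C\<^esub> q \<in> hom C (Cod C f) Z" "(u \<cdot>\<^bsub>C\<^esub> q) \<cdot>\<^bsub>C\<^esub> f = (u \<cdot>\<^bsub>C\<^esub> q) \<cdot>\<^bsub>C\<^esub> g"
    using fg u by (auto simp: is_coequaliser_def hom_iff assoc)
  from coequaliser_univ[OF fg this] show ?thesis using u v uv by auto
qed

lemma isoI:
  assumes "f \<in> hom C X Y" "g \<in> hom C Y X" "g \<cdot>\<^bsub>C\<^esub> f = Ident C X" "f \<cdot>\<^bsub>C\<^esub> g = Ident C Y"
  shows "is_iso C f"
  using assms unfolding is_iso_def by (auto simp: hom_iff)

lemma isoE: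
  assumes "is_iso C f"
  obtains g where "g \<in> hom C (Cod C f) (Dom C f)" "g \<cdot>\<^bsub>C\<^esub> f = Ident C (Dom C f)"
    "f \<cdot>\<^bsub>C\<^esub> g = Ident C (Cod C f)"
  using assms unfolding is_iso_def by auto

text \<open>Regular epimorphisms are strong. Since \<open>m\<close> is mono, \<open>t\<close>
  coequalises the pair of which \<open>q\<close> is the coequaliser, so \<open>t\<close> factors
  through \<open>q\<close>; the factor \<open>n\<close> is inverse to \<open>m\<close>.\<close>

lemma regular_epi_factor_mono_iso:
  assumes q: "is_regular_epi C q" and m: "is_mono C m" and t: "t \<in> hom C (Dom C q) (Dom C m)"
    and mt: "m \<cdot>\<^bsub>C\<^esub> t = q"
  shows "is_iso C m"
proof -
  obtain f g where fg: "is_coequaliser C f g q" using q by (auto simp: is_regular_epi_def)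
  have ma: "m \<in> Arr C" and qa: "q \<in> Arr C" using m regular_epi_arr[OF q] by (auto simp: is_mono_def)
  have [simp]: "Cod C q = Cod C m" using mt[symmetric] t ma by (auto simp: hom_iff)
  have a: "f \<in> Arr C" "g \<in> hom C (Dom C f) (Cod C f)" "Dom C q = Cod C f" "q \<cdot>\<^bsub>C\<^esub> f = q \<cdot>\<^bsub>C\<^esub> g"
    using fg by (auto simp: is_coequaliser_def)
  have "m \<cdot>\<^bsub>C\<^esub> (t \<cdot>\<^bsub>C\<^esub> f) = m \<cdot>\<^bsub>C\<^esub> (t \<cdot>\<^bsub>C\<^esub> g)"
    using a ma t by (simp add: hom_iff mt[THEN reassoc])
  then have "t \<cdot>\<^bsub>C\<^esub> f = t \<cdot>\<^bsub>C\<^esub> g"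
    by (rule monoD[OF m, where W = "Dom C f"]) (use a t in \<open>auto simp: hom_iff\<close>)
  then obtain n where n: "n \<in> hom C (Cod C q) (Dom C m)" "n \<cdot>\<^bsub>C\<^esub> q = t"
    using coequaliser_univ[OF fg, of t "Dom C m"] t a(3) by auto
  have "m \<cdot>\<^bsub>C\<^esub> n = Ident C (Cod C q)"
    by (rule regular_epi_cancel[OF q, where Z = "Cod C m"])
      (use n ma qa mt in \<open>auto simp: hom_iff assoc\<close>)
  moreover have "n \<cdot>\<^bsub>C\<^esub> m = Ident C (Dom C m)"
    by (rule monoD[OF m, where W = "Dom C m"])
      (use n ma calculation in \<open>auto simp: hom_iff calculation[THEN reassoc]\<close>)
  ultimately show ?thesis using n ma by (auto intro!: isoI simp: hom_iff)
qed

text \<open>The composite is a coequaliser of the same pair as \<open>q\<close>. It serves when the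
  mono part of an image factorisation has been shown to be invertible.\<close>

lemma regular_epi_iso_comp:
  assumes q: "is_regular_epi C q" and m: "is_iso C m" and mq: "Cod C q = Dom C m"
  shows "is_regular_epi C (m \<cdot>\<^bsub>C\<^esub> q)"
proof -
  obtain f g where fg: "is_coequaliser C f g q" using q by (auto simp: is_regular_epi_def)
  obtain n where n: "n \<in> hom C (Cod C m) (Dom C m)" "n \<cdot>\<^bsub>C\<^esub> m = Ident C (Dom C m)"
    "m \<cdot>\<^bsub>C\<^esub> n = Ident C (Cod C m)" using m by (rule isoE)
  have ma: "m \<in> Arr C" and qa: "q \<in> Arr C" using m regular_epi_arr[OF q] by (auto simp: is_iso_def)
  have a: "f \<in> Arr C" "g \<in> hom C (Dom C f) (Cod C f)" "Dom C q = Cod C f" "q \<cdot>\<^bsub>C\<^esub> f = q \<cdot>\<^bsub>C\<^esub> g"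
    and univ: "\<And>Z h. h \<in> hom C (Cod C f) Z \<Longrightarrow> h \<cdot>\<^bsub>C\<^esub> f = h \<cdot>\<^bsub>C\<^esub> g \<Longrightarrow>
      (\<exists>!u. u \<in> hom C (Cod C q) Z \<and> u \<cdot>\<^bsub>C\<^esub> q = h)"
    using fg by (auto simp: is_coequaliser_def)
  have "\<exists>!u. u \<in> hom C (Cod C m) Z \<and> u \<cdot>\<^bsub>C\<^esub> (m \<cdot>\<^bsub>C\<^esub> q) = h"
    if h: "h \<in> hom C (Cod C f) Z" "h \<cdot>\<^bsub>C\<^esub> f = h \<cdot>\<^bsub>C\<^esub> g" for Z h
  proof -
    obtain u where u: "u \<in> hom C (Cod C q) Z" "u \<cdot>\<^bsub>C\<^esub> q = h" using univ[OF h] by auto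
    show ?thesis
    proof (rule ex1I[of _ "u \<cdot>\<^bsub>C\<^esub> n"])
      show "u \<cdot>\<^bsub>C\<^esub> n \<in> hom C (Cod C m) Z \<and> (u \<cdot>\<^bsub>C\<^esub> n) \<cdot>\<^bsub>C\<^esub> (m \<cdot>\<^bsub>C\<^esub> q) = h"
        using u n ma qa mq by (auto simp: hom_iff assoc n(2)[THEN reassoc])
    next
      fix v assume v: "v \<in> hom C (Cod C m) Z \<and> v \<cdot>\<^bsub>C\<^esub> (m \<cdot>\<^bsub>C\<^esub> q) = h"
      have "v \<cdot>\<^bsub>C\<^esub> m = u"
        by (rule regular_epi_cancel[OF q, where Z = Z])
          (use v u ma qa mq in \<open>auto simp: hom_iff assoc\<close>)
      then show "v = u \<cdot>\<^bsub>C\<^esub> n" using v ma n by (auto simp: hom_iff assoc)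
    qed
  qed
  with _ _ _ _ have "is_coequaliser C f g (m \<cdot>\<^bsub>C\<^esub> q)"
    by (rule coequaliserI[of f "Dom C f" "Cod C f" _ _ "Cod C m"])
      (use a ma qa mq in \<open>auto simp: hom_iff assoc\<close>)
  then show ?thesis by (auto simp: is_regular_epi_def)
qed

section \<open>Equalisers, pullbacks and binary products\<close>

lemma equaliserD:
  assumes "is_equaliser C f g e"
  shows "e \<in> Arr C" "Cod C e = Dom C f" "f \<cdot>\<^bsub>C\<^esub> e = g \<cdot>\<^bsub>C\<^esub> e"
  using assms unfolding is_equaliser_def by auto

lemma equaliser_univ:
  assumes "is_equaliser C f g e" "h \<in> hom C W (Dom C f)" "f \<cdot>\<^bsub>C\<^esub> h = g \<cdot>\<^bsub>C\<^esub> h"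
  shows "\<exists>!u. u \<in> hom C W (Dom C e) \<and> e \<cdot>\<^bsub>C\<^esub> u = h"
  using assms(1)[unfolded is_equaliser_def] assms(2-3) by blast

lemma pullbackD:
  assumes "is_pullback C f g p q"
  shows "f \<in> Arr C" "g \<in> Arr C" "Cod C f = Cod C g" "p \<in> Arr C" "q \<in> Arr C"
    "Dom C q = Dom C p" "Cod C q = Dom C g" "Cod C p = Dom C f" "f \<cdot>\<^bsub>C\<^esub> p = g \<cdot>\<^bsub>C\<^esub> q"
  using assms unfolding is_pullback_def hom_iff by auto

lemma pullbackI:
  assumes fg: "f \<in> hom C X Z" "g \<in> hom C Y Z" and pq: "p \<in> hom C P X" "q \<in> hom C P Y"
    and eq: "f \<cdot>\<^bsub>C\<^esub> p = g \<cdot>\<^bsub>C\<^esub> q"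
    and univ: "\<And>W a b. a \<in> hom C W X \<Longrightarrow> b \<in> hom C W Y \<Longrightarrow> f \<cdot>\<^bsub>C\<^esub> a = g \<cdot>\<^bsub>C\<^esub> b \<Longrightarrow>
      \<exists>!u. u \<in> hom C W P \<and> p \<cdot>\<^bsub>C\<^esub> u = a \<and> q \<cdot>\<^bsub>C\<^esub> u = b"
  shows "is_pullback C f g p q"
proof -
  have d: "Dom C f = X" "Dom C g = Y" "Dom C p = P" using fg pq by (auto simp: hom_iff)
  show ?thesis
    unfolding is_pullback_def d
  proof (intro conjI allI ballI impI)
    show "\<exists>!u. u \<in> hom C W P \<and> p \<cdot>\<^bsub>C\<^esub> u = a \<and> q \<cdot>\<^bsub>C\<^esub> u = b"
      if "a \<in> hom C W X" "b \<in> hom C W Y" "f \<cdot>\<^bsub>C\<^esub> a = g \<cdot>\<^bsub>C\<^esub> b" for W a b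
      using univ[OF that] .
  qed (use fg pq eq in \<open>auto simp: hom_iff\<close>)
qed

lemma pullback_univ:
  assumes "is_pullback C f g p q" "a \<in> hom C W (Dom C f)" "b \<in> hom C W (Dom C g)"
    "f \<cdot>\<^bsub>C\<^esub> a = g \<cdot>\<^bsub>C\<^esub> b"
  shows "\<exists>!u. u \<in> hom C W (Dom C p) \<and> p \<cdot>\<^bsub>C\<^esub> u = a \<and> q \<cdot>\<^bsub>C\<^esub> u = b"
  using assms(1)[unfolded is_pullback_def] assms(2-4) by blast

lemma pullback_lift:
  assumes "is_pullback C f g p q" "a \<in> hom C W (Dom C f)" "b \<in> hom C W (Dom C g)"
    "f \<cdot>\<^bsub>C\<^esub> a = g \<cdot>\<^bsub>C\<^esub> b"
  obtains u where "u \<in> hom C W (Dom C p)" "p \<cdot>\<^bsub>C\<^esub> u = a" "q \<cdot>\<^bsub>C\<^esub> u = b"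
  using pullback_univ[OF assms] by blast

lemma pullback_cancel:
  assumes pb: "is_pullback C f g p q" and u: "u \<in> hom C W (Dom C p)" and v: "v \<in> hom C W (Dom C p)"
    and eq: "p \<cdot>\<^bsub>C\<^esub> u = p \<cdot>\<^bsub>C\<^esub> v" "q \<cdot>\<^bsub>C\<^esub> u = q \<cdot>\<^bsub>C\<^esub> v"
  shows "u = v"
proof -
  note pbd = pullbackD[OF pb]
  have "p \<cdot>\<^bsub>C\<^esub> u \<in> hom C W (Dom C f)" "q \<cdot>\<^bsub>C\<^esub> u \<in> hom C W (Dom C g)"
    "f \<cdot>\<^bsub>C\<^esub> (p \<cdot>\<^bsub>C\<^esub> u) = g \<cdot>\<^bsub>C\<^esub> (q \<cdot>\<^bsub>C\<^esub> u)"
    using pbd(1-8) u by (auto simp: hom_iff assoc pbd(9)[THEN reassoc])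
  from pullback_univ[OF pb this] show ?thesis using u v eq by auto
qed

text \<open>Inverse images of subobjects are subobjects; it is such an inverse image that is later
  shown to be everything by \<open>point_mono_iso\<close>.\<close>

lemma pullback_mono:
  assumes pb: "is_pullback C f g p q" and g: "is_mono C g"
  shows "is_mono C p"
  unfolding is_mono_def
proof (intro conjI allI ballI impI)
  note pbd = pullbackD[OF pb]
  show "p \<in> Arr C" by fact
  fix W u v assume uv: "u \<in> hom C W (Dom C p)" "v \<in> hom C W (Dom C p)" "p \<cdot>\<^bsub>C\<^esub> u = p \<cdot>\<^bsub>C\<^esub> v"
  have "g \<cdot>\<^bsub>C\<^esub> (q \<cdot>\<^bsub>C\<^esub> u) = g \<cdot>\<^bsub>C\<^esub> (q \<cdot>\<^bsub>C\<^esub> v)"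
    using pbd(1-8) uv by (simp add: hom_iff pbd(9)[symmetric, THEN reassoc] assoc)
  then have "q \<cdot>\<^bsub>C\<^esub> u = q \<cdot>\<^bsub>C\<^esub> v"
    by (rule monoD[OF g, where W = W]) (use uv pbd in \<open>auto simp: hom_iff\<close>)
  then show "u = v" using pullback_cancel[OF pb] uv by blast
qed

text \<open>Existence and uniqueness of pairings are separated, since the latter is used on its own
  to compare two morphisms into a product.\<close>

lemma pair_product:
  assumes "has_finite_products C" "X \<in> Obj C" "Y \<in> Obj C"
  obtains P p q where "p \<in> hom C P X" "q \<in> hom C P Y"
    "\<And>W a b. a \<in> hom C W X \<Longrightarrow> b \<in> hom C W Y \<Longrightarrow>
      \<exists>u \<in> hom C W P. p \<cdot>\<^bsub>C\<^esub> u = a \<and> q \<cdot>\<^bsub>C\<^esub> u = b"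
    "\<And>W u v. u \<in> hom C W P \<Longrightarrow> v \<in> hom C W P \<Longrightarrow> p \<cdot>\<^bsub>C\<^esub> u = p \<cdot>\<^bsub>C\<^esub> v \<Longrightarrow>
      q \<cdot>\<^bsub>C\<^esub> u = q \<cdot>\<^bsub>C\<^esub> v \<Longrightarrow> u = v"
proof -
  obtain P ps where P: "is_product C [X, Y] P ps"
    using assms unfolding has_finite_products_def by (metis empty_subsetI insert_subset list.set)
  obtain p q where ps: "ps = [p, q]" "p \<in> hom C P X" "q \<in> hom C P Y"
    using P unfolding is_product_def by (auto simp: list_all2_Cons1)
  have univ: "\<exists>!h. h \<in> hom C W P \<and> p \<cdot>\<^bsub>C\<^esub> h = a \<and> q \<cdot>\<^bsub>C\<^esub> h = b"
    if "a \<in> hom C W X" "b \<in> hom C W Y" for W a b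
    using P that hom_obj(1)[OF that(1)] unfolding is_product_def ps(1)
    by (auto dest!: bspec[where x = W] spec[where x = "[a, b]"])
  show thesis
  proof (rule that[OF ps(2,3)])
    show "\<exists>u \<in> hom C W P. p \<cdot>\<^bsub>C\<^esub> u = a \<and> q \<cdot>\<^bsub>C\<^esub> u = b" if "a \<in> hom C W X" "b \<in> hom C W Y" for W a b
      using univ[OF that] by auto
    show "u = v" if "u \<in> hom C W P" "v \<in> hom C W P" "p \<cdot>\<^bsub>C\<^esub> u = p \<cdot>\<^bsub>C\<^esub> v" "q \<cdot>\<^bsub>C\<^esub> u = q \<cdot>\<^bsub>C\<^esub> v" for W u v
      using univ[of "p \<cdot>\<^bsub>C\<^esub> u" W "q \<cdot>\<^bsub>C\<^esub> u"] that comp_hom ps by metis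
  qed
qed

end

section \<open>Pullbacks and image factorisations in a regular category\<close>

context regular_category
begin

text \<open>\<open>regular_category\<close> asks for finite products and equalisers, so pullbacks
  are constructed: the equaliser of the two composites from the product of \<open>X\<close> and
  \<open>Y\<close> to \<open>Z\<close>.\<close>

lemma ex_pullback:
  assumes "f \<in> hom C X Z" "g \<in> hom C Y Z"
  shows "\<exists>p q. is_pullback C f g p q"
proof -
  obtain P \<pi>\<^sub>1 \<pi>\<^sub>2 where P: "\<pi>\<^sub>1 \<in> hom C P X" "\<pi>\<^sub>2 \<in> hom C P Y"
    "\<And>W a b. a \<in> hom C W X \<Longrightarrow> b \<in> hom C W Y \<Longrightarrow>
      \<exists>u \<in> hom C W P. \<pi>\<^sub>1 \<cdot>\<^bsub>C\<^esub> u = a \<and> \<pi>\<^sub>2 \<cdot>\<^bsub>C\<^esub> u = b"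
    "\<And>W u v. u \<in> hom C W P \<Longrightarrow> v \<in> hom C W P \<Longrightarrow> \<pi>\<^sub>1 \<cdot>\<^bsub>C\<^esub> u = \<pi>\<^sub>1 \<cdot>\<^bsub>C\<^esub> v \<Longrightarrow>
      \<pi>\<^sub>2 \<cdot>\<^bsub>C\<^esub> u = \<pi>\<^sub>2 \<cdot>\<^bsub>C\<^esub> v \<Longrightarrow> u = v"
    by (rule pair_product[OF finite_products hom_obj(1)[OF assms(1)] hom_obj(1)[OF assms(2)]]) blast
  obtain e where e: "is_equaliser C (f \<cdot>\<^bsub>C\<^esub> \<pi>\<^sub>1) (g \<cdot>\<^bsub>C\<^esub> \<pi>\<^sub>2) e"
    using equalisers assms P(1,2) unfolding has_equalisers_def by (fastforce simp: hom_iff)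
  have e1: "e \<in> Arr C" "Cod C e = P" "f \<cdot>\<^bsub>C\<^esub> (\<pi>\<^sub>1 \<cdot>\<^bsub>C\<^esub> e) = g \<cdot>\<^bsub>C\<^esub> (\<pi>\<^sub>2 \<cdot>\<^bsub>C\<^esub> e)"
    using e assms P(1,2) unfolding is_equaliser_def by (auto simp: hom_iff assoc)
  have "\<exists>!u. u \<in> hom C W (Dom C e) \<and> \<pi>\<^sub>1 \<cdot>\<^bsub>C\<^esub> e \<cdot>\<^bsub>C\<^esub> u = a \<and> \<pi>\<^sub>2 \<cdot>\<^bsub>C\<^esub> e \<cdot>\<^bsub>C\<^esub> u = b"
    if ab: "a \<in> hom C W X" "b \<in> hom C W Y" "f \<cdot>\<^bsub>C\<^esub> a = g \<cdot>\<^bsub>C\<^esub> b" for W a b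
  proof -
    obtain w where w: "w \<in> hom C W P" "\<pi>\<^sub>1 \<cdot>\<^bsub>C\<^esub> w = a" "\<pi>\<^sub>2 \<cdot>\<^bsub>C\<^esub> w = b" using P(3)[OF ab(1,2)] by auto
    have "w \<in> hom C W (Dom C (f \<cdot>\<^bsub>C\<^esub> \<pi>\<^sub>1))" "(f \<cdot>\<^bsub>C\<^esub> \<pi>\<^sub>1) \<cdot>\<^bsub>C\<^esub> w = (g \<cdot>\<^bsub>C\<^esub> \<pi>\<^sub>2) \<cdot>\<^bsub>C\<^esub> w"
      using ab w P(1,2) assms by (auto simp: hom_iff assoc)
    then have ex1: "\<exists>!u. u \<in> hom C W (Dom C e) \<and> e \<cdot>\<^bsub>C\<^esub> u = w"
      using e unfolding is_equaliser_def by metis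
    then obtain u where u: "u \<in> hom C W (Dom C e)" "e \<cdot>\<^bsub>C\<^esub> u = w" by auto
    show ?thesis
    proof (rule ex1I[of _ u])
      show "u \<in> hom C W (Dom C e) \<and> \<pi>\<^sub>1 \<cdot>\<^bsub>C\<^esub> e \<cdot>\<^bsub>C\<^esub> u = a \<and> \<pi>\<^sub>2 \<cdot>\<^bsub>C\<^esub> e \<cdot>\<^bsub>C\<^esub> u = b"
        using u w e1 P(1,2) by (auto simp: hom_iff assoc)
    next
      fix v assume v: "v \<in> hom C W (Dom C e) \<and> \<pi>\<^sub>1 \<cdot>\<^bsub>C\<^esub> e \<cdot>\<^bsub>C\<^esub> v = a \<and> \<pi>\<^sub>2 \<cdot>\<^bsub>C\<^esub> e \<cdot>\<^bsub>C\<^esub> v = b"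
      have "e \<cdot>\<^bsub>C\<^esub> v = w"
        by (rule P(4)[where W = W]) (use v u w e1 P(1,2) in \<open>auto simp: hom_iff assoc\<close>)
      then show "v = u" using ex1 u v by auto
    qed
  qed
  with assms _ _ _ have "is_pullback C f g (\<pi>\<^sub>1 \<cdot>\<^bsub>C\<^esub> e) (\<pi>\<^sub>2 \<cdot>\<^bsub>C\<^esub> e)"
    by (rule pullbackI[where P = "Dom C e"])
      (use assms P(1,2) e1 in \<open>auto simp: hom_iff assoc\<close>)
  then show ?thesis by auto
qed

text \<open>The mono part arises by factoring \<open>f\<close> through the coequaliser
  \<open>q\<close> of its kernel pair. That it is mono is tested after covering the test object:
  pulling back \<open>q\<close> twice gives regular epimorphisms along which both test morphisms
  factor through \<open>q\<close>.\<close>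

lemma regular_epi_mono_factorisation:
  assumes f: "f \<in> hom C X Y"
  obtains q m where "is_regular_epi C q" "is_mono C m" "q \<in> hom C X (Dom C m)" "m \<cdot>\<^bsub>C\<^esub> q = f"
    "Cod C m = Y"
proof -
  obtain r s where rs: "is_pullback C f f r s" using ex_pullback[OF f f] by auto
  obtain q where q: "is_coequaliser C r s q" using kernel_pair_coequaliser[OF rs] by auto
  then have reg: "is_regular_epi C q" by (auto simp: is_regular_epi_def)
  note rsd = pullbackD[OF rs]
  have qh: "q \<in> hom C X (Cod C q)" using q f rsd unfolding is_coequaliser_def hom_iff by auto
  have qrs: "q \<cdot>\<^bsub>C\<^esub> r = q \<cdot>\<^bsub>C\<^esub> s" using q unfolding is_coequaliser_def by auto
  obtain m where m: "m \<in> hom C (Cod C q) Y" "m \<cdot>\<^bsub>C\<^esub> q = f"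
    using coequaliser_univ[OF q, of f Y] f rsd by (auto simp: hom_iff)
  have "is_mono C m" unfolding is_mono_def
  proof (intro conjI allI ballI impI)
    show "m \<in> Arr C" using m by (auto simp: hom_iff)
    fix W u v assume uv: "u \<in> hom C W (Dom C m)" "v \<in> hom C W (Dom C m)" "m \<cdot>\<^bsub>C\<^esub> u = m \<cdot>\<^bsub>C\<^esub> v"
    \<comment> \<open>After composition with \<open>w\<^sub>1\<close> and \<open>w\<^sub>2\<close>,
      the morphism \<open>u\<close> becomes \<open>q\<close> after \<open>a w\<^sub>2\<close> and
      \<open>v\<close> becomes \<open>q\<close> after \<open>b\<close>. Both covers are regular
      epimorphisms by stability, hence can be cancelled at the end.\<close>
    have dm: "Dom C m = Cod C q" using m by (auto simp: hom_iff)
    obtain w\<^sub>1 a where 1: "is_pullback C u q w\<^sub>1 a" using ex_pullback[of u W "Cod C q" q X] uv qh dm by auto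
    note d1 = pullbackD[OF 1]
    have r1: "is_regular_epi C w\<^sub>1" using regular_epi_stable[OF 1 reg] .
    obtain w\<^sub>2 b where 2: "is_pullback C (v \<cdot>\<^bsub>C\<^esub> w\<^sub>1) q w\<^sub>2 b"
      using ex_pullback[of "v \<cdot>\<^bsub>C\<^esub> w\<^sub>1" "Dom C w\<^sub>1" "Cod C q" q X] uv qh dm d1 by (auto simp: hom_iff)
    note d2 = pullbackD[OF 2]
    have r2: "is_regular_epi C w\<^sub>2" using regular_epi_stable[OF 2 reg] .
    have uvh: "u \<in> Arr C" "v \<in> Arr C" "Dom C u = W" "Dom C v = W" "Cod C u = Cod C q" "Cod C v = Cod C q"
      using uv dm by (auto simp: hom_iff)
    have qa: "q \<in> Arr C" "Dom C q = X" "f \<in> Arr C" "Dom C f = X" "Cod C f = Y" "m \<in> Arr C" "Cod C m = Y"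
      using qh f m by (auto simp: hom_iff)
    have v2: "v \<cdot>\<^bsub>C\<^esub> (w\<^sub>1 \<cdot>\<^bsub>C\<^esub> w\<^sub>2) = q \<cdot>\<^bsub>C\<^esub> b"
      using d2 uvh d1 by (simp add: assoc)
    have "f \<cdot>\<^bsub>C\<^esub> (a \<cdot>\<^bsub>C\<^esub> w\<^sub>2) = m \<cdot>\<^bsub>C\<^esub> (u \<cdot>\<^bsub>C\<^esub> (w\<^sub>1 \<cdot>\<^bsub>C\<^esub> w\<^sub>2))"
      using m(2) d1 d2 uvh qa dm by (simp add: assoc m(2)[symmetric] d1(9)[THEN reassoc])
    also have "\<dots> = m \<cdot>\<^bsub>C\<^esub> (v \<cdot>\<^bsub>C\<^esub> (w\<^sub>1 \<cdot>\<^bsub>C\<^esub> w\<^sub>2))"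
      using d1 d2 uvh qa dm uv(3) by (simp add: assoc uv(3)[THEN reassoc])
    also have "\<dots> = f \<cdot>\<^bsub>C\<^esub> b"
      using m(2) d1 d2 uvh qa dm by (simp add: assoc v2 m(2)[symmetric])
    finally have "f \<cdot>\<^bsub>C\<^esub> (a \<cdot>\<^bsub>C\<^esub> w\<^sub>2) = f \<cdot>\<^bsub>C\<^esub> b" .
    \<comment> \<open>The two lifts have the same image under \<open>f\<close>, so they define a
      generalised element \<open>t\<close> of the kernel pair, which \<open>q\<close>
      coequalises.\<close>
    then obtain t where t: "t \<in> hom C (Dom C w\<^sub>2) (Dom C r)" "r \<cdot>\<^bsub>C\<^esub> t = a \<cdot>\<^bsub>C\<^esub> w\<^sub>2" "s \<cdot>\<^bsub>C\<^esub> t = b"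
      by (rule pullback_lift[OF rs, where W = "Dom C w\<^sub>2", rotated 2])
        (use d1 d2 uvh qa in \<open>auto simp: hom_iff\<close>)
    have "q \<cdot>\<^bsub>C\<^esub> (a \<cdot>\<^bsub>C\<^esub> w\<^sub>2) = q \<cdot>\<^bsub>C\<^esub> b"
      using t rsd qa by (simp add: t(2,3)[symmetric] hom_iff qrs[THEN reassoc] assoc)
    then have "(u \<cdot>\<^bsub>C\<^esub> w\<^sub>1) \<cdot>\<^bsub>C\<^esub> w\<^sub>2 = (v \<cdot>\<^bsub>C\<^esub> w\<^sub>1) \<cdot>\<^bsub>C\<^esub> w\<^sub>2"
      using d1 d2 uvh qa by (simp add: assoc d1(9)[THEN reassoc])
    then have "u \<cdot>\<^bsub>C\<^esub> w\<^sub>1 = v \<cdot>\<^bsub>C\<^esub> w\<^sub>1"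
      by (rule regular_epi_cancel[OF r2, where Z = "Cod C q", rotated 2]) (use d1 d2 uvh in \<open>auto simp: hom_iff\<close>)
    then show "u = v"
      by (rule regular_epi_cancel[OF r1, where Z = "Cod C q", rotated 2]) (use d1 d2 uvh in \<open>auto simp: hom_iff\<close>)
  qed
  then show ?thesis using that[of q m] reg m qh by (auto simp: hom_iff)
qed

end

section \<open>Pointed and semi-abelian categories\<close>

lemma is_zeroD:
  assumes "is_zero C Z" "X \<in> Obj C"
  shows "\<exists>f. f \<in> hom C X Z" "\<exists>f. f \<in> hom C Z X"
    "f \<in> hom C X Z \<Longrightarrow> g \<in> hom C X Z \<Longrightarrow> f = g" "f' \<in> hom C Z X \<Longrightarrow> g' \<in> hom C Z X \<Longrightarrow> f' = g'"
proof -
  have *: "\<exists>!f. f \<in> hom C X Z" "\<exists>!f. f \<in> hom C Z X" using assms unfolding is_zero_def by auto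
  show "\<exists>f. f \<in> hom C X Z" "\<exists>f. f \<in> hom C Z X" using * by auto
  show "f = g" if "f \<in> hom C X Z" "g \<in> hom C X Z" using *(1) that by auto
  show "f' = g'" if "f' \<in> hom C Z X" "g' \<in> hom C Z X" using *(2) that by auto
qed

context pointed_category
begin

text \<open>\<open>zero_map\<close> is a definite description ranging over all zero objects, so
  independence of the choice is needed: the morphism \<open>t\<close> between two zero objects
  carries one factorisation to the other.\<close>

lemma zero_map_eq:
  assumes Z: "is_zero C Z" and uv: "u \<in> hom C X Z" "v \<in> hom C Z Y"
  shows "zero_map C X Y = v \<cdot>\<^bsub>C\<^esub> u"
  unfolding zero_map_def
proof (rule the_equality)
  show "\<exists>Z u' v'. is_zero C Z \<and> u' \<in> hom C X Z \<and> v' \<in> hom C Z Y \<and> v \<cdot>\<^bsub>C\<^esub> u = v' \<cdot>\<^bsub>C\<^esub> u'"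
    using assms by blast
next
  fix h assume "\<exists>Z u v. is_zero C Z \<and> u \<in> hom C X Z \<and> v \<in> hom C Z Y \<and> h = v \<cdot>\<^bsub>C\<^esub> u"
  then obtain Z' u' v' where Z': "is_zero C Z'" "u' \<in> hom C X Z'" "v' \<in> hom C Z' Y" "h = v' \<cdot>\<^bsub>C\<^esub> u'"
    by blast
  have "Z \<in> Obj C" using Z by (simp add: is_zero_def)
  then obtain t where t: "t \<in> hom C Z Z'" using is_zeroD(1)[OF Z'(1)] by blast
  have "t \<cdot>\<^bsub>C\<^esub> u \<in> hom C X Z'" "v' \<cdot>\<^bsub>C\<^esub> t \<in> hom C Z Y" using t uv Z' comp_hom by auto
  moreover have "X \<in> Obj C" "Y \<in> Obj C" using uv hom_obj by auto
  ultimately have "t \<cdot>\<^bsub>C\<^esub> u = u'" "v' \<cdot>\<^bsub>C\<^esub> t = v"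
    using is_zeroD(3)[OF Z'(1)] is_zeroD(4)[OF Z] Z'(2) uv(2) by auto
  then show "h = v \<cdot>\<^bsub>C\<^esub> u" using Z'(4) comp_assoc[OF uv(1) t Z'(3)] by simp
qed

lemma zero_map_hom:
  assumes "X \<in> Obj C" "Y \<in> Obj C"
  shows "zero_map C X Y \<in> hom C X Y"
proof -
  obtain Z where Z: "is_zero C Z" using ex_zero by blast
  then obtain u v where "u \<in> hom C X Z" "v \<in> hom C Z Y"
    using is_zeroD(1)[OF Z assms(1)] is_zeroD(2)[OF Z assms(2)] by blast
  then show ?thesis using zero_map_eq[OF Z] comp_hom by auto
qed

lemma zero_map_simps [simp]:
  assumes "X \<in> Obj C" "Y \<in> Obj C"
  shows "zero_map C X Y \<in> Arr C" "Dom C (zero_map C X Y) = X" "Cod C (zero_map C X Y) = Y"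
  using zero_map_hom[OF assms] by (auto simp: hom_iff)

lemma comp_zero [simp]:
  assumes "f \<in> Arr C" "Dom C f = Y" "X \<in> Obj C"
  shows "f \<cdot>\<^bsub>C\<^esub> zero_map C X Y = zero_map C X (Cod C f)"
proof -
  obtain Z where Z: "is_zero C Z" using ex_zero by blast
  obtain u v where uv: "u \<in> hom C X Z" "v \<in> hom C Z Y" using is_zeroD(1,2)[OF Z] assms by (metis dom_obj)
  have "f \<cdot>\<^bsub>C\<^esub> v \<in> hom C Z (Cod C f)" using uv assms by (auto simp: hom_iff)
  then show ?thesis
    using zero_map_eq[OF Z uv] zero_map_eq[OF Z uv(1), of "f \<cdot>\<^bsub>C\<^esub> v"] uv assms by (auto simp: hom_iff assoc)
qed

lemma zero_comp [simp]:
  assumes "f \<in> Arr C" "Cod C f = X" "Y \<in> Obj C"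
  shows "zero_map C X Y \<cdot>\<^bsub>C\<^esub> f = zero_map C (Dom C f) Y"
proof -
  obtain Z where Z: "is_zero C Z" using ex_zero by blast
  obtain u v where uv: "u \<in> hom C X Z" "v \<in> hom C Z Y" using is_zeroD(1,2)[OF Z] assms by (metis cod_obj)
  have "u \<cdot>\<^bsub>C\<^esub> f \<in> hom C (Dom C f) Z" using uv assms by (auto simp: hom_iff)
  then show ?thesis
    using zero_map_eq[OF Z uv] zero_map_eq[OF Z _ uv(2), of "u \<cdot>\<^bsub>C\<^esub> f"] uv assms by (auto simp: hom_iff assoc)
qed

lemma hom_into_zero:
  assumes "is_zero C Z" "f \<in> hom C X Z"
  shows "f = zero_map C X Z"
  using is_zeroD(3)[OF assms(1) hom_obj(1)[OF assms(2)] assms(2) zero_map_hom] hom_obj[OF assms(2)] by blast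

lemma kernelD:
  assumes "is_kernel C k f"
  shows "f \<in> Arr C" "k \<in> Arr C" "Cod C k = Dom C f" "f \<cdot>\<^bsub>C\<^esub> k = zero_map C (Dom C k) (Cod C f)"
  using assms unfolding is_kernel_def by auto

lemma kernel_univ:
  assumes "is_kernel C k f" "h \<in> hom C W (Dom C f)" "f \<cdot>\<^bsub>C\<^esub> h = zero_map C W (Cod C f)"
  shows "\<exists>!u. u \<in> hom C W (Dom C k) \<and> k \<cdot>\<^bsub>C\<^esub> u = h"
  using assms(1)[unfolded is_kernel_def] assms(2,3) by blast

lemma kernel_lift:
  assumes "is_kernel C k f" "h \<in> hom C W (Dom C f)" "f \<cdot>\<^bsub>C\<^esub> h = zero_map C W (Cod C f)"
  obtains u where "u \<in> hom C W (Dom C k)" "k \<cdot>\<^bsub>C\<^esub> u = h"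
  using kernel_univ[OF assms] by blast

lemma kernel_mono:
  assumes k: "is_kernel C k f"
  shows "is_mono C k"
  unfolding is_mono_def
proof (intro conjI allI ballI impI)
  note kd = kernelD[OF k]
  show "k \<in> Arr C" by fact
  fix W u v assume uv: "u \<in> hom C W (Dom C k)" "v \<in> hom C W (Dom C k)" "k \<cdot>\<^bsub>C\<^esub> u = k \<cdot>\<^bsub>C\<^esub> v"
  have "k \<cdot>\<^bsub>C\<^esub> v \<in> hom C W (Dom C f)" "f \<cdot>\<^bsub>C\<^esub> (k \<cdot>\<^bsub>C\<^esub> v) = zero_map C W (Cod C f)"
    using kd uv(2) by (auto simp: hom_iff kd(4)[THEN reassoc])
  from kernel_univ[OF k this] show "u = v" using uv by auto
qed

lemma kernelI:
  assumes f: "f \<in> hom C X Y" and k: "k \<in> hom C N X" and fk: "f \<cdot>\<^bsub>C\<^esub> k = zero_map C N Y"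
    and m: "is_mono C k"
    and univ: "\<And>W h. h \<in> hom C W X \<Longrightarrow> f \<cdot>\<^bsub>C\<^esub> h = zero_map C W Y \<Longrightarrow> \<exists>u \<in> hom C W N. k \<cdot>\<^bsub>C\<^esub> u = h"
  shows "is_kernel C k f"
proof -
  have d: "Dom C f = X" "Cod C f = Y" "Dom C k = N" using f k by (auto simp: hom_iff)
  show ?thesis
    unfolding is_kernel_def d
  proof (intro conjI allI ballI impI)
    show "\<exists>!u. u \<in> hom C W N \<and> k \<cdot>\<^bsub>C\<^esub> u = h" if h: "h \<in> hom C W X" "f \<cdot>\<^bsub>C\<^esub> h = zero_map C W Y" for W h
      using univ[OF h] monoD[OF m] d(3) by auto
  qed (use f k fk in \<open>auto simp: hom_iff\<close>)
qed

lemma cokernelI: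
  assumes k: "k \<in> hom C N X" and f: "f \<in> hom C X Y" and fk: "f \<cdot>\<^bsub>C\<^esub> k = zero_map C N Y"
    and univ: "\<And>Z h. h \<in> hom C X Z \<Longrightarrow> h \<cdot>\<^bsub>C\<^esub> k = zero_map C N Z \<Longrightarrow>
      \<exists>!u. u \<in> hom C Y Z \<and> u \<cdot>\<^bsub>C\<^esub> f = h"
  shows "is_cokernel C f k"
proof -
  have d: "Cod C k = X" "Cod C f = Y" "Dom C k = N" using f k by (auto simp: hom_iff)
  show ?thesis
    unfolding is_cokernel_def d
  proof (intro conjI allI ballI impI)
    show "\<exists>!u. u \<in> hom C Y Z \<and> u \<cdot>\<^bsub>C\<^esub> f = h"
      if "h \<in> hom C X Z" "h \<cdot>\<^bsub>C\<^esub> k = zero_map C N Z" for Z h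
      using univ[OF that] .
  qed (use f k fk in \<open>auto simp: hom_iff\<close>)
qed

lemma cokernel_univ:
  assumes "is_cokernel C f k" "h \<in> hom C (Cod C k) Z" "h \<cdot>\<^bsub>C\<^esub> k = zero_map C (Dom C k) Z"
  shows "\<exists>!u. u \<in> hom C (Cod C f) Z \<and> u \<cdot>\<^bsub>C\<^esub> f = h"
  using assms(1)[unfolded is_cokernel_def] assms(2,3) by blast

end

section \<open>Consequences of protomodularity\<close>

context semi_abelian_category
begin

text \<open>A kernel is an equaliser with the zero morphism; its existence gives the
  \<open>SOME\<close> in \<open>kernel\<close> a meaning.\<close>

lemma kernel_is_kernel:
  assumes f: "f \<in> Arr C"
  shows "is_kernel C (kernel C f) f"
proof -
  let ?z = "zero_map C (Dom C f) (Cod C f)"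
  have "?z \<in> hom C (Dom C f) (Cod C f)" using f zero_map_hom by simp
  then obtain e where e: "is_equaliser C f ?z e"
    using equalisers f unfolding has_equalisers_def by blast
  note ed = equaliserD[OF e]
  have "is_kernel C e f"
    unfolding is_kernel_def
  proof (intro conjI allI ballI impI)
    show "\<exists>!u. u \<in> hom C W (Dom C e) \<and> e \<cdot>\<^bsub>C\<^esub> u = h"
      if h: "h \<in> hom C W (Dom C f)" "f \<cdot>\<^bsub>C\<^esub> h = zero_map C W (Cod C f)" for W h
    proof -
      have "f \<cdot>\<^bsub>C\<^esub> h = ?z \<cdot>\<^bsub>C\<^esub> h" using h f by (auto simp: hom_iff)
      then show ?thesis using equaliser_univ[OF e h(1)] by blast
    qed
  qed (use ed f in auto)
  then show ?thesis unfolding kernel_def by (rule someI)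
qed

text \<open>
  In a protomodular category the kernel and the section of a split epimorphism are jointly
  extremal: change of base along \<open>0 \<rightarrow> B\<close> reflects isomorphisms.
\<close>

lemma point_mono_iso:
  assumes p: "p \<in> hom C E B" "s \<in> hom C B E" "p \<cdot>\<^bsub>C\<^esub> s = Ident C B"
    and k: "is_kernel C \<kappa> p" and m: "is_mono C m" "Cod C m = E"
    and k0: "\<kappa>\<^sub>0 \<in> hom C (Dom C \<kappa>) (Dom C m)" "m \<cdot>\<^bsub>C\<^esub> \<kappa>\<^sub>0 = \<kappa>"
    and s0: "s\<^sub>0 \<in> hom C B (Dom C m)" "m \<cdot>\<^bsub>C\<^esub> s\<^sub>0 = s"
  shows "is_iso C m"
proof -
  obtain Z where Z: "is_zero C Z" using ex_zero by blast
  have Zo [simp]: "Z \<in> Obj C" using Z by (auto simp: is_zero_def)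
  have Bo [simp]: "B \<in> Obj C" using hom_obj p by blast
  have ma [simp]: "m \<in> Arr C" using m by (auto simp: is_mono_def)
  note kd = kernelD[OF k]
  have da: "p \<in> Arr C" "s \<in> Arr C" "Dom C p = E" "Cod C p = B" "Dom C s = B" "Cod C s = E"
    "\<kappa>\<^sub>0 \<in> Arr C" "Dom C \<kappa>\<^sub>0 = Dom C \<kappa>" "Cod C \<kappa>\<^sub>0 = Dom C m"
    "s\<^sub>0 \<in> Arr C" "Dom C s\<^sub>0 = B" "Cod C s\<^sub>0 = Dom C m" "Cod C \<kappa> = E"
    using p k0 s0 kd by (auto simp: hom_iff)
  let ?v = "zero_map C Z B" and ?a = "zero_map C (Dom C \<kappa>) Z"
  \<comment> \<open>With \<open>s\<^sub>0\<close> as section, \<open>p m\<close> is again a point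
    over \<open>B\<close>, and \<open>m\<close> is a morphism from it to \<open>(p, s)\<close>. As
    \<open>m\<close> is mono, \<open>\<kappa>\<^sub>0\<close> is a kernel of \<open>p m\<close>; so
    pulling back along \<open>0 \<rightarrow> B\<close> gives the same object for both points, and
    the induced comparison is an identity.\<close>
  have "is_point C B (p \<cdot>\<^bsub>C\<^esub> m) s\<^sub>0"
    unfolding is_point_def using da s0(2) p(3) m(2) by (intro exI[of _ "Dom C m"]) (auto simp: hom_iff assoc)
  moreover have "is_point C B p s" unfolding is_point_def using p by blast
  moreover have "is_pullback C ?v (p \<cdot>\<^bsub>C\<^esub> m) ?a \<kappa>\<^sub>0"
  proof (rule pullbackI[where X = Z and Z = B and Y = "Dom C m" and P = "Dom C \<kappa>"])
    fix W a b assume ab: "a \<in> hom C W Z" "b \<in> hom C W (Dom C m)" "?v \<cdot>\<^bsub>C\<^esub> a = p \<cdot>\<^bsub>C\<^esub> m \<cdot>\<^bsub>C\<^esub> b"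
    have "m \<cdot>\<^bsub>C\<^esub> b \<in> hom C W (Dom C p)" "p \<cdot>\<^bsub>C\<^esub> (m \<cdot>\<^bsub>C\<^esub> b) = zero_map C W (Cod C p)"
      using ab da m(2) by (auto simp: hom_iff assoc)
    from kernel_univ[OF k this]
    obtain u where u: "u \<in> hom C W (Dom C \<kappa>)" "\<kappa> \<cdot>\<^bsub>C\<^esub> u = m \<cdot>\<^bsub>C\<^esub> b" by blast
    have "m \<cdot>\<^bsub>C\<^esub> (\<kappa>\<^sub>0 \<cdot>\<^bsub>C\<^esub> u) = m \<cdot>\<^bsub>C\<^esub> b"
      using u da m(2) by (simp add: hom_iff k0(2)[THEN reassoc])
    then have "\<kappa>\<^sub>0 \<cdot>\<^bsub>C\<^esub> u = b"
      by (rule monoD[OF m(1), where W = W]) (use u ab da in \<open>auto simp: hom_iff\<close>)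
    moreover have "?a \<cdot>\<^bsub>C\<^esub> u = a" 
      using u kd by (simp add: hom_iff hom_into_zero[OF Z ab(1), symmetric])
    moreover have "v = u" if v: "v \<in> hom C W (Dom C \<kappa>)" "\<kappa>\<^sub>0 \<cdot>\<^bsub>C\<^esub> v = b" for v
    proof (rule monoD[OF kernel_mono[OF k], where W = W])
      show "\<kappa> \<cdot>\<^bsub>C\<^esub> v = \<kappa> \<cdot>\<^bsub>C\<^esub> u"
        using u(2) v da m(2) by (simp add: k0(2)[THEN reassoc, symmetric] hom_iff)
    qed (use u v in auto)
    ultimately show "\<exists>!u. u \<in> hom C W (Dom C \<kappa>) \<and> ?a \<cdot>\<^bsub>C\<^esub> u = a \<and> \<kappa>\<^sub>0 \<cdot>\<^bsub>C\<^esub> u = b"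
      using u by blast
  qed (use da kd k0 m(2) in \<open>auto simp: hom_iff assoc\<close>)
  moreover have "is_pullback C ?v p ?a \<kappa>"
  proof (rule pullbackI[where X = Z and Z = B and Y = E and P = "Dom C \<kappa>"])
    fix W a b assume ab: "a \<in> hom C W Z" "b \<in> hom C W E" "?v \<cdot>\<^bsub>C\<^esub> a = p \<cdot>\<^bsub>C\<^esub> b"
    have "b \<in> hom C W (Dom C p)" "p \<cdot>\<^bsub>C\<^esub> b = zero_map C W (Cod C p)"
      using ab da by (auto simp: hom_iff)
    from kernel_univ[OF k this]
    have "\<exists>!u. u \<in> hom C W (Dom C \<kappa>) \<and> \<kappa> \<cdot>\<^bsub>C\<^esub> u = b" .
    moreover have "?a \<cdot>\<^bsub>C\<^esub> u = a" if "u \<in> hom C W (Dom C \<kappa>)" for u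
      using that kd by (simp add: hom_iff hom_into_zero[OF Z ab(1), symmetric])
    ultimately show "\<exists>!u. u \<in> hom C W (Dom C \<kappa>) \<and> ?a \<cdot>\<^bsub>C\<^esub> u = a \<and> \<kappa> \<cdot>\<^bsub>C\<^esub> u = b"
      by blast
  qed (use da kd in \<open>auto simp: hom_iff assoc\<close>)
  moreover have "is_iso C (Ident C (Dom C \<kappa>))"
    using kd by (intro isoI[where g = "Ident C (Dom C \<kappa>)" and X = "Dom C \<kappa>" and Y = "Dom C \<kappa>"]) (auto simp: hom_iff)
  moreover have "m \<in> hom C (Dom C (p \<cdot>\<^bsub>C\<^esub> m)) (Dom C p)" "p \<cdot>\<^bsub>C\<^esub> m = p \<cdot>\<^bsub>C\<^esub> m" "m \<cdot>\<^bsub>C\<^esub> s\<^sub>0 = s"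
    using da m(2) s0 by (auto simp: hom_iff)
  moreover have "Ident C (Dom C \<kappa>) \<in> hom C (Dom C ?a) (Dom C ?a)"
    "?a \<cdot>\<^bsub>C\<^esub> Ident C (Dom C \<kappa>) = ?a" "\<kappa> \<cdot>\<^bsub>C\<^esub> Ident C (Dom C \<kappa>) = m \<cdot>\<^bsub>C\<^esub> \<kappa>\<^sub>0"
    using kd k0(2) by (auto simp: hom_iff)
  ultimately show ?thesis
    using protomodular[unfolded protomodular_def, rule_format,
        of B "p \<cdot>\<^bsub>C\<^esub> m" s\<^sub>0 p s m ?v ?a \<kappa>\<^sub>0 ?a \<kappa> "Ident C (Dom C \<kappa>)"] by blast
qed

text \<open>The equaliser of \<open>u\<close> and \<open>v\<close> is a subobject containing both
  the kernel and the section, hence everything by \<open>point_mono_iso\<close>.\<close>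

lemma kernel_section_epi:
  assumes p: "p \<in> hom C E B" "s \<in> hom C B E" "p \<cdot>\<^bsub>C\<^esub> s = Ident C B" and k: "is_kernel C \<kappa> p"
    and uv: "u \<in> hom C E Z" "v \<in> hom C E Z" "u \<cdot>\<^bsub>C\<^esub> \<kappa> = v \<cdot>\<^bsub>C\<^esub> \<kappa>" "u \<cdot>\<^bsub>C\<^esub> s = v \<cdot>\<^bsub>C\<^esub> s"
  shows "u = v"
proof -
  have "u \<in> Arr C" "v \<in> hom C (Dom C u) (Cod C u)" using uv(1,2) by (auto simp: hom_iff)
  then obtain m where m: "is_equaliser C u v m"
    using equalisers unfolding has_equalisers_def by blast
  have md: "m \<in> Arr C" "Cod C m = E" "u \<cdot>\<^bsub>C\<^esub> m = v \<cdot>\<^bsub>C\<^esub> m"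
    and univ: "\<And>W h. h \<in> hom C W E \<Longrightarrow> u \<cdot>\<^bsub>C\<^esub> h = v \<cdot>\<^bsub>C\<^esub> h \<Longrightarrow>
      \<exists>!t. t \<in> hom C W (Dom C m) \<and> m \<cdot>\<^bsub>C\<^esub> t = h"
    using equaliserD[OF m] equaliser_univ[OF m] uv(1) by (auto simp: hom_iff)
  note kd = kernelD[OF k]
  have mono: "is_mono C m"
    unfolding is_mono_def
  proof (intro conjI allI ballI impI)
    show "m \<in> Arr C" by fact
    fix W a b assume ab: "a \<in> hom C W (Dom C m)" "b \<in> hom C W (Dom C m)" "m \<cdot>\<^bsub>C\<^esub> a = m \<cdot>\<^bsub>C\<^esub> b"
    have "m \<cdot>\<^bsub>C\<^esub> b \<in> hom C W E" "u \<cdot>\<^bsub>C\<^esub> (m \<cdot>\<^bsub>C\<^esub> b) = v \<cdot>\<^bsub>C\<^esub> (m \<cdot>\<^bsub>C\<^esub> b)"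
      using ab(2) md(1,2) uv(1,2) by (auto simp: hom_iff md(3)[THEN reassoc] assoc)
    from univ[OF this] show "a = b" using ab by auto
  qed
  obtain \<kappa>\<^sub>0 where "\<kappa>\<^sub>0 \<in> hom C (Dom C \<kappa>) (Dom C m)" "m \<cdot>\<^bsub>C\<^esub> \<kappa>\<^sub>0 = \<kappa>"
    using univ[of \<kappa> "Dom C \<kappa>"] kd uv p by (auto simp: hom_iff)
  moreover obtain s\<^sub>0 where "s\<^sub>0 \<in> hom C B (Dom C m)" "m \<cdot>\<^bsub>C\<^esub> s\<^sub>0 = s"
    using univ[of s B] uv p by (auto simp: hom_iff)
  ultimately have "is_iso C m" by (rule point_mono_iso[OF p k mono md(2)])
  then obtain n where n: "n \<in> hom C E (Dom C m)" "m \<cdot>\<^bsub>C\<^esub> n = Ident C E"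
    by (rule isoE) (use md in auto)
  have "u = u \<cdot>\<^bsub>C\<^esub> (m \<cdot>\<^bsub>C\<^esub> n)" "v = v \<cdot>\<^bsub>C\<^esub> (m \<cdot>\<^bsub>C\<^esub> n)" using n uv(1,2) by (auto simp: hom_iff)
  then show ?thesis using md n(1) uv(1,2) by (metis comp_assoc hom_iff)
qed

text \<open>
  Pulling \<open>\<gamma>\<close> back along \<open>\<kappa>'\<close> gives a point over the kernel of \<open>h\<close> with the same kernel as \<open>p\<close>,
  whose section becomes zero in the kernel of \<open>p'\<close>.
\<close>

lemma kernel_map_regular_epi:
  assumes g: "is_regular_epi C \<gamma>" "\<gamma> \<in> hom C E E'"
    and p: "p \<in> hom C E P" "s \<in> hom C P E" "p \<cdot>\<^bsub>C\<^esub> s = Ident C P"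
    and p': "p' \<in> hom C E' P'" "s' \<in> hom C P' E'"
    and h: "h \<in> hom C P P'" "p' \<cdot>\<^bsub>C\<^esub> \<gamma> = h \<cdot>\<^bsub>C\<^esub> p" "\<gamma> \<cdot>\<^bsub>C\<^esub> s = s' \<cdot>\<^bsub>C\<^esub> h"
    and k: "is_kernel C \<kappa> p" "is_kernel C \<kappa>' p'"
    and u: "u \<in> hom C (Dom C \<kappa>) (Dom C \<kappa>')" "\<kappa>' \<cdot>\<^bsub>C\<^esub> u = \<gamma> \<cdot>\<^bsub>C\<^esub> \<kappa>"
  shows "is_regular_epi C u"
proof -
  note kd = kernelD[OF k(1)] and kd' = kernelD[OF k(2)]
  have a [simp]: "\<gamma> \<in> Arr C" "Dom C \<gamma> = E" "Cod C \<gamma> = E'" "p \<in> Arr C" "Dom C p = E" "Cod C p = P"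
    "s \<in> Arr C" "Dom C s = P" "Cod C s = E" "p' \<in> Arr C" "Dom C p' = E'" "Cod C p' = P'"
    "s' \<in> Arr C" "Dom C s' = P'" "Cod C s' = E'" "h \<in> Arr C" "Dom C h = P" "Cod C h = P'"
    "\<kappa> \<in> Arr C" "Cod C \<kappa> = E" "\<kappa>' \<in> Arr C" "Cod C \<kappa>' = E'"
    "u \<in> Arr C" "Dom C u = Dom C \<kappa>" "Cod C u = Dom C \<kappa>'"
    using assms kd kd' by (auto simp: hom_iff)
  have Po [simp]: "P \<in> Obj C" "P' \<in> Obj C" "E \<in> Obj C" "E' \<in> Obj C" using hom_obj p p' by auto
  obtain \<alpha> \<beta> where G: "is_pullback C \<kappa>' \<gamma> \<alpha> \<beta>"
    using ex_pullback[of \<kappa>' "Dom C \<kappa>'" E' \<gamma> E] by (auto simp: hom_iff)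
  note Gd = pullbackD[OF G]
  have \<alpha>: "is_regular_epi C \<alpha>" using regular_epi_stable[OF G g(1)] .
  define G where "G = Dom C \<alpha>"
  have b [simp]: "\<alpha> \<in> Arr C" "\<beta> \<in> Arr C" "Dom C \<alpha> = G" "Dom C \<beta> = G" "Cod C \<beta> = E" "Cod C \<alpha> = Dom C \<kappa>'"
    using Gd by (auto simp: G_def)
  have Go [simp]: "G \<in> Obj C" using dom_obj[of \<alpha>] by simp
  define \<eta> where "\<eta> = kernel C h"
  have \<eta>: "is_kernel C \<eta> h" using kernel_is_kernel[of h] by (simp add: \<eta>_def)
  note \<eta>d = kernelD[OF \<eta>]
  define H where "H = Dom C \<eta>"
  have c [simp]: "\<eta> \<in> Arr C" "Dom C \<eta> = H" "Cod C \<eta> = P" using \<eta>d by (auto simp: H_def)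
  have Ho [simp]: "H \<in> Obj C" using dom_obj[of \<eta>] by simp
  \<comment> \<open>\<open>p \<beta>\<close> lands in the kernel of \<open>h\<close>, since \<open>h
    p \<beta> = p' \<gamma> \<beta> = p' \<kappa>' \<alpha> = 0\<close>. This defines the projection
    \<open>pG\<close> of the new point.\<close>
  have "h \<cdot>\<^bsub>C\<^esub> (p \<cdot>\<^bsub>C\<^esub> \<beta>) = p' \<cdot>\<^bsub>C\<^esub> (\<gamma> \<cdot>\<^bsub>C\<^esub> \<beta>)"
    by (simp add: h(2)[THEN reassoc] assoc)
  also have "\<dots> = zero_map C G (Cod C h)"
    by (simp add: Gd(9)[symmetric] kd'(4)[THEN reassoc])
  finally obtain pG where pG: "pG \<in> hom C G H" "\<eta> \<cdot>\<^bsub>C\<^esub> pG = p \<cdot>\<^bsub>C\<^esub> \<beta>"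
    by (rule kernel_lift[OF \<eta>, of "p \<cdot>\<^bsub>C\<^esub> \<beta>" G, rotated]) (auto simp: hom_iff)
  \<comment> \<open>The pair \<open>(0, s \<eta>)\<close> lies in the pullback because
    \<open>\<gamma> s \<eta> = s' h \<eta> = 0\<close>; this yields the section \<open>sG\<close>,
    with \<open>\<alpha> sG = 0\<close>.\<close>
  have "\<gamma> \<cdot>\<^bsub>C\<^esub> (s \<cdot>\<^bsub>C\<^esub> \<eta>) = s' \<cdot>\<^bsub>C\<^esub> (h \<cdot>\<^bsub>C\<^esub> \<eta>)"
    by (simp add: h(3)[THEN reassoc] assoc)
  then have "\<kappa>' \<cdot>\<^bsub>C\<^esub> zero_map C H (Dom C \<kappa>') = \<gamma> \<cdot>\<^bsub>C\<^esub> (s \<cdot>\<^bsub>C\<^esub> \<eta>)"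
    using \<eta>d(4) by simp
  then obtain sG where sG: "sG \<in> hom C H G" "\<alpha> \<cdot>\<^bsub>C\<^esub> sG = zero_map C H (Dom C \<kappa>')" "\<beta> \<cdot>\<^bsub>C\<^esub> sG = s \<cdot>\<^bsub>C\<^esub> \<eta>"
    by (rule pullback_lift[OF G, where W = H, rotated 2]) (auto simp: hom_iff)
  obtain \<kappa>G where \<kappa>G: "\<kappa>G \<in> hom C (Dom C \<kappa>) G" "\<alpha> \<cdot>\<^bsub>C\<^esub> \<kappa>G = u" "\<beta> \<cdot>\<^bsub>C\<^esub> \<kappa>G = \<kappa>"
    by (rule pullback_lift[OF G, where W = "Dom C \<kappa>", OF _ _ u(2)]) (auto simp: hom_iff)
  have d [simp]: "pG \<in> Arr C" "Dom C pG = G" "Cod C pG = H" "sG \<in> Arr C" "Dom C sG = H" "Cod C sG = G"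
    "\<kappa>G \<in> Arr C" "Dom C \<kappa>G = Dom C \<kappa>" "Cod C \<kappa>G = G"
    using pG sG \<kappa>G by (auto simp: hom_iff)
  have sec: "pG \<cdot>\<^bsub>C\<^esub> sG = Ident C H"
    by (rule monoD[OF kernel_mono[OF \<eta>], where W = H])
      (auto simp: hom_iff pG(2)[THEN reassoc] assoc sG(3) p(3)[THEN reassoc])
  have ker: "is_kernel C \<kappa>G pG"
  proof (rule kernelI[OF pG(1) \<kappa>G(1)])
    show "pG \<cdot>\<^bsub>C\<^esub> \<kappa>G = zero_map C (Dom C \<kappa>) H"
      by (rule monoD[OF kernel_mono[OF \<eta>], where W = "Dom C \<kappa>"])
        (auto simp: hom_iff pG(2)[THEN reassoc] assoc \<kappa>G(3) kd(4))
    show "is_mono C \<kappa>G"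
      unfolding is_mono_def
    proof (intro conjI allI ballI impI)
      fix W a b assume ab: "a \<in> hom C W (Dom C \<kappa>G)" "b \<in> hom C W (Dom C \<kappa>G)"
        "\<kappa>G \<cdot>\<^bsub>C\<^esub> a = \<kappa>G \<cdot>\<^bsub>C\<^esub> b"
      have "\<kappa> \<cdot>\<^bsub>C\<^esub> a = \<kappa> \<cdot>\<^bsub>C\<^esub> b" using ab by (simp add: \<kappa>G(3)[THEN reassoc, symmetric] hom_iff)
      then show "a = b" by (rule monoD[OF kernel_mono[OF k(1)], where W = W]) (use ab in auto)
    qed simp
    fix W x assume x: "x \<in> hom C W G" "pG \<cdot>\<^bsub>C\<^esub> x = zero_map C W H"
    have xs: "x \<in> Arr C" "Dom C x = W" "Cod C x = G" "W \<in> Obj C" using x by (auto simp: hom_iff)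
    \<comment> \<open>If \<open>pG\<close> kills \<open>x\<close>, then \<open>\<beta> x\<close> is
      killed by \<open>p\<close> and equals \<open>\<kappa> y\<close>. As \<open>\<kappa>'\<close>
      is mono, \<open>\<alpha> x = u y\<close>; so \<open>x\<close> and \<open>\<kappa>G y\<close>
      have the same two components in the pullback.\<close>
    have "p \<cdot>\<^bsub>C\<^esub> (\<beta> \<cdot>\<^bsub>C\<^esub> x) = \<eta> \<cdot>\<^bsub>C\<^esub> (pG \<cdot>\<^bsub>C\<^esub> x)" using xs by (simp add: pG(2)[THEN reassoc] assoc)
    also have "\<dots> = zero_map C W (Cod C p)" using x xs by simp
    finally obtain y where y: "y \<in> hom C W (Dom C \<kappa>)" "\<kappa> \<cdot>\<^bsub>C\<^esub> y = \<beta> \<cdot>\<^bsub>C\<^esub> x"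
      by (rule kernel_lift[OF k(1), of _ W, rotated]) (use xs in \<open>auto simp: hom_iff\<close>)
    have ys: "y \<in> Arr C" "Dom C y = W" "Cod C y = Dom C \<kappa>" using y by (auto simp: hom_iff)
    have "\<kappa>' \<cdot>\<^bsub>C\<^esub> (u \<cdot>\<^bsub>C\<^esub> y) = \<kappa>' \<cdot>\<^bsub>C\<^esub> (\<alpha> \<cdot>\<^bsub>C\<^esub> x)"
      using ys xs by (simp add: u(2)[THEN reassoc] assoc y(2) Gd(9)[THEN reassoc])
    then have "u \<cdot>\<^bsub>C\<^esub> y = \<alpha> \<cdot>\<^bsub>C\<^esub> x"
      by (rule monoD[OF kernel_mono[OF k(2)], where W = W]) (use xs ys in \<open>auto simp: hom_iff\<close>)
    then have "\<alpha> \<cdot>\<^bsub>C\<^esub> (\<kappa>G \<cdot>\<^bsub>C\<^esub> y) = \<alpha> \<cdot>\<^bsub>C\<^esub> x"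
      using ys by (simp add: \<kappa>G(2)[THEN reassoc])
    with _ _ have "\<kappa>G \<cdot>\<^bsub>C\<^esub> y = x"
      by (rule pullback_cancel[OF G, where W = W])
        (use xs ys in \<open>auto simp: hom_iff y(2) \<kappa>G(2,3)[THEN reassoc]\<close>)
    then show "\<exists>u \<in> hom C W (Dom C \<kappa>). \<kappa>G \<cdot>\<^bsub>C\<^esub> u = x" using y by blast
  qed
  \<comment> \<open>It remains to invert the mono part \<open>m\<close> of \<open>u\<close>. The
    inverse image \<open>w\<close> of \<open>m\<close> under \<open>\<alpha>\<close> contains the
    kernel \<open>\<kappa>G\<close>, as \<open>\<alpha> \<kappa>G = u\<close>, and the section
    \<open>sG\<close>, as \<open>\<alpha> sG = 0\<close>. So it is everything, and the regular
    epimorphism \<open>\<alpha>\<close> factors through \<open>m\<close>.\<close>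
  obtain q m where q: "is_regular_epi C q" "q \<in> hom C (Dom C \<kappa>) (Dom C m)" "m \<cdot>\<^bsub>C\<^esub> q = u"
    and m: "is_mono C m" "Cod C m = Dom C \<kappa>'"
    using regular_epi_mono_factorisation[OF u(1)] by metis
  have ma [simp]: "m \<in> Arr C" using m by (auto simp: is_mono_def)
  obtain w z where wz: "is_pullback C \<alpha> m w z"
    using ex_pullback[of \<alpha> G "Dom C \<kappa>'" m "Dom C m"] m by (auto simp: hom_iff)
  note wzd = pullbackD[OF wz]
  have wm: "is_mono C w" using pullback_mono[OF wz m(1)] .
  obtain \<kappa>\<^sub>0 where "\<kappa>\<^sub>0 \<in> hom C (Dom C \<kappa>G) (Dom C w)" "w \<cdot>\<^bsub>C\<^esub> \<kappa>\<^sub>0 = \<kappa>G"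
    by (rule pullback_lift[OF wz, of \<kappa>G "Dom C \<kappa>" q]) (use q \<kappa>G in \<open>auto simp: hom_iff\<close>)
  moreover obtain s\<^sub>0 where "s\<^sub>0 \<in> hom C H (Dom C w)" "w \<cdot>\<^bsub>C\<^esub> s\<^sub>0 = sG"
    by (rule pullback_lift[OF wz, of sG H "zero_map C H (Dom C m)"]) (use m sG(2) in \<open>auto simp: hom_iff\<close>)
  ultimately have "is_iso C w"
    using point_mono_iso[OF pG(1) sG(1) sec ker wm] wzd by simp
  then obtain w' where w': "w' \<in> hom C G (Dom C w)" "w \<cdot>\<^bsub>C\<^esub> w' = Ident C G"
    by (rule isoE) (use wzd in auto)
  have "m \<cdot>\<^bsub>C\<^esub> (z \<cdot>\<^bsub>C\<^esub> w') = \<alpha>"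
    using w' wzd(1-8) by (simp add: hom_iff wzd(9)[symmetric, THEN reassoc] assoc)
  then have "is_iso C m"
    by (intro regular_epi_factor_mono_iso[OF \<alpha> m(1), of "z \<cdot>\<^bsub>C\<^esub> w'"]) (use w' wzd in \<open>auto simp: hom_iff\<close>)
  then show ?thesis using regular_epi_iso_comp[OF q(1)] q by (auto simp: hom_iff)
qed

section \<open>Reflexive relations and reflexive graphs\<close>

text \<open>
  The relation \<open>{(m, n). r\<^sub>1 m = r\<^sub>1 n}\<close> is a point over \<open>R\<close> by its first projection and the
  diagonal; both this diagonal and the kernel lie in the subobject of the pairs for which
  \<open>(r\<^sub>2 m, r\<^sub>2 n)\<close> belongs to \<open>R\<close>.
\<close>

lemma reflexive_relation_euclidean:
  assumes r: "r\<^sub>1 \<in> hom C R X" "r\<^sub>2 \<in> hom C R X"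
    and jm: "\<forall>W. \<forall>u \<in> hom C W R. \<forall>v \<in> hom C W R.
      r\<^sub>1 \<cdot>\<^bsub>C\<^esub> u = r\<^sub>1 \<cdot>\<^bsub>C\<^esub> v \<and> r\<^sub>2 \<cdot>\<^bsub>C\<^esub> u = r\<^sub>2 \<cdot>\<^bsub>C\<^esub> v \<longrightarrow> u = v"
    and e: "e \<in> hom C X R" "r\<^sub>1 \<cdot>\<^bsub>C\<^esub> e = Ident C X" "r\<^sub>2 \<cdot>\<^bsub>C\<^esub> e = Ident C X"
    and mn: "m \<in> hom C W R" "n \<in> hom C W R" "r\<^sub>1 \<cdot>\<^bsub>C\<^esub> m = r\<^sub>1 \<cdot>\<^bsub>C\<^esub> n"
  obtains t where "t \<in> hom C W R" "r\<^sub>1 \<cdot>\<^bsub>C\<^esub> t = r\<^sub>2 \<cdot>\<^bsub>C\<^esub> m" "r\<^sub>2 \<cdot>\<^bsub>C\<^esub> t = r\<^sub>2 \<cdot>\<^bsub>C\<^esub> n"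
proof -
  have X [simp]: "X \<in> Obj C" "R \<in> Obj C" using hom_obj r by auto
  have a1 [simp]: "r\<^sub>1 \<in> Arr C" "Dom C r\<^sub>1 = R" "Cod C r\<^sub>1 = X" "r\<^sub>2 \<in> Arr C" "Dom C r\<^sub>2 = R" "Cod C r\<^sub>2 = X"
    "e \<in> Arr C" "Dom C e = X" "Cod C e = R"
    using r e by (auto simp: hom_iff)
  \<comment> \<open>The product of \<open>X\<close> with itself turns the jointly monic pair into a
    single mono \<open>i\<close>, so that membership in \<open>R\<close> becomes a pullback along
    \<open>i\<close>.\<close>
  obtain P \<pi>\<^sub>1 \<pi>\<^sub>2 where \<pi>: "\<pi>\<^sub>1 \<in> hom C P X" "\<pi>\<^sub>2 \<in> hom C P X"
    and pair: "\<And>W a b. a \<in> hom C W X \<Longrightarrow> b \<in> hom C W X \<Longrightarrow>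
      \<exists>u \<in> hom C W P. \<pi>\<^sub>1 \<cdot>\<^bsub>C\<^esub> u = a \<and> \<pi>\<^sub>2 \<cdot>\<^bsub>C\<^esub> u = b"
    and pair_eq: "\<And>W u v. u \<in> hom C W P \<Longrightarrow> v \<in> hom C W P \<Longrightarrow> \<pi>\<^sub>1 \<cdot>\<^bsub>C\<^esub> u = \<pi>\<^sub>1 \<cdot>\<^bsub>C\<^esub> v \<Longrightarrow>
      \<pi>\<^sub>2 \<cdot>\<^bsub>C\<^esub> u = \<pi>\<^sub>2 \<cdot>\<^bsub>C\<^esub> v \<Longrightarrow> u = v"
    by (rule pair_product[OF finite_products X(1) X(1)]) blast
  obtain i where i: "i \<in> hom C R P" "\<pi>\<^sub>1 \<cdot>\<^bsub>C\<^esub> i = r\<^sub>1" "\<pi>\<^sub>2 \<cdot>\<^bsub>C\<^esub> i = r\<^sub>2" using pair[OF r] by blast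
  have a2 [simp]: "\<pi>\<^sub>1 \<in> Arr C" "Dom C \<pi>\<^sub>1 = P" "Cod C \<pi>\<^sub>1 = X" "\<pi>\<^sub>2 \<in> Arr C" "Dom C \<pi>\<^sub>2 = P" "Cod C \<pi>\<^sub>2 = X"
    "i \<in> Arr C" "Dom C i = R" "Cod C i = P"
    using \<pi> i by (auto simp: hom_iff)
  have im: "is_mono C i"
    unfolding is_mono_def
  proof (intro conjI allI ballI impI)
    fix W u v assume uv: "u \<in> hom C W (Dom C i)" "v \<in> hom C W (Dom C i)" "i \<cdot>\<^bsub>C\<^esub> u = i \<cdot>\<^bsub>C\<^esub> v"
    have "r\<^sub>1 \<cdot>\<^bsub>C\<^esub> u = \<pi>\<^sub>1 \<cdot>\<^bsub>C\<^esub> (i \<cdot>\<^bsub>C\<^esub> u)" "r\<^sub>2 \<cdot>\<^bsub>C\<^esub> u = \<pi>\<^sub>2 \<cdot>\<^bsub>C\<^esub> (i \<cdot>\<^bsub>C\<^esub> u)"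
      "r\<^sub>1 \<cdot>\<^bsub>C\<^esub> v = \<pi>\<^sub>1 \<cdot>\<^bsub>C\<^esub> (i \<cdot>\<^bsub>C\<^esub> v)" "r\<^sub>2 \<cdot>\<^bsub>C\<^esub> v = \<pi>\<^sub>2 \<cdot>\<^bsub>C\<^esub> (i \<cdot>\<^bsub>C\<^esub> v)"
      using uv(1,2) by (simp_all add: hom_iff i(2,3)[THEN reassoc])
    then show "u = v" using jm uv by simp
  qed simp
  obtain a b where ab: "is_pullback C r\<^sub>1 r\<^sub>1 a b" using ex_pullback[OF r(1) r(1)] by blast
  note abd = pullbackD[OF ab]
  define Q where "Q = Dom C a"
  have a3 [simp]: "a \<in> Arr C" "Dom C a = Q" "Cod C a = R" "b \<in> Arr C" "Dom C b = Q" "Cod C b = R"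
    using abd by (auto simp: Q_def)
  obtain y where y: "y \<in> hom C Q P" "\<pi>\<^sub>1 \<cdot>\<^bsub>C\<^esub> y = r\<^sub>2 \<cdot>\<^bsub>C\<^esub> a" "\<pi>\<^sub>2 \<cdot>\<^bsub>C\<^esub> y = r\<^sub>2 \<cdot>\<^bsub>C\<^esub> b"
    using pair[of "r\<^sub>2 \<cdot>\<^bsub>C\<^esub> a" Q "r\<^sub>2 \<cdot>\<^bsub>C\<^esub> b"] by (auto simp: hom_iff)
  obtain w z where wz: "is_pullback C y i w z" using ex_pullback[OF y(1) i(1)] by blast
  note wzd = pullbackD[OF wz]
  have wm: "is_mono C w" using pullback_mono[OF wz im] .
  obtain \<delta> where \<delta>: "\<delta> \<in> hom C R Q" "a \<cdot>\<^bsub>C\<^esub> \<delta> = Ident C R" "b \<cdot>\<^bsub>C\<^esub> \<delta> = Ident C R"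
    by (rule pullback_lift[OF ab, of "Ident C R" R "Ident C R"]) (auto simp: hom_iff)
  define \<kappa> where "\<kappa> = kernel C a"
  have \<kappa>: "is_kernel C \<kappa> a" unfolding \<kappa>_def by (rule kernel_is_kernel) simp
  note \<kappa>d = kernelD[OF \<kappa>]
  have a4 [simp]: "y \<in> Arr C" "Dom C y = Q" "Cod C y = P" "\<delta> \<in> Arr C" "Dom C \<delta> = R" "Cod C \<delta> = Q"
    "\<kappa> \<in> Arr C" "Cod C \<kappa> = Q" "w \<in> Arr C" "Cod C w = Q" "z \<in> Arr C" "Cod C z = R" "Dom C z = Dom C w"
    using y \<delta> \<kappa>d wzd by (auto simp: hom_iff)
  \<comment> \<open>On the kernel of \<open>a\<close> the first component of \<open>y\<close>
    vanishes, and so does \<open>r\<^sub>1 b \<kappa> = r\<^sub>1 a \<kappa>\<close>. Thus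
    \<open>b \<kappa>\<close>, an element of \<open>R\<close>, itself witnesses that
    \<open>y \<kappa>\<close> lies in \<open>R\<close>.\<close>
  have r1b: "r\<^sub>1 \<cdot>\<^bsub>C\<^esub> (b \<cdot>\<^bsub>C\<^esub> \<kappa>) = zero_map C (Dom C \<kappa>) X"
    by (simp add: abd(9)[symmetric, THEN reassoc] assoc \<kappa>d(4))
  have "y \<cdot>\<^bsub>C\<^esub> \<kappa> = i \<cdot>\<^bsub>C\<^esub> (b \<cdot>\<^bsub>C\<^esub> \<kappa>)"
    by (rule pair_eq[where W = "Dom C \<kappa>"])
      (auto simp: hom_iff y(2,3)[THEN reassoc] i(2,3)[THEN reassoc] assoc \<kappa>d(4) r1b)
  then obtain \<kappa>\<^sub>0 where k0: "\<kappa>\<^sub>0 \<in> hom C (Dom C \<kappa>) (Dom C w)" "w \<cdot>\<^bsub>C\<^esub> \<kappa>\<^sub>0 = \<kappa>"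
    by (rule pullback_lift[OF wz, where W = "Dom C \<kappa>", rotated 2]) (auto simp: hom_iff)
  \<comment> \<open>On the diagonal both components of \<open>y\<close> equal
    \<open>r\<^sub>2\<close>, and reflexivity supplies the witness
    \<open>e r\<^sub>2\<close>.\<close>
  have "y \<cdot>\<^bsub>C\<^esub> \<delta> = i \<cdot>\<^bsub>C\<^esub> (e \<cdot>\<^bsub>C\<^esub> r\<^sub>2)"
    by (rule pair_eq[where W = R])
      (auto simp: hom_iff y(2,3)[THEN reassoc] i(2,3)[THEN reassoc] assoc \<delta>(2,3) e(2,3)[THEN reassoc])
  then obtain \<delta>\<^sub>0 where d0: "\<delta>\<^sub>0 \<in> hom C R (Dom C w)" "w \<cdot>\<^bsub>C\<^esub> \<delta>\<^sub>0 = \<delta>"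
    by (rule pullback_lift[OF wz, where W = R, rotated 2]) (auto simp: hom_iff)
  have "is_iso C w"
    by (rule point_mono_iso[OF _ \<delta>(1,2) \<kappa> wm _ k0 d0]) (auto simp: hom_iff)
  then obtain w' where w': "w' \<in> hom C Q (Dom C w)" "w \<cdot>\<^bsub>C\<^esub> w' = Ident C Q"
    by (rule isoE) auto
  have a5 [simp]: "w' \<in> Arr C" "Dom C w' = Q" "Cod C w' = Dom C w" using w' by (auto simp: hom_iff)
  have it: "i \<cdot>\<^bsub>C\<^esub> (z \<cdot>\<^bsub>C\<^esub> w') = y"
    by (simp add: wzd(9)[symmetric, THEN reassoc] assoc w'(2))
  obtain l where l: "l \<in> hom C W Q" "a \<cdot>\<^bsub>C\<^esub> l = m" "b \<cdot>\<^bsub>C\<^esub> l = n"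
    by (rule pullback_lift[OF ab _ _ mn(3)]) (use mn in auto)
  have a6 [simp]: "l \<in> Arr C" "Dom C l = W" "Cod C l = Q" using l by (auto simp: hom_iff)
  have t1: "r\<^sub>1 \<cdot>\<^bsub>C\<^esub> (z \<cdot>\<^bsub>C\<^esub> w') = r\<^sub>2 \<cdot>\<^bsub>C\<^esub> a"
    using i(2)[THEN reassoc, of "z \<cdot>\<^bsub>C\<^esub> w'"] y(2) it by simp
  have t2: "r\<^sub>2 \<cdot>\<^bsub>C\<^esub> (z \<cdot>\<^bsub>C\<^esub> w') = r\<^sub>2 \<cdot>\<^bsub>C\<^esub> b"
    using i(3)[THEN reassoc, of "z \<cdot>\<^bsub>C\<^esub> w'"] y(3) it by simp
  show thesis
  proof (rule that[of "z \<cdot>\<^bsub>C\<^esub> w' \<cdot>\<^bsub>C\<^esub> l"])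
    show "r\<^sub>1 \<cdot>\<^bsub>C\<^esub> (z \<cdot>\<^bsub>C\<^esub> w' \<cdot>\<^bsub>C\<^esub> l) = r\<^sub>2 \<cdot>\<^bsub>C\<^esub> m"
      using t1[THEN reassoc, of l] by (simp add: assoc l)
    show "r\<^sub>2 \<cdot>\<^bsub>C\<^esub> (z \<cdot>\<^bsub>C\<^esub> w' \<cdot>\<^bsub>C\<^esub> l) = r\<^sub>2 \<cdot>\<^bsub>C\<^esub> n"
      using t2[THEN reassoc, of l] by (simp add: assoc l)
  qed (simp add: hom_iff)
qed

text \<open>The Mal'tsev property of semi-abelian categories. Symmetry \<open>\<sigma>\<close> is
  the Euclidean property for the identity and \<open>e r\<^sub>1\<close>; transitivity is the same
  property for \<open>\<sigma> p\<close> and \<open>q\<close>, since \<open>\<sigma>\<close> turns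
  the common middle term of \<open>p\<close> and \<open>q\<close> into a common source.\<close>

lemma reflexive_relation_equivalence:
  assumes r: "r\<^sub>1 \<in> hom C R X" "r\<^sub>2 \<in> hom C R X"
    and jm: "\<forall>W. \<forall>u \<in> hom C W R. \<forall>v \<in> hom C W R.
      r\<^sub>1 \<cdot>\<^bsub>C\<^esub> u = r\<^sub>1 \<cdot>\<^bsub>C\<^esub> v \<and> r\<^sub>2 \<cdot>\<^bsub>C\<^esub> u = r\<^sub>2 \<cdot>\<^bsub>C\<^esub> v \<longrightarrow> u = v"
    and e: "e \<in> hom C X R" "r\<^sub>1 \<cdot>\<^bsub>C\<^esub> e = Ident C X" "r\<^sub>2 \<cdot>\<^bsub>C\<^esub> e = Ident C X"
  shows "is_equivalence_relation C X r\<^sub>1 r\<^sub>2"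
proof -
  have X [simp]: "X \<in> Obj C" "R \<in> Obj C" using hom_obj r by auto
  have a1 [simp]: "r\<^sub>1 \<in> Arr C" "Dom C r\<^sub>1 = R" "Cod C r\<^sub>1 = X" "r\<^sub>2 \<in> Arr C" "Dom C r\<^sub>2 = R" "Cod C r\<^sub>2 = X"
    "e \<in> Arr C" "Dom C e = X" "Cod C e = R"
    using r e by (auto simp: hom_iff)
  obtain \<sigma> where \<sigma>': "\<sigma> \<in> hom C R R" "r\<^sub>1 \<cdot>\<^bsub>C\<^esub> \<sigma> = r\<^sub>2 \<cdot>\<^bsub>C\<^esub> Ident C R" "r\<^sub>2 \<cdot>\<^bsub>C\<^esub> \<sigma> = r\<^sub>2 \<cdot>\<^bsub>C\<^esub> (e \<cdot>\<^bsub>C\<^esub> r\<^sub>1)"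
    by (rule reflexive_relation_euclidean[OF r jm e, where W = R and m = "Ident C R" and n = "e \<cdot>\<^bsub>C\<^esub> r\<^sub>1"])
      (auto simp: hom_iff e(2)[THEN reassoc])
  then have \<sigma>: "\<sigma> \<in> hom C R R" "r\<^sub>1 \<cdot>\<^bsub>C\<^esub> \<sigma> = r\<^sub>2" "r\<^sub>2 \<cdot>\<^bsub>C\<^esub> \<sigma> = r\<^sub>1"
    by (auto simp: e(3)[THEN reassoc])
  have a2 [simp]: "\<sigma> \<in> Arr C" "Dom C \<sigma> = R" "Cod C \<sigma> = R" using \<sigma> by (auto simp: hom_iff)
  have "\<exists>t \<in> hom C (Dom C p) R. r\<^sub>1 \<cdot>\<^bsub>C\<^esub> t = r\<^sub>1 \<cdot>\<^bsub>C\<^esub> p \<and> r\<^sub>2 \<cdot>\<^bsub>C\<^esub> t = r\<^sub>2 \<cdot>\<^bsub>C\<^esub> q"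
    if pq: "is_pullback C r\<^sub>2 r\<^sub>1 p q" for p q
  proof -
    note d = pullbackD[OF pq]
    have eq: "r\<^sub>1 \<cdot>\<^bsub>C\<^esub> (\<sigma> \<cdot>\<^bsub>C\<^esub> p) = r\<^sub>1 \<cdot>\<^bsub>C\<^esub> q" using d by (simp add: \<sigma>(2)[THEN reassoc])
    obtain t where "t \<in> hom C (Dom C p) R" "r\<^sub>1 \<cdot>\<^bsub>C\<^esub> t = r\<^sub>2 \<cdot>\<^bsub>C\<^esub> (\<sigma> \<cdot>\<^bsub>C\<^esub> p)"
      "r\<^sub>2 \<cdot>\<^bsub>C\<^esub> t = r\<^sub>2 \<cdot>\<^bsub>C\<^esub> q"
      by (rule reflexive_relation_euclidean[OF r jm e _ _ eq, where W = "Dom C p"]) (use d in \<open>auto simp: hom_iff\<close>)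
    then show ?thesis using d by (auto simp: \<sigma>(3)[THEN reassoc])
  qed
  then show ?thesis
    unfolding is_equivalence_relation_def using r jm e \<sigma> by blast
qed

text \<open>Regularity of \<open>\<epsilon>\<close> comes from stability: it is the pullback of the
  regular epimorphism \<open>\<rho>\<close> from \<open>Y\<close> onto the image \<open>R\<close> of
  \<open>(d, c)\<close>, along the morphism \<open>j = (0, \<kappa>)\<close> from the kernel of
  \<open>q\<close> to \<open>R\<close>.\<close>

lemma reflexive_graph_normalisation:
  assumes dc: "d \<in> hom C Y X" "c \<in> hom C Y X" and e: "e \<in> hom C X Y" "d \<cdot>\<^bsub>C\<^esub> e = Ident C X" "c \<cdot>\<^bsub>C\<^esub> e = Ident C X"
    and q: "is_coequaliser C d c q" and \<kappa>: "is_kernel C \<kappa> q" and \<nu>: "is_kernel C \<nu> d"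
  obtains \<epsilon> where "is_regular_epi C \<epsilon>" "\<epsilon> \<in> hom C (Dom C \<nu>) (Dom C \<kappa>)" "\<kappa> \<cdot>\<^bsub>C\<^esub> \<epsilon> = c \<cdot>\<^bsub>C\<^esub> \<nu>"
proof -
  note \<kappa>d = kernelD[OF \<kappa>] and \<nu>d = kernelD[OF \<nu>]
  have X [simp]: "X \<in> Obj C" "Y \<in> Obj C" using hom_obj dc by auto
  have qd: "q \<in> Arr C" "Dom C q = X" "q \<cdot>\<^bsub>C\<^esub> d = q \<cdot>\<^bsub>C\<^esub> c"
    using q dc unfolding is_coequaliser_def by (auto simp: hom_iff)
  have a1 [simp]: "d \<in> Arr C" "Dom C d = Y" "Cod C d = X" "c \<in> Arr C" "Dom C c = Y" "Cod C c = X"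
    "e \<in> Arr C" "Dom C e = X" "Cod C e = Y" "q \<in> Arr C" "Dom C q = X"
    "\<kappa> \<in> Arr C" "Cod C \<kappa> = X" "\<nu> \<in> Arr C" "Cod C \<nu> = Y"
    using dc e qd \<kappa>d \<nu>d by (auto simp: hom_iff)
  obtain P \<pi>\<^sub>1 \<pi>\<^sub>2 where \<pi>: "\<pi>\<^sub>1 \<in> hom C P X" "\<pi>\<^sub>2 \<in> hom C P X"
    and pair: "\<And>W a b. a \<in> hom C W X \<Longrightarrow> b \<in> hom C W X \<Longrightarrow>
      \<exists>u \<in> hom C W P. \<pi>\<^sub>1 \<cdot>\<^bsub>C\<^esub> u = a \<and> \<pi>\<^sub>2 \<cdot>\<^bsub>C\<^esub> u = b"
    and pair_eq: "\<And>W u v. u \<in> hom C W P \<Longrightarrow> v \<in> hom C W P \<Longrightarrow> \<pi>\<^sub>1 \<cdot>\<^bsub>C\<^esub> u = \<pi>\<^sub>1 \<cdot>\<^bsub>C\<^esub> v \<Longrightarrow>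
      \<pi>\<^sub>2 \<cdot>\<^bsub>C\<^esub> u = \<pi>\<^sub>2 \<cdot>\<^bsub>C\<^esub> v \<Longrightarrow> u = v"
    by (rule pair_product[OF finite_products X(1) X(1)]) blast
  obtain g where g: "g \<in> hom C Y P" "\<pi>\<^sub>1 \<cdot>\<^bsub>C\<^esub> g = d" "\<pi>\<^sub>2 \<cdot>\<^bsub>C\<^esub> g = c" using pair[OF dc] by blast
  obtain \<rho> m where \<rho>: "is_regular_epi C \<rho>" "\<rho> \<in> hom C Y (Dom C m)" "m \<cdot>\<^bsub>C\<^esub> \<rho> = g"
    and m: "is_mono C m" "Cod C m = P"
    using regular_epi_mono_factorisation[OF g(1)] by metis
  define R where "R = Dom C m"
  have ma: "m \<in> Arr C" using m by (auto simp: is_mono_def)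
  have a2 [simp]: "\<pi>\<^sub>1 \<in> Arr C" "Dom C \<pi>\<^sub>1 = P" "Cod C \<pi>\<^sub>1 = X" "\<pi>\<^sub>2 \<in> Arr C" "Dom C \<pi>\<^sub>2 = P" "Cod C \<pi>\<^sub>2 = X"
    "m \<in> Arr C" "Dom C m = R" "Cod C m = P" "\<rho> \<in> Arr C" "Dom C \<rho> = Y" "Cod C \<rho> = R"
    using \<pi> m ma \<rho> by (auto simp: hom_iff R_def)
  define r\<^sub>1 r\<^sub>2 where "r\<^sub>1 = \<pi>\<^sub>1 \<cdot>\<^bsub>C\<^esub> m" and "r\<^sub>2 = \<pi>\<^sub>2 \<cdot>\<^bsub>C\<^esub> m"
  have r: "r\<^sub>1 \<in> hom C R X" "r\<^sub>2 \<in> hom C R X" by (auto simp: r\<^sub>1_def r\<^sub>2_def hom_iff)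
  have a3 [simp]: "r\<^sub>1 \<in> Arr C" "Dom C r\<^sub>1 = R" "Cod C r\<^sub>1 = X" "r\<^sub>2 \<in> Arr C" "Dom C r\<^sub>2 = R" "Cod C r\<^sub>2 = X"
    using r by (auto simp: hom_iff)
  have r\<rho>: "r\<^sub>1 \<cdot>\<^bsub>C\<^esub> \<rho> = d" "r\<^sub>2 \<cdot>\<^bsub>C\<^esub> \<rho> = c"
    by (auto simp: r\<^sub>1_def r\<^sub>2_def assoc \<rho>(3) g)
  have jm: "u = v" if uv: "u \<in> hom C W R" "v \<in> hom C W R"
    "r\<^sub>1 \<cdot>\<^bsub>C\<^esub> u = r\<^sub>1 \<cdot>\<^bsub>C\<^esub> v" "r\<^sub>2 \<cdot>\<^bsub>C\<^esub> u = r\<^sub>2 \<cdot>\<^bsub>C\<^esub> v" for W u v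
  proof -
    have "m \<cdot>\<^bsub>C\<^esub> u = m \<cdot>\<^bsub>C\<^esub> v"
      by (rule pair_eq[where W = W])
        (use uv in \<open>auto simp: hom_iff r\<^sub>1_def[symmetric, THEN reassoc] r\<^sub>2_def[symmetric, THEN reassoc]\<close>)
    then show ?thesis by (rule monoD[OF m(1), where W = W]) (use uv in auto)
  qed
  \<comment> \<open>The section of the graph followed by \<open>\<rho>\<close> shows that the image
    relation is reflexive.\<close>
  have "is_equivalence_relation C X r\<^sub>1 r\<^sub>2"
    by (rule reflexive_relation_equivalence[OF r _, where e = "\<rho> \<cdot>\<^bsub>C\<^esub> e"])
      (use jm in \<open>auto simp: hom_iff r\<rho>[THEN reassoc] e\<close>)
  then obtain q' where q': "is_pullback C q' q' r\<^sub>1 r\<^sub>2" using equivalence_relation_effective by blast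
  note q'd = pullbackD[OF q']
  have a4 [simp]: "q' \<in> Arr C" "Dom C q' = X" using q'd by auto
  have "q' \<cdot>\<^bsub>C\<^esub> d = q' \<cdot>\<^bsub>C\<^esub> c"
    using q'd(9)[THEN reassoc, of \<rho>] by (simp add: assoc r\<rho>)
  \<comment> \<open>Effectiveness presents \<open>R\<close> as the kernel pair of some
    \<open>q'\<close>. As \<open>q'\<close> factors through the coequaliser \<open>q\<close>, it
    kills \<open>\<kappa>\<close>, and therefore \<open>(0, \<kappa>)\<close> lies in
    \<open>R\<close>.\<close>
  from coequaliser_univ[OF q _ this, of "Cod C q'"]
  obtain t where t: "t \<in> hom C (Cod C q) (Cod C q')" "t \<cdot>\<^bsub>C\<^esub> q = q'" by (auto simp: hom_iff)
  have a5 [simp]: "t \<in> Arr C" "Dom C t = Cod C q" "Cod C t = Cod C q'" using t by (auto simp: hom_iff)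
  have "q' \<cdot>\<^bsub>C\<^esub> zero_map C (Dom C \<kappa>) X = q' \<cdot>\<^bsub>C\<^esub> \<kappa>"
    using t(2)[THEN reassoc, of \<kappa>] by (simp add: \<kappa>d(4))
  then obtain j where j: "j \<in> hom C (Dom C \<kappa>) R" "r\<^sub>1 \<cdot>\<^bsub>C\<^esub> j = zero_map C (Dom C \<kappa>) X" "r\<^sub>2 \<cdot>\<^bsub>C\<^esub> j = \<kappa>"
    by (rule pullback_lift[OF q', where W = "Dom C \<kappa>", rotated 2]) (auto simp: hom_iff)
  have a6 [simp]: "j \<in> Arr C" "Dom C j = Dom C \<kappa>" "Cod C j = R" using j by (auto simp: hom_iff)
  have rr: "q \<cdot>\<^bsub>C\<^esub> r\<^sub>1 = q \<cdot>\<^bsub>C\<^esub> r\<^sub>2"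
    by (rule regular_epi_cancel[OF \<rho>(1), where Z = "Cod C q"]) (auto simp: hom_iff assoc r\<rho> qd(3))
  have qcn: "q \<cdot>\<^bsub>C\<^esub> (c \<cdot>\<^bsub>C\<^esub> \<nu>) = zero_map C (Dom C \<nu>) (Cod C q)"
    by (simp add: qd(3)[symmetric, THEN reassoc] assoc \<nu>d(4))
  obtain \<epsilon> where \<epsilon>: "\<epsilon> \<in> hom C (Dom C \<nu>) (Dom C \<kappa>)" "\<kappa> \<cdot>\<^bsub>C\<^esub> \<epsilon> = c \<cdot>\<^bsub>C\<^esub> \<nu>"
    by (rule kernel_lift[OF \<kappa> _ qcn]) (auto simp: hom_iff)
  have a7 [simp]: "\<epsilon> \<in> Arr C" "Dom C \<epsilon> = Dom C \<nu>" "Cod C \<epsilon> = Dom C \<kappa>" using \<epsilon> by (auto simp: hom_iff)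
  have "is_pullback C j \<rho> \<epsilon> \<nu>"
  proof (rule pullbackI[where X = "Dom C \<kappa>" and Z = R and Y = Y and P = "Dom C \<nu>"])
    show "j \<cdot>\<^bsub>C\<^esub> \<epsilon> = \<rho> \<cdot>\<^bsub>C\<^esub> \<nu>"
      by (rule jm[where W = "Dom C \<nu>"])
        (auto simp: hom_iff j(2,3)[THEN reassoc] r\<rho>[THEN reassoc] \<nu>d(4) \<epsilon>(2))
    fix W a b assume ab: "a \<in> hom C W (Dom C \<kappa>)" "b \<in> hom C W Y" "j \<cdot>\<^bsub>C\<^esub> a = \<rho> \<cdot>\<^bsub>C\<^esub> b"
    have abh: "a \<in> Arr C" "Dom C a = W" "Cod C a = Dom C \<kappa>" "b \<in> Arr C" "Dom C b = W" "Cod C b = Y"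
      using ab by (auto simp: hom_iff)
    \<comment> \<open>From \<open>j a = \<rho> b\<close>, the first component gives
      \<open>d b = 0\<close>, so \<open>b\<close> factors through \<open>\<nu>\<close>; the second
      component shows that \<open>\<epsilon>\<close> sends the factor to \<open>a\<close>.\<close>
    have "d \<cdot>\<^bsub>C\<^esub> b = r\<^sub>1 \<cdot>\<^bsub>C\<^esub> (\<rho> \<cdot>\<^bsub>C\<^esub> b)" using abh by (simp add: r\<rho>[THEN reassoc])
    also have "\<dots> = zero_map C W (Cod C d)" using abh by (simp add: ab(3)[symmetric] j(2)[THEN reassoc])
    finally have db: "d \<cdot>\<^bsub>C\<^esub> b = zero_map C W (Cod C d)" .
    have "\<exists>!u. u \<in> hom C W (Dom C \<nu>) \<and> \<nu> \<cdot>\<^bsub>C\<^esub> u = b"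
      by (rule kernel_univ[OF \<nu> _ db]) (use ab in auto)
    moreover have "\<epsilon> \<cdot>\<^bsub>C\<^esub> u = a" if u: "u \<in> hom C W (Dom C \<nu>)" "\<nu> \<cdot>\<^bsub>C\<^esub> u = b" for u
    proof (rule monoD[OF kernel_mono[OF \<kappa>], where W = W])
      have us: "u \<in> Arr C" "Dom C u = W" "Cod C u = Dom C \<nu>" using u by (auto simp: hom_iff)
      have "\<kappa> \<cdot>\<^bsub>C\<^esub> (\<epsilon> \<cdot>\<^bsub>C\<^esub> u) = c \<cdot>\<^bsub>C\<^esub> b"
        using us u(2) by (simp add: \<epsilon>(2)[THEN reassoc] assoc)
      also have "\<dots> = r\<^sub>2 \<cdot>\<^bsub>C\<^esub> (\<rho> \<cdot>\<^bsub>C\<^esub> b)" using abh by (simp add: r\<rho>[THEN reassoc])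
      also have "\<dots> = \<kappa> \<cdot>\<^bsub>C\<^esub> a" using abh by (simp add: ab(3)[symmetric] j(3)[THEN reassoc])
      finally show "\<kappa> \<cdot>\<^bsub>C\<^esub> (\<epsilon> \<cdot>\<^bsub>C\<^esub> u) = \<kappa> \<cdot>\<^bsub>C\<^esub> a" .
      show "\<epsilon> \<cdot>\<^bsub>C\<^esub> u \<in> hom C W (Dom C \<kappa>)" using us by (simp add: hom_iff)
    qed (use ab in auto)
    ultimately show "\<exists>!u. u \<in> hom C W (Dom C \<nu>) \<and> \<epsilon> \<cdot>\<^bsub>C\<^esub> u = a \<and> \<nu> \<cdot>\<^bsub>C\<^esub> u = b"
      by blast
  qed (auto simp: hom_iff)
  then have "is_regular_epi C \<epsilon>" using regular_epi_stable \<rho>(1) by blast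
  then show thesis using that \<epsilon> by blast
qed

section \<open>Regular epimorphisms as cokernels, and right exactness\<close>

text \<open>Let \<open>(r, s)\<close> be the kernel pair of \<open>q\<close>. If \<open>h\<close>
  kills \<open>\<kappa>\<close> then \<open>h r = h s\<close>: the two agree on the diagonal, and on
  the kernel of \<open>r\<close>, which \<open>s\<close> sends into the kernel of \<open>q\<close>.
  The pair \<open>f\<close>, \<open>g\<close> coequalised by \<open>q\<close> factors through the
  kernel pair, so \<open>h f = h g\<close>.\<close>

lemma regular_epi_cokernel_of_kernel:
  assumes q: "is_regular_epi C q" and \<kappa>: "is_kernel C \<kappa> q"
  shows "is_cokernel C q \<kappa>"
proof -
  note \<kappa>d = kernelD[OF \<kappa>]
  define X where "X = Dom C q"
  have a1 [simp]: "q \<in> Arr C" "Dom C q = X" "\<kappa> \<in> Arr C" "Cod C \<kappa> = X" using \<kappa>d by (auto simp: X_def)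
  have X [simp]: "X \<in> Obj C" using dom_obj[of q] by simp
  obtain f g where fg: "is_coequaliser C f g q" using q by (auto simp: is_regular_epi_def)
  have fgd: "f \<in> Arr C" "Cod C f = X" "g \<in> Arr C" "Dom C g = Dom C f" "Cod C g = X"
    "q \<cdot>\<^bsub>C\<^esub> f = q \<cdot>\<^bsub>C\<^esub> g"
    using fg a1(2) unfolding is_coequaliser_def hom_iff by auto
  obtain r s where rs: "is_pullback C q q r s" using ex_pullback[of q X "Cod C q" q X] by (auto simp: hom_iff)
  note rsd = pullbackD[OF rs]
  define R where "R = Dom C r"
  have a2 [simp]: "r \<in> Arr C" "Dom C r = R" "Cod C r = X" "s \<in> Arr C" "Dom C s = R" "Cod C s = X"
    using rsd by (auto simp: R_def)
  obtain \<delta> where \<delta>: "\<delta> \<in> hom C X R" "r \<cdot>\<^bsub>C\<^esub> \<delta> = Ident C X" "s \<cdot>\<^bsub>C\<^esub> \<delta> = Ident C X"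
    by (rule pullback_lift[OF rs, of "Ident C X" X "Ident C X"]) (auto simp: hom_iff)
  obtain l where l: "l \<in> hom C (Dom C f) R" "r \<cdot>\<^bsub>C\<^esub> l = f" "s \<cdot>\<^bsub>C\<^esub> l = g"
    by (rule pullback_lift[OF rs _ _ fgd(6)]) (use fgd in \<open>auto simp: hom_iff\<close>)
  define \<nu> where "\<nu> = kernel C r"
  have \<nu>: "is_kernel C \<nu> r" unfolding \<nu>_def by (rule kernel_is_kernel) simp
  note \<nu>d = kernelD[OF \<nu>]
  have a3 [simp]: "\<delta> \<in> Arr C" "Dom C \<delta> = X" "Cod C \<delta> = R" "l \<in> Arr C" "Dom C l = Dom C f" "Cod C l = R"
    "\<nu> \<in> Arr C" "Cod C \<nu> = R"
    using \<delta> l \<nu>d by (auto simp: hom_iff)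
  have qsn: "q \<cdot>\<^bsub>C\<^esub> (s \<cdot>\<^bsub>C\<^esub> \<nu>) = zero_map C (Dom C \<nu>) (Cod C q)"
    by (simp add: rsd(9)[symmetric, THEN reassoc] assoc \<nu>d(4))
  obtain j where j: "j \<in> hom C (Dom C \<nu>) (Dom C \<kappa>)" "\<kappa> \<cdot>\<^bsub>C\<^esub> j = s \<cdot>\<^bsub>C\<^esub> \<nu>"
    by (rule kernel_lift[OF \<kappa> _ qsn]) (auto simp: hom_iff)
  have a4 [simp]: "j \<in> Arr C" "Dom C j = Dom C \<nu>" "Cod C j = Dom C \<kappa>" using j by (auto simp: hom_iff)
  show ?thesis
  proof (rule cokernelI[where N = "Dom C \<kappa>" and X = X and Y = "Cod C q"])
    fix Z h assume h: "h \<in> hom C X Z" "h \<cdot>\<^bsub>C\<^esub> \<kappa> = zero_map C (Dom C \<kappa>) Z"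
    have hs: "h \<in> Arr C" "Dom C h = X" "Cod C h = Z" "Z \<in> Obj C" using h by (auto simp: hom_iff)
    have hsn: "h \<cdot>\<^bsub>C\<^esub> (s \<cdot>\<^bsub>C\<^esub> \<nu>) = zero_map C (Dom C \<nu>) Z"
      using hs by (simp add: j(2)[symmetric] h(2)[THEN reassoc])
    have "h \<cdot>\<^bsub>C\<^esub> r = h \<cdot>\<^bsub>C\<^esub> s"
      by (rule kernel_section_epi[OF _ \<delta>(1,2) \<nu>, where Z = Z])
        (use hs in \<open>auto simp: hom_iff assoc \<delta>(2,3) \<nu>d(4) hsn\<close>)
    then have "h \<cdot>\<^bsub>C\<^esub> f = h \<cdot>\<^bsub>C\<^esub> g"
      using reassoc[of h r "h \<cdot>\<^bsub>C\<^esub> s" l] hs by (simp add: l assoc)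
    then show "\<exists>!u. u \<in> hom C (Cod C q) Z \<and> u \<cdot>\<^bsub>C\<^esub> q = h"
      using coequaliser_univ[OF fg] fgd h by simp
  qed (auto simp: hom_iff \<kappa>d(4))
qed

text \<open>\<open>\<kappa>\<close> after \<open>\<epsilon>\<close> is already an image
  factorisation with normal mono part, whence properness; and a morphism killing the composite kills
  \<open>\<kappa>\<close>, because \<open>\<epsilon>\<close> can be cancelled.\<close>

lemma right_exactI:
  assumes q: "is_regular_epi C q" and \<kappa>: "is_kernel C \<kappa> q"
    and \<epsilon>: "is_regular_epi C \<epsilon>" "Cod C \<epsilon> = Dom C \<kappa>"
  shows "right_exact C (\<kappa> \<cdot>\<^bsub>C\<^esub> \<epsilon>) q"
proof -
  note \<kappa>d = kernelD[OF \<kappa>]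
  have \<epsilon>a [simp]: "\<epsilon> \<in> Arr C" using regular_epi_arr[OF \<epsilon>(1)] .
  have "is_proper C (\<kappa> \<cdot>\<^bsub>C\<^esub> \<epsilon>)"
    unfolding is_proper_def is_image_def is_normal_subobject_def
    using kernel_mono[OF \<kappa>] \<kappa> \<epsilon> by blast
  moreover have "is_cokernel C q (\<kappa> \<cdot>\<^bsub>C\<^esub> \<epsilon>)"
  proof (rule cokernelI[where N = "Dom C \<epsilon>" and X = "Dom C q" and Y = "Cod C q"])
    show "q \<cdot>\<^bsub>C\<^esub> (\<kappa> \<cdot>\<^bsub>C\<^esub> \<epsilon>) = zero_map C (Dom C \<epsilon>) (Cod C q)"
      using \<kappa>d \<epsilon> by (simp add: \<kappa>d(4)[THEN reassoc])
    fix Z h assume h: "h \<in> hom C (Dom C q) Z" "h \<cdot>\<^bsub>C\<^esub> (\<kappa> \<cdot>\<^bsub>C\<^esub> \<epsilon>) = zero_map C (Dom C \<epsilon>) Z"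
    have hs: "h \<in> Arr C" "Dom C h = Dom C q" "Cod C h = Z" "Z \<in> Obj C" using h by (auto simp: hom_iff)
    have "h \<cdot>\<^bsub>C\<^esub> \<kappa> = zero_map C (Dom C \<kappa>) Z"
      by (rule regular_epi_cancel[OF \<epsilon>(1), where Z = Z]) (use hs h(2) \<kappa>d \<epsilon> in \<open>auto simp: hom_iff assoc\<close>)
    then show "\<exists>!u. u \<in> hom C (Cod C q) Z \<and> u \<cdot>\<^bsub>C\<^esub> q = h"
      using cokernel_univ[OF regular_epi_cokernel_of_kernel[OF q \<kappa>], of h Z] h \<kappa>d by simp
  qed (use \<kappa>d \<epsilon> in \<open>auto simp: hom_iff\<close>)
  ultimately show ?thesis by (simp add: right_exact_def)
qed

end

section \<open>Finite products and coproducts\<close>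

lemma omit_nth:
  assumes "j < length xs" "i < length xs - 1"
  shows "omit j xs ! i = (if i < j then xs ! i else xs ! Suc i)"
  using assms by (auto simp: omit_def nth_append)

lemma length_omit: "j < length xs \<Longrightarrow> length (omit j xs) = length xs - 1"
  by (simp add: omit_def)

lemma set_omit: "set (omit j xs) \<subseteq> set xs"
  by (auto simp: omit_def dest: in_set_takeD in_set_dropD)

lemma omit_of_map: "omit j (map f xs) = map f (omit j xs)"
  by (simp add: omit_def take_map drop_map)

section \<open>Morphisms into chosen finite products\<close>

context regular_category
begin

lemma product_is_product:
  assumes "set Xs \<subseteq> Obj C"
  shows "is_product C Xs (product C Xs) (projs C Xs)"
proof -
  have "\<exists>x. case x of (P, ps) \<Rightarrow> is_product C Xs P ps"
    using finite_products assms unfolding has_finite_products_def by auto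
  from someI_ex[OF this] show ?thesis
    unfolding product_def projs_def prod_cone_def split_def .
qed

text \<open>With \<open>v\<close> zero, the second part describes what a morphism into a product
  kills; this is how the kernel defining a cross-effect becomes accessible.\<close>

lemma tuple_comp_eq_iff:
  assumes Xs: "set Xs \<subseteq> Obj C" and W: "W \<in> Obj C"
    and gs: "list_all2 (\<lambda>X g. g \<in> hom C W X) Xs gs"
    and uv: "u \<in> hom C V W" "v \<in> hom C V W"
  shows "tuple C Xs W gs \<in> hom C W (product C Xs)"
    and "tuple C Xs W gs \<cdot>\<^bsub>C\<^esub> u = tuple C Xs W gs \<cdot>\<^bsub>C\<^esub> v \<longleftrightarrow> (\<forall>g \<in> set gs. g \<cdot>\<^bsub>C\<^esub> u = g \<cdot>\<^bsub>C\<^esub> v)"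
proof -
  let ?t = "tuple C Xs W gs" and ?P = "product C Xs" and ?ps = "projs C Xs"
  note prod = product_is_product[OF Xs, unfolded is_product_def]
  have univ: "\<exists>!h. h \<in> hom C W ?P \<and> map (\<lambda>p. p \<cdot>\<^bsub>C\<^esub> h) ?ps = gs"
    if "W \<in> Obj C" "list_all2 (\<lambda>X g. g \<in> hom C W X) Xs gs" for W gs
    using prod that by blast
  have t: "?t \<in> hom C W ?P" "map (\<lambda>p. p \<cdot>\<^bsub>C\<^esub> ?t) ?ps = gs"
    using theI'[OF univ[OF W gs]] unfolding tuple_def by auto
  then show "?t \<in> hom C W ?P" by blast
  have V: "V \<in> Obj C" using hom_obj uv by blast
  have ps: "p \<in> Arr C" "Dom C p = ?P" if "p \<in> set ?ps" for p
    using prod that unfolding list_all2_conv_all_nth hom_iff by (auto simp: in_set_conv_nth)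
  have map_t: "map (\<lambda>p. p \<cdot>\<^bsub>C\<^esub> (?t \<cdot>\<^bsub>C\<^esub> x)) ?ps = map (\<lambda>g. g \<cdot>\<^bsub>C\<^esub> x) gs"
    if x: "x \<in> hom C V W" for x
  proof -
    have "map (\<lambda>p. p \<cdot>\<^bsub>C\<^esub> (?t \<cdot>\<^bsub>C\<^esub> x)) ?ps = map (\<lambda>g. g \<cdot>\<^bsub>C\<^esub> x) (map (\<lambda>p. p \<cdot>\<^bsub>C\<^esub> ?t) ?ps)"
      unfolding map_map comp_def
      by (rule map_cong[OF refl]) (use x t(1) ps in \<open>simp add: hom_iff assoc\<close>)
    then show ?thesis unfolding t(2) .
  qed
  have "list_all2 (\<lambda>X g. g \<in> hom C V X) Xs (map (\<lambda>g. g \<cdot>\<^bsub>C\<^esub> u) gs)"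
    using gs comp_hom[OF uv(1)] by (auto simp: list_all2_conv_all_nth)
  from univ[OF V this]
  have "map (\<lambda>g. g \<cdot>\<^bsub>C\<^esub> u) gs = map (\<lambda>g. g \<cdot>\<^bsub>C\<^esub> v) gs \<Longrightarrow> ?t \<cdot>\<^bsub>C\<^esub> u = ?t \<cdot>\<^bsub>C\<^esub> v"
    using map_t[OF uv(1)] map_t[OF uv(2)] comp_hom[OF uv(1) t(1)] comp_hom[OF uv(2) t(1)] by auto
  moreover have "map (\<lambda>g. g \<cdot>\<^bsub>C\<^esub> u) gs = map (\<lambda>g. g \<cdot>\<^bsub>C\<^esub> v) gs" if "?t \<cdot>\<^bsub>C\<^esub> u = ?t \<cdot>\<^bsub>C\<^esub> v"
    using map_t[OF uv(1)] map_t[OF uv(2)] that by simp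
  ultimately have "?t \<cdot>\<^bsub>C\<^esub> u = ?t \<cdot>\<^bsub>C\<^esub> v \<longleftrightarrow> map (\<lambda>g. g \<cdot>\<^bsub>C\<^esub> u) gs = map (\<lambda>g. g \<cdot>\<^bsub>C\<^esub> v) gs"
    by (rule iffI[rotated])
  then show "?t \<cdot>\<^bsub>C\<^esub> u = ?t \<cdot>\<^bsub>C\<^esub> v \<longleftrightarrow> (\<forall>g \<in> set gs. g \<cdot>\<^bsub>C\<^esub> u = g \<cdot>\<^bsub>C\<^esub> v)"
    unfolding map_eq_conv .
qed

end

section \<open>Finite coproducts in a pointed category\<close>

lemma coproduct_univ:
  assumes "is_coproduct C Xs P is" "Z \<in> Obj C" "list_all2 (\<lambda>X g. g \<in> hom C X Z) Xs gs"
  shows "\<exists>!h. h \<in> hom C P Z \<and> map (\<lambda>i. h \<cdot>\<^bsub>C\<^esub> i) is = gs"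
  using assms(1)[unfolded is_coproduct_def, THEN conjunct2, THEN conjunct2, THEN bspec, OF assms(2),
      THEN spec, THEN mp, OF assms(3)] .

text \<open>Cross-effects involve coproducts of lists of several lengths, including the one-element
  lists left after deleting an entry of a pair. The zero object is the empty coproduct, and an entry
  is added in front by a binary coproduct.\<close>

lemma (in pointed_category) finite_coproducts_if_binary:
  assumes bin: "has_binary_coproducts C"
  shows "has_finite_coproducts C"
  unfolding has_finite_coproducts_def
proof (intro allI impI)
  fix Xs show "set Xs \<subseteq> Obj C \<Longrightarrow> \<exists>P is. is_coproduct C Xs P is"
  proof (induction Xs)
    case Nil
    obtain Z where Z: "is_zero C Z" using ex_zero by blast
    then have "is_coproduct C [] Z []" by (auto simp: is_coproduct_def is_zero_def)
    then show ?case by blast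
  next
    case (Cons X Xs)
    then obtain P "is" where P: "is_coproduct C Xs P is" by auto
    then have Pd: "P \<in> Obj C" "list_all2 (\<lambda>X i. i \<in> hom C X P) Xs is"
      unfolding is_coproduct_def by blast+
    note Pu = coproduct_univ[OF P]
    have "X \<in> Obj C" using Cons.prems by simp
    then obtain Q js where Q: "is_coproduct C [X, P] Q js"
      using bin Pd(1) unfolding has_binary_coproducts_def by blast
    then obtain a b where ab: "js = [a, b]" "a \<in> hom C X Q" "b \<in> hom C P Q" and Qo: "Q \<in> Obj C"
      unfolding is_coproduct_def by (auto simp: list_all2_Cons1)
    have Qu: "\<exists>!h. h \<in> hom C Q Z \<and> h \<cdot>\<^bsub>C\<^esub> a = g \<and> h \<cdot>\<^bsub>C\<^esub> b = g'"
      if "Z \<in> Obj C" "g \<in> hom C X Z" "g' \<in> hom C P Z" for Z g g'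
    proof -
      have "list_all2 (\<lambda>X g. g \<in> hom C X Z) [X, P] [g, g']" using that by simp
      from coproduct_univ[OF Q that(1) this] show ?thesis by (simp add: ab(1))
    qed
    have is_arr: "i \<in> Arr C" "Cod C i = P" if "i \<in> set is" for i
      using Pd(2) that unfolding list_all2_conv_all_nth hom_iff by (auto simp: in_set_conv_nth)
    have "is_coproduct C (X # Xs) Q (a # map (\<lambda>i. b \<cdot>\<^bsub>C\<^esub> i) is)"
      unfolding is_coproduct_def
    proof (intro conjI ballI allI impI)
      show "list_all2 (\<lambda>X i. i \<in> hom C X Q) (X # Xs) (a # map (\<lambda>i. b \<cdot>\<^bsub>C\<^esub> i) is)"
        using Pd(2) comp_hom[OF _ ab(3)] ab(2) by (auto simp: list.rel_map elim: list_all2_mono)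
      fix Z hs assume Z: "Z \<in> Obj C" and hs: "list_all2 (\<lambda>X g. g \<in> hom C X Z) (X # Xs) hs"
      then obtain g gs where gs: "hs = g # gs" "g \<in> hom C X Z" "list_all2 (\<lambda>X g. g \<in> hom C X Z) Xs gs"
        by (auto simp: list_all2_Cons1)
      obtain g' where g': "g' \<in> hom C P Z" "map (\<lambda>i. g' \<cdot>\<^bsub>C\<^esub> i) is = gs" using Pu[OF Z gs(3)] by blast
      obtain h where h: "h \<in> hom C Q Z" "h \<cdot>\<^bsub>C\<^esub> a = g" "h \<cdot>\<^bsub>C\<^esub> b = g'" using Qu[OF Z gs(2) g'(1)] by blast
      have map_h: "map ((\<lambda>i. v \<cdot>\<^bsub>C\<^esub> i) \<circ> (\<lambda>i. b \<cdot>\<^bsub>C\<^esub> i)) is = map (\<lambda>i. (v \<cdot>\<^bsub>C\<^esub> b) \<cdot>\<^bsub>C\<^esub> i) is"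
        if "v \<in> hom C Q Z" for v
        by (rule map_cong[OF refl]) (use that is_arr ab in \<open>auto simp: hom_iff assoc\<close>)
      show "\<exists>!h. h \<in> hom C Q Z \<and> map (\<lambda>i. h \<cdot>\<^bsub>C\<^esub> i) (a # map (\<lambda>i. b \<cdot>\<^bsub>C\<^esub> i) is) = hs"
      proof (rule ex1I[of _ h])
        show "h \<in> hom C Q Z \<and> map (\<lambda>i. h \<cdot>\<^bsub>C\<^esub> i) (a # map (\<lambda>i. b \<cdot>\<^bsub>C\<^esub> i) is) = hs"
          using h g' map_h[OF h(1)] by (simp add: gs(1))
      next
        fix v assume v: "v \<in> hom C Q Z \<and> map (\<lambda>i. v \<cdot>\<^bsub>C\<^esub> i) (a # map (\<lambda>i. b \<cdot>\<^bsub>C\<^esub> i) is) = hs"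
        then have "v \<cdot>\<^bsub>C\<^esub> a = g" "map (\<lambda>i. (v \<cdot>\<^bsub>C\<^esub> b) \<cdot>\<^bsub>C\<^esub> i) is = gs" "v \<cdot>\<^bsub>C\<^esub> b \<in> hom C P Z"
          using map_h[of v] comp_hom[OF ab(3)] by (auto simp: gs(1))
        moreover from this have "v \<cdot>\<^bsub>C\<^esub> b = g'" using Pu[OF Z gs(3)] g' by blast
        ultimately show "v = h" using Qu[OF Z gs(2) g'(1)] h v by blast
      qed
    qed (fact Qo)
    then show ?case by blast
  qed
qed

locale pointed_cocartesian_category = pointed_category +
  assumes finite_coproducts: "has_finite_coproducts C"
begin

lemma coprod_is_coproduct:
  assumes "set Xs \<subseteq> Obj C"
  shows "is_coproduct C Xs (coprod C Xs) (injs C Xs)"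
proof -
  have "\<exists>x. case x of (P, is) \<Rightarrow> is_coproduct C Xs P is"
    using finite_coproducts assms unfolding has_finite_coproducts_def by auto
  from someI_ex[OF this] show ?thesis
    unfolding coprod_def injs_def coprod_cocone_def split_def .
qed

lemma coprod_obj [simp]: "set Xs \<subseteq> Obj C \<Longrightarrow> coprod C Xs \<in> Obj C"
  using coprod_is_coproduct unfolding is_coproduct_def by blast

lemma length_injs [simp]: "set Xs \<subseteq> Obj C \<Longrightarrow> length (injs C Xs) = length Xs"
  using coprod_is_coproduct[of Xs] unfolding is_coproduct_def by (auto dest: list_all2_lengthD)

lemma injs_simps [simp]:
  assumes "set Xs \<subseteq> Obj C" "i < length Xs"
  shows "injs C Xs ! i \<in> Arr C" "Dom C (injs C Xs ! i) = Xs ! i" "Cod C (injs C Xs ! i) = coprod C Xs"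
  using coprod_is_coproduct[OF assms(1)] assms(2) unfolding is_coproduct_def
  by (auto simp: list_all2_conv_all_nth hom_iff)

lemma cotuple:
  assumes "set Xs \<subseteq> Obj C" "Z \<in> Obj C" "length gs = length Xs"
    and "\<And>i. i < length Xs \<Longrightarrow> gs ! i \<in> hom C (Xs ! i) Z"
  shows "cotuple C Xs Z gs \<in> hom C (coprod C Xs) Z"
    and "i < length Xs \<Longrightarrow> cotuple C Xs Z gs \<cdot>\<^bsub>C\<^esub> injs C Xs ! i = gs ! i"
proof -
  have "list_all2 (\<lambda>X g. g \<in> hom C X Z) Xs gs" using assms by (auto simp: list_all2_conv_all_nth)
  then have "\<exists>!h. h \<in> hom C (coprod C Xs) Z \<and> map (\<lambda>i. h \<cdot>\<^bsub>C\<^esub> i) (injs C Xs) = gs"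
    by (rule coproduct_univ[OF coprod_is_coproduct[OF assms(1)] assms(2)])
  from theI'[OF this]
  have t: "cotuple C Xs Z gs \<in> hom C (coprod C Xs) Z" "map (\<lambda>i. cotuple C Xs Z gs \<cdot>\<^bsub>C\<^esub> i) (injs C Xs) = gs"
    unfolding cotuple_def by auto
  then show "cotuple C Xs Z gs \<in> hom C (coprod C Xs) Z" by blast
  show "cotuple C Xs Z gs \<cdot>\<^bsub>C\<^esub> injs C Xs ! i = gs ! i" if "i < length Xs"
    using arg_cong[OF t(2), of "\<lambda>xs. xs ! i"] that assms(1) by simp
qed

lemma coprod_eqI:
  assumes Xs: "set Xs \<subseteq> Obj C" and uv: "u \<in> hom C (coprod C Xs) Z" "v \<in> hom C (coprod C Xs) Z"
    and eq: "\<And>i. i < length Xs \<Longrightarrow> u \<cdot>\<^bsub>C\<^esub> injs C Xs ! i = v \<cdot>\<^bsub>C\<^esub> injs C Xs ! i"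
  shows "u = v"
proof -
  have "Z \<in> Obj C" using hom_obj uv by blast
  moreover have "list_all2 (\<lambda>X g. g \<in> hom C X Z) Xs (map (\<lambda>i. u \<cdot>\<^bsub>C\<^esub> i) (injs C Xs))"
    using Xs uv by (auto simp: list_all2_conv_all_nth hom_iff)
  ultimately have "\<exists>!h. h \<in> hom C (coprod C Xs) Z \<and>
      map (\<lambda>i. h \<cdot>\<^bsub>C\<^esub> i) (injs C Xs) = map (\<lambda>i. u \<cdot>\<^bsub>C\<^esub> i) (injs C Xs)"
    by (rule coproduct_univ[OF coprod_is_coproduct[OF Xs]])
  moreover have "map (\<lambda>i. v \<cdot>\<^bsub>C\<^esub> i) (injs C Xs) = map (\<lambda>i. u \<cdot>\<^bsub>C\<^esub> i) (injs C Xs)"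
    by (rule nth_equalityI) (use eq Xs in auto)
  ultimately show ?thesis using uv by blast
qed

lemma coprod_map:
  assumes fs: "set fs \<subseteq> Arr C"
  shows "coprod_map C fs \<in> hom C (coprod C (map (Dom C) fs)) (coprod C (map (Cod C) fs))"
    and "i < length fs \<Longrightarrow>
      coprod_map C fs \<cdot>\<^bsub>C\<^esub> injs C (map (Dom C) fs) ! i = injs C (map (Cod C) fs) ! i \<cdot>\<^bsub>C\<^esub> fs ! i"
proof -
  let ?Xs = "map (Dom C) fs" and ?Ys = "map (Cod C) fs"
  let ?gs = "map2 (\<lambda>i f. i \<cdot>\<^bsub>C\<^esub> f) (injs C ?Ys) fs"
  have f: "fs ! i \<in> Arr C" if "i < length fs" for i using that fs by auto
  have Xs: "set ?Xs \<subseteq> Obj C" "set ?Ys \<subseteq> Obj C" using fs by auto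
  have gs: "?gs ! i = injs C ?Ys ! i \<cdot>\<^bsub>C\<^esub> fs ! i" if "i < length fs" for i using that Xs by simp
  have gsh: "?gs ! i \<in> hom C (?Xs ! i) (coprod C ?Ys)" if "i < length ?Xs" for i
    using that Xs f by (simp add: hom_iff)
  have l: "length ?gs = length ?Xs" using Xs by simp
  show "coprod_map C fs \<in> hom C (coprod C ?Xs) (coprod C ?Ys)"
    unfolding coprod_map_def Let_def by (rule cotuple(1)[OF Xs(1) _ l gsh]) (use Xs in auto)
  show "coprod_map C fs \<cdot>\<^bsub>C\<^esub> injs C ?Xs ! i = injs C ?Ys ! i \<cdot>\<^bsub>C\<^esub> fs ! i" if "i < length fs"
    unfolding coprod_map_def Let_def
    using cotuple(2)[OF Xs(1) _ l gsh, of i] that Xs gs by simp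
qed

lemma omit_map:
  assumes Xs: "set Xs \<subseteq> Obj C" and j: "j < length Xs"
  shows "omit_map C Xs j \<in> hom C (coprod C Xs) (coprod C (omit j Xs))"
    and "i < length Xs \<Longrightarrow> omit_map C Xs j \<cdot>\<^bsub>C\<^esub> injs C Xs ! i =
      (if i < j then injs C (omit j Xs) ! i
       else if i = j then zero_map C (Xs ! j) (coprod C (omit j Xs))
       else injs C (omit j Xs) ! (i - 1))"
proof -
  let ?Ys = "omit j Xs"
  let ?gs = "take j (injs C ?Ys) @ [zero_map C (Xs ! j) (coprod C ?Ys)] @ drop j (injs C ?Ys)"
  have Ys: "set ?Ys \<subseteq> Obj C" using subset_trans[OF set_omit Xs] .
  have l: "length (injs C ?Ys) = length Xs - 1" using Ys j by (simp add: length_omit)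
  \<comment> \<open>Past position \<open>j\<close> the injections are shifted by the inserted zero,
    hence the index \<open>i - 1\<close>.\<close>
  have gs: "?gs ! i = (if i < j then injs C ?Ys ! i else if i = j then zero_map C (Xs ! j) (coprod C ?Ys)
      else injs C ?Ys ! (i - 1))" if "i < length Xs" for i
  proof (cases "i \<le> j")
    case False
    then obtain m where "i = Suc m" "j \<le> m" by (cases i) auto
    then show ?thesis using that j l by (simp add: nth_append)
  qed (use that j l in \<open>simp add: nth_append\<close>)
  have Xo: "Xs ! i \<in> Obj C" if "i < length Xs" for i using that Xs by auto
  have gsh: "?gs ! i \<in> hom C (Xs ! i) (coprod C ?Ys)" if "i < length Xs" for i
    unfolding gs[OF that] using that Ys j Xo by (auto simp: hom_iff length_omit omit_nth)
  have lg: "length ?gs = length Xs" using l j by simp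
  show "omit_map C Xs j \<in> hom C (coprod C Xs) (coprod C ?Ys)"
    unfolding omit_map_def Let_def by (rule cotuple(1)[OF Xs _ lg gsh]) (use Ys in auto)
  show "omit_map C Xs j \<cdot>\<^bsub>C\<^esub> injs C Xs ! i = (if i < j then injs C ?Ys ! i
       else if i = j then zero_map C (Xs ! j) (coprod C ?Ys) else injs C ?Ys ! (i - 1))"
    if "i < length Xs"
    unfolding omit_map_def Let_def
    using cotuple(2)[OF Xs _ lg gsh, of i] that Ys gs by simp
qed

text \<open>Naturality of the \<open>r_j\<close>, on which functoriality of cross-effects rests. On
  summand \<open>j\<close> both sides vanish; on the other summands both are an injection after
  \<open>fs ! i\<close>.\<close>

lemma omit_map_natural:
  assumes fs: "set fs \<subseteq> Arr C" and j: "j < length fs"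
  shows "omit_map C (map (Cod C) fs) j \<cdot>\<^bsub>C\<^esub> coprod_map C fs =
    coprod_map C (omit j fs) \<cdot>\<^bsub>C\<^esub> omit_map C (map (Dom C) fs) j"
proof -
  let ?Xs = "map (Dom C) fs" and ?Ys = "map (Cod C) fs"
  have Xs: "set ?Xs \<subseteq> Obj C" "set ?Ys \<subseteq> Obj C" using fs by auto
  have fs': "set (omit j fs) \<subseteq> Arr C" using subset_trans[OF set_omit fs] .
  have f: "fs ! i \<in> Arr C" if "i < length fs" for i using that fs by auto
  have Xs': "set (omit j ?Xs) \<subseteq> Obj C" "set (omit j ?Ys) \<subseteq> Obj C" using fs' by (auto simp: omit_of_map)
  note cm = coprod_map(1)[OF fs]
  have cm': "coprod_map C (omit j fs) \<in> hom C (coprod C (omit j ?Xs)) (coprod C (omit j ?Ys))"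
    using coprod_map(1)[OF fs'] unfolding omit_of_map .
  have om: "omit_map C ?Xs j \<in> hom C (coprod C ?Xs) (coprod C (omit j ?Xs))"
    "omit_map C ?Ys j \<in> hom C (coprod C ?Ys) (coprod C (omit j ?Ys))"
    using omit_map(1)[OF Xs(1)] omit_map(1)[OF Xs(2)] j by auto
  have a: "coprod_map C fs \<in> Arr C" "Dom C (coprod_map C fs) = coprod C ?Xs" "Cod C (coprod_map C fs) = coprod C ?Ys"
    "coprod_map C (omit j fs) \<in> Arr C" "Dom C (coprod_map C (omit j fs)) = coprod C (omit j ?Xs)"
    "Cod C (coprod_map C (omit j fs)) = coprod C (omit j ?Ys)"
    "omit_map C ?Xs j \<in> Arr C" "Dom C (omit_map C ?Xs j) = coprod C ?Xs"
    "Cod C (omit_map C ?Xs j) = coprod C (omit j ?Xs)"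
    "omit_map C ?Ys j \<in> Arr C" "Dom C (omit_map C ?Ys j) = coprod C ?Ys"
    "Cod C (omit_map C ?Ys j) = coprod C (omit j ?Ys)"
    using cm cm' om by (auto simp: hom_iff)
  show ?thesis
  proof (rule coprod_eqI[OF Xs(1), where Z = "coprod C (omit j ?Ys)"])
    fix i assume "i < length ?Xs"
    then have i: "i < length fs" by simp
    have "(omit_map C ?Ys j \<cdot>\<^bsub>C\<^esub> coprod_map C fs) \<cdot>\<^bsub>C\<^esub> injs C ?Xs ! i =
        (omit_map C ?Ys j \<cdot>\<^bsub>C\<^esub> injs C ?Ys ! i) \<cdot>\<^bsub>C\<^esub> fs ! i"
      using i Xs a f by (simp add: assoc coprod_map(2)[OF fs])
    moreover have "(coprod_map C (omit j fs) \<cdot>\<^bsub>C\<^esub> omit_map C ?Xs j) \<cdot>\<^bsub>C\<^esub> injs C ?Xs ! i =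
        coprod_map C (omit j fs) \<cdot>\<^bsub>C\<^esub> (omit_map C ?Xs j \<cdot>\<^bsub>C\<^esub> injs C ?Xs ! i)"
      using i Xs a by (simp add: assoc)
    moreover have "(omit_map C ?Ys j \<cdot>\<^bsub>C\<^esub> injs C ?Ys ! i) \<cdot>\<^bsub>C\<^esub> fs ! i =
        coprod_map C (omit j fs) \<cdot>\<^bsub>C\<^esub> (omit_map C ?Xs j \<cdot>\<^bsub>C\<^esub> injs C ?Xs ! i)"
    proof -
      have cm2: "coprod_map C (omit j fs) \<cdot>\<^bsub>C\<^esub> injs C (omit j ?Xs) ! i' =
          injs C (omit j ?Ys) ! i' \<cdot>\<^bsub>C\<^esub> omit j fs ! i'" if "i' < length fs - 1" for i'
        using coprod_map(2)[OF fs', of i'] that j by (simp add: omit_of_map length_omit)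
      consider "i < j" | "i = j" | "i > j" by linarith
      then show ?thesis
      proof cases
        case 1
        then show ?thesis
          using i j Xs omit_map(2)[OF Xs(1), of j i] omit_map(2)[OF Xs(2), of j i] cm2[of i]
          by (simp add: omit_nth)
      next
        case 2
        then show ?thesis
          using i j Xs Xs' a f omit_map(2)[OF Xs(1), of j i] omit_map(2)[OF Xs(2), of j i] by simp
      next
        case 3
        then obtain i' where "i = Suc i'" "j \<le> i'" by (cases i) auto
        then show ?thesis
          using i j Xs omit_map(2)[OF Xs(1), of j i] omit_map(2)[OF Xs(2), of j i] cm2[of i']
          by (simp add: omit_nth)
      qed
    qed
    ultimately show "(omit_map C ?Ys j \<cdot>\<^bsub>C\<^esub> coprod_map C fs) \<cdot>\<^bsub>C\<^esub> injs C ?Xs ! i =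
        (coprod_map C (omit j fs) \<cdot>\<^bsub>C\<^esub> omit_map C ?Xs j) \<cdot>\<^bsub>C\<^esub> injs C ?Xs ! i"
      by simp
  qed (use a in \<open>auto simp: hom_iff\<close>)
qed

section \<open>Binary coproducts and their retractions\<close>

definition inl :: "'a \<Rightarrow> 'a \<Rightarrow> 'b" where "inl X Y = injs C [X, Y] ! 0"

definition inr :: "'a \<Rightarrow> 'a \<Rightarrow> 'b" where "inr X Y = injs C [X, Y] ! 1"

definition copair :: "'b \<Rightarrow> 'b \<Rightarrow> 'b"
  where "copair a b = cotuple C [Dom C a, Dom C b] (Cod C a) [a, b]"

text \<open>With \<open>retr\<close>, a substitute for the \<open>r_j\<close> of a pair: these end
  in \<open>X\<close> and \<open>Y\<close> themselves, whereas \<open>omit_map\<close> ends in the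
  chosen coproduct of a one-element list.\<close>

definition retl :: "'a \<Rightarrow> 'a \<Rightarrow> 'b" where "retl X Y = copair (Ident C X) (zero_map C Y X)"

definition retr :: "'a \<Rightarrow> 'a \<Rightarrow> 'b" where "retr X Y = copair (zero_map C X Y) (Ident C Y)"

lemma in_simps [simp]:
  assumes "X \<in> Obj C" "Y \<in> Obj C"
  shows "inl X Y \<in> Arr C" "Dom C (inl X Y) = X" "Cod C (inl X Y) = coprod C [X, Y]"
    "inr X Y \<in> Arr C" "Dom C (inr X Y) = Y" "Cod C (inr X Y) = coprod C [X, Y]"
  using assms injs_simps[of "[X, Y]" 0] injs_simps[of "[X, Y]" 1] by (auto simp: inl_def inr_def)

lemma pair_eqI:
  assumes uv: "u \<in> hom C (coprod C [X, Y]) Z" "v \<in> hom C (coprod C [X, Y]) Z"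
    and XY: "X \<in> Obj C" "Y \<in> Obj C"
    and "u \<cdot>\<^bsub>C\<^esub> inl X Y = v \<cdot>\<^bsub>C\<^esub> inl X Y" "u \<cdot>\<^bsub>C\<^esub> inr X Y = v \<cdot>\<^bsub>C\<^esub> inr X Y"
  shows "u = v"
  by (rule coprod_eqI[OF _ uv]) (use assms in \<open>auto simp: inl_def inr_def less_Suc_eq\<close>)

lemma copair_simps [simp]:
  assumes "a \<in> Arr C" "b \<in> Arr C" "Cod C a = Cod C b"
  shows "copair a b \<in> Arr C" "Dom C (copair a b) = coprod C [Dom C a, Dom C b]"
    "Cod C (copair a b) = Cod C b"
    "Dom C a = X \<Longrightarrow> Dom C b = Y \<Longrightarrow> copair a b \<cdot>\<^bsub>C\<^esub> inl X Y = a"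
    "Dom C a = X \<Longrightarrow> Dom C b = Y \<Longrightarrow> copair a b \<cdot>\<^bsub>C\<^esub> inr X Y = b"
proof -
  have *: "set [Dom C a, Dom C b] \<subseteq> Obj C" "Cod C a \<in> Obj C" "length [a, b] = length [Dom C a, Dom C b]"
    "\<And>i. i < length [Dom C a, Dom C b] \<Longrightarrow> [a, b] ! i \<in> hom C ([Dom C a, Dom C b] ! i) (Cod C a)"
    using assms by (auto simp: hom_iff less_Suc_eq)
  show "copair a b \<in> Arr C" "Dom C (copair a b) = coprod C [Dom C a, Dom C b]"
    "Cod C (copair a b) = Cod C b"
    using cotuple(1)[OF *] assms(3) by (auto simp: copair_def hom_iff)
  show "copair a b \<cdot>\<^bsub>C\<^esub> inl X Y = a" if "Dom C a = X" "Dom C b = Y"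
    using cotuple(2)[OF *, of 0] that by (simp add: copair_def inl_def)
  show "copair a b \<cdot>\<^bsub>C\<^esub> inr X Y = b" if "Dom C a = X" "Dom C b = Y"
    using cotuple(2)[OF *, of 1] that by (simp add: copair_def inr_def)
qed

lemma copair_comp [simp]:
  assumes "a \<in> Arr C" "b \<in> Arr C" "Cod C a = Cod C b" "Dom C a = X" "Dom C b = Y" "h \<in> Arr C"
  shows "Cod C h = X \<Longrightarrow> copair a b \<cdot>\<^bsub>C\<^esub> (inl X Y \<cdot>\<^bsub>C\<^esub> h) = a \<cdot>\<^bsub>C\<^esub> h"
    "Cod C h = Y \<Longrightarrow> copair a b \<cdot>\<^bsub>C\<^esub> (inr X Y \<cdot>\<^bsub>C\<^esub> h) = b \<cdot>\<^bsub>C\<^esub> h"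
  using assms copair_simps(4,5)[THEN reassoc, OF assms(1-5), of h] by auto

lemma sum_map_simps [simp]:
  assumes "f \<in> Arr C" "g \<in> Arr C"
  shows "coprod_map C [f, g] \<in> Arr C" "Dom C (coprod_map C [f, g]) = coprod C [Dom C f, Dom C g]"
    "Cod C (coprod_map C [f, g]) = coprod C [Cod C f, Cod C g]"
    "Dom C f = X \<Longrightarrow> Dom C g = Y \<Longrightarrow>
      coprod_map C [f, g] \<cdot>\<^bsub>C\<^esub> inl X Y = inl (Cod C f) (Cod C g) \<cdot>\<^bsub>C\<^esub> f"
    "Dom C f = X \<Longrightarrow> Dom C g = Y \<Longrightarrow>
      coprod_map C [f, g] \<cdot>\<^bsub>C\<^esub> inr X Y = inr (Cod C f) (Cod C g) \<cdot>\<^bsub>C\<^esub> g"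
proof -
  have *: "set [f, g] \<subseteq> Arr C" using assms by simp
  show "coprod_map C [f, g] \<in> Arr C" "Dom C (coprod_map C [f, g]) = coprod C [Dom C f, Dom C g]"
    "Cod C (coprod_map C [f, g]) = coprod C [Cod C f, Cod C g]"
    using coprod_map(1)[OF *] by (auto simp: hom_iff)
  show "coprod_map C [f, g] \<cdot>\<^bsub>C\<^esub> inl X Y = inl (Cod C f) (Cod C g) \<cdot>\<^bsub>C\<^esub> f"
    if "Dom C f = X" "Dom C g = Y"
    using coprod_map(2)[OF *, of 0] that by (simp add: inl_def)
  show "coprod_map C [f, g] \<cdot>\<^bsub>C\<^esub> inr X Y = inr (Cod C f) (Cod C g) \<cdot>\<^bsub>C\<^esub> g"
    if "Dom C f = X" "Dom C g = Y"
    using coprod_map(2)[OF *, of 1] that by (simp add: inr_def)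
qed

lemma sum_map_comp [simp]:
  assumes "f \<in> Arr C" "g \<in> Arr C" "Dom C f = X" "Dom C g = Y" "h \<in> Arr C"
  shows "Cod C h = X \<Longrightarrow>
      coprod_map C [f, g] \<cdot>\<^bsub>C\<^esub> (inl X Y \<cdot>\<^bsub>C\<^esub> h) = inl (Cod C f) (Cod C g) \<cdot>\<^bsub>C\<^esub> (f \<cdot>\<^bsub>C\<^esub> h)"
    "Cod C h = Y \<Longrightarrow>
      coprod_map C [f, g] \<cdot>\<^bsub>C\<^esub> (inr X Y \<cdot>\<^bsub>C\<^esub> h) = inr (Cod C f) (Cod C g) \<cdot>\<^bsub>C\<^esub> (g \<cdot>\<^bsub>C\<^esub> h)"
  using assms sum_map_simps(4,5)[THEN reassoc, OF assms(1-4), of h] by (auto simp: assoc)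

lemma ret_simps [simp]:
  assumes "X \<in> Obj C" "Y \<in> Obj C"
  shows "retl X Y \<in> Arr C" "Dom C (retl X Y) = coprod C [X, Y]" "Cod C (retl X Y) = X"
    "retr X Y \<in> Arr C" "Dom C (retr X Y) = coprod C [X, Y]" "Cod C (retr X Y) = Y"
    "retl X Y \<cdot>\<^bsub>C\<^esub> inl X Y = Ident C X" "retl X Y \<cdot>\<^bsub>C\<^esub> inr X Y = zero_map C Y X"
    "retr X Y \<cdot>\<^bsub>C\<^esub> inl X Y = zero_map C X Y" "retr X Y \<cdot>\<^bsub>C\<^esub> inr X Y = Ident C Y"
    "h \<in> Arr C \<Longrightarrow> Cod C h = X \<Longrightarrow> retl X Y \<cdot>\<^bsub>C\<^esub> (inl X Y \<cdot>\<^bsub>C\<^esub> h) = h"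
    "h \<in> Arr C \<Longrightarrow> Cod C h = Y \<Longrightarrow> retl X Y \<cdot>\<^bsub>C\<^esub> (inr X Y \<cdot>\<^bsub>C\<^esub> h) = zero_map C (Dom C h) X"
    "h \<in> Arr C \<Longrightarrow> Cod C h = X \<Longrightarrow> retr X Y \<cdot>\<^bsub>C\<^esub> (inl X Y \<cdot>\<^bsub>C\<^esub> h) = zero_map C (Dom C h) Y"
    "h \<in> Arr C \<Longrightarrow> Cod C h = Y \<Longrightarrow> retr X Y \<cdot>\<^bsub>C\<^esub> (inr X Y \<cdot>\<^bsub>C\<^esub> h) = h"
  using assms by (simp_all add: retl_def retr_def)

lemma ret_sum_map:
  assumes "f \<in> Arr C" "g \<in> Arr C" "Cod C f = X" "Cod C g = Y"
  shows "retl X Y \<cdot>\<^bsub>C\<^esub> coprod_map C [f, g] = f \<cdot>\<^bsub>C\<^esub> retl (Dom C f) (Dom C g)"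
    "retr X Y \<cdot>\<^bsub>C\<^esub> coprod_map C [f, g] = g \<cdot>\<^bsub>C\<^esub> retr (Dom C f) (Dom C g)"
proof -
  have XY: "X \<in> Obj C" "Y \<in> Obj C" using assms by auto
  show "retl X Y \<cdot>\<^bsub>C\<^esub> coprod_map C [f, g] = f \<cdot>\<^bsub>C\<^esub> retl (Dom C f) (Dom C g)"
    by (rule pair_eqI[where X = "Dom C f" and Y = "Dom C g" and Z = X])
      (use assms XY in \<open>auto simp: hom_iff assoc\<close>)
  show "retr X Y \<cdot>\<^bsub>C\<^esub> coprod_map C [f, g] = g \<cdot>\<^bsub>C\<^esub> retr (Dom C f) (Dom C g)"
    by (rule pair_eqI[where X = "Dom C f" and Y = "Dom C g" and Z = Y])
      (use assms XY in \<open>auto simp: hom_iff assoc\<close>)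
qed

lemma sum_map_sum_map:
  assumes "f \<in> Arr C" "g \<in> Arr C" "f' \<in> Arr C" "g' \<in> Arr C" "Cod C f = Dom C f'" "Cod C g = Dom C g'"
  shows "coprod_map C [f', g'] \<cdot>\<^bsub>C\<^esub> coprod_map C [f, g] = coprod_map C [f' \<cdot>\<^bsub>C\<^esub> f, g' \<cdot>\<^bsub>C\<^esub> g]"
  by (rule pair_eqI[where X = "Dom C f" and Y = "Dom C g" and Z = "coprod C [Cod C f', Cod C g']"])
    (use assms in \<open>auto simp: hom_iff assoc\<close>)

lemma sum_map_Ident:
  assumes "X \<in> Obj C" "Y \<in> Obj C"
  shows "coprod_map C [Ident C X, Ident C Y] = Ident C (coprod C [X, Y])"
  by (rule pair_eqI[where X = X and Y = Y and Z = "coprod C [X, Y]"])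
    (use assms in \<open>auto simp: hom_iff assoc\<close>)

text \<open>This factorisation through \<open>X\<close> is why \<open>F(X|-)\<close> sends zero
  morphisms to zero: \<open>F(retl)\<close> vanishes on the cross-effect.\<close>

lemma sum_map_zero:
  assumes "X \<in> Obj C" "Y \<in> Obj C" "Z \<in> Obj C"
  shows "coprod_map C [Ident C X, zero_map C Y Z] = inl X Z \<cdot>\<^bsub>C\<^esub> retl X Y"
  by (rule pair_eqI[where X = X and Y = Y and Z = "coprod C [X, Z]"])
    (use assms in \<open>auto simp: hom_iff assoc\<close>)

text \<open>The chosen coproduct of \<open>[Y]\<close> is only isomorphic to \<open>Y\<close>. Each
  \<open>r_j\<close> is a retraction followed by a split mono, and is turned back into the
  retraction by a left inverse \<open>t\<close>; so after applying \<open>F\<close> the two kill the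
  same morphisms.\<close>

lemma omit_map_pair:
  assumes XY: "X \<in> Obj C" "Y \<in> Obj C"
  shows "omit_map C [X, Y] 0 = injs C [Y] ! 0 \<cdot>\<^bsub>C\<^esub> retr X Y"
    "omit_map C [X, Y] 1 = injs C [X] ! 0 \<cdot>\<^bsub>C\<^esub> retl X Y"
    "\<exists>t \<in> hom C (coprod C [Y]) Y. retr X Y = t \<cdot>\<^bsub>C\<^esub> omit_map C [X, Y] 0"
    "\<exists>t \<in> hom C (coprod C [X]) X. retl X Y = t \<cdot>\<^bsub>C\<^esub> omit_map C [X, Y] 1"
proof -
  have o [simp]: "omit 0 [X, Y] = [Y]" "omit (Suc 0) [X, Y] = [X]" by (auto simp: omit_def)
  have set: "set [X, Y] \<subseteq> Obj C" using XY by simp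
  have om: "omit_map C [X, Y] 0 \<in> hom C (coprod C [X, Y]) (coprod C [Y])"
    "omit_map C [X, Y] 1 \<in> hom C (coprod C [X, Y]) (coprod C [X])"
    using omit_map(1)[OF set, of 0] omit_map(1)[OF set, of 1] by auto
  have oi: "omit_map C [X, Y] 0 \<cdot>\<^bsub>C\<^esub> inl X Y = zero_map C X (coprod C [Y])"
    "omit_map C [X, Y] 0 \<cdot>\<^bsub>C\<^esub> inr X Y = injs C [Y] ! 0"
    "omit_map C [X, Y] 1 \<cdot>\<^bsub>C\<^esub> inl X Y = injs C [X] ! 0"
    "omit_map C [X, Y] 1 \<cdot>\<^bsub>C\<^esub> inr X Y = zero_map C Y (coprod C [X])"
    using omit_map(2)[OF set, of 0 0] omit_map(2)[OF set, of 0 1]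
      omit_map(2)[OF set, of 1 0] omit_map(2)[OF set, of 1 1] by (auto simp: inl_def inr_def)
  show eq: "omit_map C [X, Y] 0 = injs C [Y] ! 0 \<cdot>\<^bsub>C\<^esub> retr X Y"
    by (rule pair_eqI[OF om(1) _ XY]) (use XY oi in \<open>auto simp: hom_iff assoc\<close>)
  show eq': "omit_map C [X, Y] 1 = injs C [X] ! 0 \<cdot>\<^bsub>C\<^esub> retl X Y"
    by (rule pair_eqI[OF om(2) _ XY]) (use XY oi in \<open>auto simp: hom_iff assoc\<close>)
  have retract: "\<exists>t \<in> hom C (coprod C [Z]) Z. t \<cdot>\<^bsub>C\<^esub> injs C [Z] ! 0 = Ident C Z" if "Z \<in> Obj C" for Z
    using cotuple[of "[Z]" Z "[Ident C Z]"] that by (auto simp: hom_iff)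
  show "\<exists>t \<in> hom C (coprod C [Y]) Y. retr X Y = t \<cdot>\<^bsub>C\<^esub> omit_map C [X, Y] 0"
  proof -
    obtain t where t: "t \<in> hom C (coprod C [Y]) Y" "t \<cdot>\<^bsub>C\<^esub> injs C [Y] ! 0 = Ident C Y"
      using retract XY by blast
    have "t \<cdot>\<^bsub>C\<^esub> (injs C [Y] ! 0 \<cdot>\<^bsub>C\<^esub> retr X Y) = retr X Y"
      using t(1) XY by (simp add: hom_iff t(2)[THEN reassoc])
    then show ?thesis using t(1) eq by metis
  qed
  show "\<exists>t \<in> hom C (coprod C [X]) X. retl X Y = t \<cdot>\<^bsub>C\<^esub> omit_map C [X, Y] 1"
  proof -
    obtain t where t: "t \<in> hom C (coprod C [X]) X" "t \<cdot>\<^bsub>C\<^esub> injs C [X] ! 0 = Ident C X"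
      using retract XY by blast
    have "t \<cdot>\<^bsub>C\<^esub> (injs C [X] ! 0 \<cdot>\<^bsub>C\<^esub> retl X Y) = retl X Y"
      using t(1) XY by (simp add: hom_iff t(2)[THEN reassoc])
    then show ?thesis using t(1) eq' by metis
  qed
qed

section \<open>Ternary coproducts and associativity\<close>

lemma triple_eqI:
  assumes XYZ: "X \<in> Obj C" "Y \<in> Obj C" "Z \<in> Obj C"
    and uv: "u \<in> hom C (coprod C [X, Y, Z]) W" "v \<in> hom C (coprod C [X, Y, Z]) W"
    and eq: "u \<cdot>\<^bsub>C\<^esub> injs C [X, Y, Z] ! 0 = v \<cdot>\<^bsub>C\<^esub> injs C [X, Y, Z] ! 0"
      "u \<cdot>\<^bsub>C\<^esub> injs C [X, Y, Z] ! 1 = v \<cdot>\<^bsub>C\<^esub> injs C [X, Y, Z] ! 1"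
      "u \<cdot>\<^bsub>C\<^esub> injs C [X, Y, Z] ! 2 = v \<cdot>\<^bsub>C\<^esub> injs C [X, Y, Z] ! 2"
  shows "u = v"
proof (rule coprod_eqI[OF _ uv])
  fix i assume "i < length [X, Y, Z]"
  then consider "i = 0" | "i = 1" | "i = 2" by force
  then show "u \<cdot>\<^bsub>C\<^esub> injs C [X, Y, Z] ! i = v \<cdot>\<^bsub>C\<^esub> injs C [X, Y, Z] ! i" using eq by cases simp_all
qed (use XYZ in auto)

lemma triple_injs [simp]:
  assumes "X \<in> Obj C" "Y \<in> Obj C" "Z \<in> Obj C"
  shows "injs C [X, Y, Z] ! 0 \<in> hom C X (coprod C [X, Y, Z])"
    "injs C [X, Y, Z] ! Suc 0 \<in> hom C Y (coprod C [X, Y, Z])"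
    "injs C [X, Y, Z] ! 2 \<in> hom C Z (coprod C [X, Y, Z])"
  using injs_simps[of "[X, Y, Z]"] assms by (auto simp: hom_iff)

lemma coprod_assoc:
  assumes XYZ: "X \<in> Obj C" "Y \<in> Obj C" "Z \<in> Obj C"
  shows "coprod_assoc C X Y Z \<in> hom C (coprod C [X, Y, Z]) (coprod C [X, coprod C [Y, Z]])"
    "coprod_assoc C X Y Z \<cdot>\<^bsub>C\<^esub> injs C [X, Y, Z] ! 0 = inl X (coprod C [Y, Z])"
    "coprod_assoc C X Y Z \<cdot>\<^bsub>C\<^esub> injs C [X, Y, Z] ! 1 = inr X (coprod C [Y, Z]) \<cdot>\<^bsub>C\<^esub> inl Y Z"
    "coprod_assoc C X Y Z \<cdot>\<^bsub>C\<^esub> injs C [X, Y, Z] ! 2 = inr X (coprod C [Y, Z]) \<cdot>\<^bsub>C\<^esub> inr Y Z"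
proof -
  let ?T = "coprod C [Y, Z]"
  let ?gs = "[inl X ?T, inr X ?T \<cdot>\<^bsub>C\<^esub> inl Y Z, inr X ?T \<cdot>\<^bsub>C\<^esub> inr Y Z]"
  have eq: "coprod_assoc C X Y Z = cotuple C [X, Y, Z] (coprod C [X, ?T]) ?gs"
    unfolding coprod_assoc_def Let_def inl_def inr_def ..
  have *: "set [X, Y, Z] \<subseteq> Obj C" "coprod C [X, ?T] \<in> Obj C" "length ?gs = length [X, Y, Z]"
    "\<And>i. i < length [X, Y, Z] \<Longrightarrow> ?gs ! i \<in> hom C ([X, Y, Z] ! i) (coprod C [X, ?T])"
    using XYZ by (auto simp: hom_iff less_Suc_eq)
  show "coprod_assoc C X Y Z \<in> hom C (coprod C [X, Y, Z]) (coprod C [X, ?T])"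
    unfolding eq by (rule cotuple(1)[OF *])
  show "coprod_assoc C X Y Z \<cdot>\<^bsub>C\<^esub> injs C [X, Y, Z] ! 0 = inl X ?T"
    "coprod_assoc C X Y Z \<cdot>\<^bsub>C\<^esub> injs C [X, Y, Z] ! 1 = inr X ?T \<cdot>\<^bsub>C\<^esub> inl Y Z"
    "coprod_assoc C X Y Z \<cdot>\<^bsub>C\<^esub> injs C [X, Y, Z] ! 2 = inr X ?T \<cdot>\<^bsub>C\<^esub> inr Y Z"
    unfolding eq using cotuple(2)[OF *, of 0] cotuple(2)[OF *, of 1] cotuple(2)[OF *, of 2] by auto
qed

lemma coprod_assoc_simps [simp]:
  assumes "X \<in> Obj C" "Y \<in> Obj C" "Z \<in> Obj C"
  shows "coprod_assoc C X Y Z \<in> Arr C" "Dom C (coprod_assoc C X Y Z) = coprod C [X, Y, Z]"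
    "Cod C (coprod_assoc C X Y Z) = coprod C [X, coprod C [Y, Z]]"
  using coprod_assoc(1)[OF assms] by (auto simp: hom_iff)

text \<open>The inverse carries elements of \<open>F(X + (K + B))\<close> back to
  \<open>F(X + K + B)\<close> when \<open>F(X|K|B)\<close> is recognised as a kernel.\<close>

lemma coprod_assoc_iso:
  assumes XYZ: "X \<in> Obj C" "Y \<in> Obj C" "Z \<in> Obj C"
  obtains \<beta> where "\<beta> \<in> hom C (coprod C [X, coprod C [Y, Z]]) (coprod C [X, Y, Z])"
    "\<beta> \<cdot>\<^bsub>C\<^esub> coprod_assoc C X Y Z = Ident C (coprod C [X, Y, Z])"
    "coprod_assoc C X Y Z \<cdot>\<^bsub>C\<^esub> \<beta> = Ident C (coprod C [X, coprod C [Y, Z]])"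
proof -
  let ?i = "\<lambda>n. injs C [X, Y, Z] ! n" and ?\<alpha> = "coprod_assoc C X Y Z"
  define \<beta> where "\<beta> = copair (?i 0) (copair (?i 1) (?i 2))"
  note inj = triple_injs[OF XYZ, unfolded hom_iff]
  note \<alpha> = coprod_assoc[OF XYZ]
  have \<beta>: "\<beta> \<in> Arr C" "Dom C \<beta> = coprod C [X, coprod C [Y, Z]]" "Cod C \<beta> = coprod C [X, Y, Z]"
    using inj by (auto simp: \<beta>_def)
  have \<beta>i: "\<beta> \<cdot>\<^bsub>C\<^esub> inl X (coprod C [Y, Z]) = ?i 0" "\<beta> \<cdot>\<^bsub>C\<^esub> (inr X (coprod C [Y, Z]) \<cdot>\<^bsub>C\<^esub> inl Y Z) = ?i 1"
    "\<beta> \<cdot>\<^bsub>C\<^esub> (inr X (coprod C [Y, Z]) \<cdot>\<^bsub>C\<^esub> inr Y Z) = ?i 2"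
    using inj XYZ by (auto simp: \<beta>_def)
  show thesis
  proof (rule that[of \<beta>])
    show "\<beta> \<in> hom C (coprod C [X, coprod C [Y, Z]]) (coprod C [X, Y, Z])" using \<beta> by (simp add: hom_iff)
    show "\<beta> \<cdot>\<^bsub>C\<^esub> ?\<alpha> = Ident C (coprod C [X, Y, Z])"
      by (rule triple_eqI[OF XYZ, where W = "coprod C [X, Y, Z]"])
        (use \<beta> \<beta>i inj XYZ \<alpha>(2-4) in \<open>auto simp: hom_iff assoc\<close>)
    have \<beta>r: "\<beta> \<cdot>\<^bsub>C\<^esub> inr X (coprod C [Y, Z]) = copair (?i 1) (?i 2)"
      using inj XYZ by (auto simp: \<beta>_def)
    have \<alpha>c: "?\<alpha> \<cdot>\<^bsub>C\<^esub> copair (?i 1) (?i 2) = inr X (coprod C [Y, Z])"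
      by (rule pair_eqI[where X = Y and Y = Z and Z = "coprod C [X, coprod C [Y, Z]]"])
        (use inj XYZ \<alpha>(2-4) in \<open>auto simp: hom_iff assoc\<close>)
    show "?\<alpha> \<cdot>\<^bsub>C\<^esub> \<beta> = Ident C (coprod C [X, coprod C [Y, Z]])"
      by (rule pair_eqI[where X = X and Y = "coprod C [Y, Z]" and Z = "coprod C [X, coprod C [Y, Z]]"])
        (use \<beta> \<beta>i(1) \<beta>r \<alpha>c inj XYZ \<alpha>(2-4) in \<open>auto simp: hom_iff assoc\<close>)
  qed
qed

text \<open>Expresses the three conditions that cut out \<open>F(X|Y|Z)\<close> on
  \<open>X + (Y + Z)\<close>; in this form they can be compared with the conditions for
  \<open>F(X|Y+Z)\<close>.\<close>

lemma omit_map_triple: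
  assumes XYZ: "X \<in> Obj C" "Y \<in> Obj C" "Z \<in> Obj C"
  shows "omit_map C [X, Y, Z] 0 = retr X (coprod C [Y, Z]) \<cdot>\<^bsub>C\<^esub> coprod_assoc C X Y Z"
    "omit_map C [X, Y, Z] 1 = coprod_map C [Ident C X, retr Y Z] \<cdot>\<^bsub>C\<^esub> coprod_assoc C X Y Z"
    "omit_map C [X, Y, Z] 2 = coprod_map C [Ident C X, retl Y Z] \<cdot>\<^bsub>C\<^esub> coprod_assoc C X Y Z"
proof -
  let ?i = "\<lambda>n. injs C [X, Y, Z] ! n" and ?\<alpha> = "coprod_assoc C X Y Z"
  have o: "omit 0 [X, Y, Z] = [Y, Z]" "omit 1 [X, Y, Z] = [X, Z]" "omit 2 [X, Y, Z] = [X, Y]"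
    by (auto simp: omit_def numeral_2_eq_2)
  have set: "set [X, Y, Z] \<subseteq> Obj C" using XYZ by simp
  note inj = triple_injs[OF XYZ, unfolded hom_iff]
  note \<alpha> = coprod_assoc[OF XYZ]
  note om = omit_map(1)[OF set, of 0, unfolded o] omit_map(1)[OF set, of 1, unfolded o]
    omit_map(1)[OF set, of 2, unfolded o]
  note oi = omit_map(2)[OF set, of 0, unfolded o] omit_map(2)[OF set, of 1, unfolded o]
    omit_map(2)[OF set, of 2, unfolded o]
  have [simp]: "retr X (coprod C [Y, Z]) \<cdot>\<^bsub>C\<^esub> inl X (coprod C [Y, Z]) = zero_map C X (coprod C [Y, Z])"
    using XYZ by simp
  show "omit_map C [X, Y, Z] 0 = retr X (coprod C [Y, Z]) \<cdot>\<^bsub>C\<^esub> ?\<alpha>"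
    by (rule triple_eqI[OF XYZ, where W = "coprod C [Y, Z]"])
      (use om(1) oi(1)[of 0] oi(1)[of 1] oi(1)[of 2] inj XYZ \<alpha>(2-4) in
        \<open>auto simp: hom_iff assoc inl_def[of Y Z] inr_def[of Y Z]\<close>)
  show "omit_map C [X, Y, Z] 1 = coprod_map C [Ident C X, retr Y Z] \<cdot>\<^bsub>C\<^esub> ?\<alpha>"
    by (rule triple_eqI[OF XYZ, where W = "coprod C [X, Z]"])
      (use om(2) oi(2)[of 0] oi(2)[of 1] oi(2)[of 2] inj XYZ \<alpha>(2-4) in
        \<open>auto simp: hom_iff assoc inl_def[of X Z] inr_def[of X Z]\<close>)
  show "omit_map C [X, Y, Z] 2 = coprod_map C [Ident C X, retl Y Z] \<cdot>\<^bsub>C\<^esub> ?\<alpha>"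
    by (rule triple_eqI[OF XYZ, where W = "coprod C [X, Y]"])
      (use om(3) oi(3)[of 0] oi(3)[of 1] oi(3)[of 2] inj XYZ \<alpha>(2-4) in
        \<open>auto simp: hom_iff assoc inl_def[of X Y] inr_def[of X Y]\<close>)
qed

text \<open>
  The cokernel \<open>f\<close> of \<open>k\<close> is the coequaliser of the maps \<open>(0, 1)\<close> and \<open>(k, 1)\<close> from \<open>K + B\<close> to
  \<open>B\<close>, whose common section makes them a reflexive graph.
\<close>

lemma sum_map_coequaliser:
  assumes X: "X \<in> Obj C" and k: "k \<in> hom C K B" and f: "f \<in> hom C B A" and fk: "is_cokernel C f k"
  shows "is_coequaliser C (coprod_map C [Ident C X, retr K B])
    (coprod_map C [Ident C X, copair k (Ident C B)]) (coprod_map C [Ident C X, f])"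
proof -
  have a [simp]: "k \<in> Arr C" "Dom C k = K" "Cod C k = B" "f \<in> Arr C" "Dom C f = B" "Cod C f = A"
    "K \<in> Obj C" "B \<in> Obj C" "A \<in> Obj C" "X \<in> Obj C"
    using k f X by (auto simp: hom_iff)
  let ?T = "coprod C [K, B]"
  have fkz: "f \<cdot>\<^bsub>C\<^esub> k = zero_map C K A" using fk by (simp add: is_cokernel_def)
  have "f \<cdot>\<^bsub>C\<^esub> retr K B = f \<cdot>\<^bsub>C\<^esub> copair k (Ident C B)"
    by (rule pair_eqI[where X = K and Y = B and Z = A]) (auto simp: hom_iff assoc fkz)
  then have eq: "coprod_map C [Ident C X, f] \<cdot>\<^bsub>C\<^esub> coprod_map C [Ident C X, retr K B] =
      coprod_map C [Ident C X, f] \<cdot>\<^bsub>C\<^esub> coprod_map C [Ident C X, copair k (Ident C B)]"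
    by (simp add: sum_map_sum_map)
  show ?thesis
  proof (rule coequaliserI[where X = "coprod C [X, ?T]" and Y = "coprod C [X, B]" and Q = "coprod C [X, A]"])
    fix Z h
    assume h: "h \<in> hom C (coprod C [X, B]) Z"
      and eqh: "h \<cdot>\<^bsub>C\<^esub> coprod_map C [Ident C X, retr K B] =
        h \<cdot>\<^bsub>C\<^esub> coprod_map C [Ident C X, copair k (Ident C B)]"
    have hs: "h \<in> Arr C" "Dom C h = coprod C [X, B]" "Cod C h = Z" "Z \<in> Obj C" using h by (auto simp: hom_iff)
    \<comment> \<open>Restriction of the coequalising condition to the summand \<open>K\<close>: the
      first leg is zero there and the second is \<open>k\<close>, so \<open>h\<close> restricted to
      \<open>B\<close> kills \<open>k\<close> and factors through the cokernel
      \<open>f\<close>.\<close>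
    have "(h \<cdot>\<^bsub>C\<^esub> coprod_map C [Ident C X, retr K B]) \<cdot>\<^bsub>C\<^esub> (inr X ?T \<cdot>\<^bsub>C\<^esub> inl K B) =
        (h \<cdot>\<^bsub>C\<^esub> coprod_map C [Ident C X, copair k (Ident C B)]) \<cdot>\<^bsub>C\<^esub> (inr X ?T \<cdot>\<^bsub>C\<^esub> inl K B)"
      by (simp add: eqh)
    then have hk: "(h \<cdot>\<^bsub>C\<^esub> inr X B) \<cdot>\<^bsub>C\<^esub> k = zero_map C K Z" using hs by (simp add: assoc)
    have ex1: "\<exists>!t. t \<in> hom C A Z \<and> t \<cdot>\<^bsub>C\<^esub> f = h \<cdot>\<^bsub>C\<^esub> inr X B"
      using cokernel_univ[OF fk, of "h \<cdot>\<^bsub>C\<^esub> inr X B" Z] hk hs by (simp add: hom_iff)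
    then obtain t where t: "t \<in> hom C A Z" "t \<cdot>\<^bsub>C\<^esub> f = h \<cdot>\<^bsub>C\<^esub> inr X B" by blast
    have ts: "t \<in> Arr C" "Dom C t = A" "Cod C t = Z" using t by (auto simp: hom_iff)
    let ?u = "copair (h \<cdot>\<^bsub>C\<^esub> inl X B) t"
    show "\<exists>!u. u \<in> hom C (coprod C [X, A]) Z \<and> u \<cdot>\<^bsub>C\<^esub> coprod_map C [Ident C X, f] = h"
    proof (rule ex1I[of _ ?u])
      have "?u \<cdot>\<^bsub>C\<^esub> coprod_map C [Ident C X, f] = h"
        by (rule pair_eqI[where X = X and Y = B and Z = Z]) (use hs ts t(2) in \<open>auto simp: hom_iff assoc\<close>)
      then show "?u \<in> hom C (coprod C [X, A]) Z \<and> ?u \<cdot>\<^bsub>C\<^esub> coprod_map C [Ident C X, f] = h"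
        using hs ts by (simp add: hom_iff)
    next
      fix v assume v: "v \<in> hom C (coprod C [X, A]) Z \<and> v \<cdot>\<^bsub>C\<^esub> coprod_map C [Ident C X, f] = h"
      have vs: "v \<in> Arr C" "Dom C v = coprod C [X, A]" "Cod C v = Z" using v by (auto simp: hom_iff)
      have hl: "h \<cdot>\<^bsub>C\<^esub> inl X B = v \<cdot>\<^bsub>C\<^esub> inl X A"
        using v[THEN conjunct2, symmetric] vs by (simp add: assoc)
      have "h \<cdot>\<^bsub>C\<^esub> inr X B = (v \<cdot>\<^bsub>C\<^esub> inr X A) \<cdot>\<^bsub>C\<^esub> f"
        using v[THEN conjunct2, symmetric] vs by (simp add: assoc)
      moreover have "v \<cdot>\<^bsub>C\<^esub> inr X A \<in> hom C A Z" using vs by (simp add: hom_iff)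
      ultimately have vt: "v \<cdot>\<^bsub>C\<^esub> inr X A = t" using ex1 t by metis
      show "v = ?u"
        by (rule pair_eqI[where X = X and Y = A and Z = Z]) (use hs ts vs hl vt in \<open>auto simp: hom_iff\<close>)
    qed
  qed (use eq in \<open>auto simp: hom_iff\<close>)
qed

end

section \<open>Cross-effects\<close>

locale zero_preserving_functor =
  C: pointed_cocartesian_category C + D: semi_abelian_category D + cat_functor C D F
  for C :: "('a, 'f) cat" and D :: "('b, 'g) cat" and F :: "('a, 'f, 'b, 'g) funct" +
  assumes zero_preserved: "preserves_zero C D F"
begin

abbreviation cr :: "'a list \<Rightarrow> 'b" where "cr \<equiv> cross C D F"

abbreviation \<iota> :: "'a list \<Rightarrow> 'g" where "\<iota> \<equiv> cross_incl C D F"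

abbreviation crm :: "'f list \<Rightarrow> 'g" where "crm \<equiv> cross_map C D F"

lemma functor_simps [simp]:
  "X \<in> Obj C \<Longrightarrow> onObj F X \<in> Obj D"
  "f \<in> Arr C \<Longrightarrow> onArr F f \<in> Arr D"
  "f \<in> Arr C \<Longrightarrow> Dom D (onArr F f) = onObj F (Dom C f)"
  "f \<in> Arr C \<Longrightarrow> Cod D (onArr F f) = onObj F (Cod C f)"
  "X \<in> Obj C \<Longrightarrow> onArr F (Ident C X) = Ident D (onObj F X)"
  using obj_functor hom_functor[of f "Dom C f" "Cod C f"] ident_functor by (auto simp: hom_iff)

lemma functor_comp:
  assumes "f \<in> Arr C" "g \<in> Arr C" "Cod C f = Dom C g"
  shows "onArr F g \<cdot>\<^bsub>D\<^esub> onArr F f = onArr F (g \<cdot>\<^bsub>C\<^esub> f)"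
    and "h \<in> Arr D \<Longrightarrow> Cod D h = onObj F (Dom C f) \<Longrightarrow>
      onArr F g \<cdot>\<^bsub>D\<^esub> (onArr F f \<cdot>\<^bsub>D\<^esub> h) = onArr F (g \<cdot>\<^bsub>C\<^esub> f) \<cdot>\<^bsub>D\<^esub> h"
proof -
  show eq: "onArr F g \<cdot>\<^bsub>D\<^esub> onArr F f = onArr F (g \<cdot>\<^bsub>C\<^esub> f)"
    using comp_functor[of f "Dom C f" "Cod C f" g "Cod C g"] assms by (simp add: hom_iff)
  show "onArr F g \<cdot>\<^bsub>D\<^esub> (onArr F f \<cdot>\<^bsub>D\<^esub> h) = onArr F (g \<cdot>\<^bsub>C\<^esub> f) \<cdot>\<^bsub>D\<^esub> h"
    if "h \<in> Arr D" "Cod D h = onObj F (Dom C f)"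
    using D.reassoc[OF eq, of h] that assms by simp
qed

lemma functor_zero [simp]:
  assumes "X \<in> Obj C" "Y \<in> Obj C"
  shows "onArr F (zero_map C X Y) = zero_map D (onObj F X) (onObj F Y)"
proof -
  obtain Z where Z: "is_zero C Z" using C.ex_zero by blast
  have FZ: "is_zero D (onObj F Z)" using zero_preserved Z by (simp add: preserves_zero_def)
  obtain u v where uv: "u \<in> hom C X Z" "v \<in> hom C Z Y"
    using is_zeroD(1)[OF Z assms(1)] is_zeroD(2)[OF Z assms(2)] by blast
  show ?thesis
    using C.zero_map_eq[OF Z uv] D.zero_map_eq[OF FZ hom_functor[OF uv(1)] hom_functor[OF uv(2)]]
      comp_functor[OF uv] by simp
qed

section \<open>Cross-effects of arbitrary arity\<close>

text \<open>Replaces the kernel of a morphism into a product by the list of conditions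
  \<open>F(r_j) h = 0\<close>, so that the product need not be handled again.\<close>

lemma cross_comparison:
  assumes Xs: "set Xs \<subseteq> Obj C"
  shows "cross_comparison C D F Xs \<in> Arr D"
    "Dom D (cross_comparison C D F Xs) = onObj F (coprod C Xs)"
    "h \<in> hom D W (onObj F (coprod C Xs)) \<Longrightarrow>
      cross_comparison C D F Xs \<cdot>\<^bsub>D\<^esub> h = zero_map D W (Cod D (cross_comparison C D F Xs)) \<longleftrightarrow>
      (\<forall>j < length Xs. onArr F (omit_map C Xs j) \<cdot>\<^bsub>D\<^esub> h = zero_map D W (onObj F (coprod C (omit j Xs))))"
proof -
  let ?t = "cross_comparison C D F Xs" and ?S = "onObj F (coprod C Xs)"
  let ?Ys = "map (\<lambda>j. onObj F (coprod C (omit j Xs))) [0..<length Xs]"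
  let ?gs = "map (\<lambda>j. onArr F (omit_map C Xs j)) [0..<length Xs]"
  have S: "?S \<in> Obj D" using Xs by simp
  have omit: "set (omit j Xs) \<subseteq> Obj C" for j using subset_trans[OF set_omit Xs] .
  have Ys: "set ?Ys \<subseteq> Obj D" using omit by auto
  have om: "onArr F (omit_map C Xs j) \<in> hom D ?S (onObj F (coprod C (omit j Xs)))" if "j < length Xs" for j
    using hom_functor C.omit_map(1)[OF Xs that] .
  then have gs: "list_all2 (\<lambda>Y g. g \<in> hom D ?S Y) ?Ys ?gs"
    by (simp add: list_all2_conv_all_nth)
  note tuple = D.tuple_comp_eq_iff[OF Ys S gs, folded cross_comparison_def]
  have th: "?t \<in> hom D ?S (product D ?Ys)"
    using tuple(1)[of "Ident D ?S" ?S "Ident D ?S"] D.ident_hom[OF S] by blast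
  then show t: "?t \<in> Arr D" "Dom D ?t = ?S" by (auto simp: hom_iff)
  assume h: "h \<in> hom D W ?S"
  have W: "W \<in> Obj D" using D.hom_obj h by blast
  have "onArr F (omit_map C Xs j) \<cdot>\<^bsub>D\<^esub> zero_map D W ?S = zero_map D W (onObj F (coprod C (omit j Xs)))"
    if "j < length Xs" for j
    using om[OF that] W by (simp add: hom_iff)
  then show "?t \<cdot>\<^bsub>D\<^esub> h = zero_map D W (Cod D ?t) \<longleftrightarrow>
      (\<forall>j < length Xs. onArr F (omit_map C Xs j) \<cdot>\<^bsub>D\<^esub> h = zero_map D W (onObj F (coprod C (omit j Xs))))"
    using tuple(2)[OF h D.zero_map_hom[OF W S]] t W by auto
qed

lemma cross_incl_simps [simp]:
  assumes "set Xs \<subseteq> Obj C"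
  shows "\<iota> Xs \<in> Arr D" "Dom D (\<iota> Xs) = cr Xs" "Cod D (\<iota> Xs) = onObj F (coprod C Xs)" "cr Xs \<in> Obj D"
  using D.kernelD[OF D.kernel_is_kernel[OF cross_comparison(1)[OF assms]]] cross_comparison(2)[OF assms]
    D.dom_obj[of "\<iota> Xs"]
  by (auto simp: cross_incl_def cross_def)

lemma cross_incl_mono:
  assumes "set Xs \<subseteq> Obj C"
  shows "is_mono D (\<iota> Xs)"
  using D.kernel_mono[OF D.kernel_is_kernel[OF cross_comparison(1)[OF assms]]]
  by (simp add: cross_incl_def)

lemma cross_eqI:
  assumes "set Xs \<subseteq> Obj C" "u \<in> hom D W (cr Xs)" "v \<in> hom D W (cr Xs)" "\<iota> Xs \<cdot>\<^bsub>D\<^esub> u = \<iota> Xs \<cdot>\<^bsub>D\<^esub> v"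
  shows "u = v"
  using D.monoD[OF cross_incl_mono[OF assms(1)] assms(4), of W] assms by simp

lemma omit_map_cross_incl:
  assumes Xs: "set Xs \<subseteq> Obj C" and j: "j < length Xs"
  shows "onArr F (omit_map C Xs j) \<cdot>\<^bsub>D\<^esub> \<iota> Xs = zero_map D (cr Xs) (onObj F (coprod C (omit j Xs)))"
proof -
  have "cross_comparison C D F Xs \<cdot>\<^bsub>D\<^esub> \<iota> Xs = zero_map D (cr Xs) (Cod D (cross_comparison C D F Xs))"
    using D.kernelD(4)[OF D.kernel_is_kernel[OF cross_comparison(1)[OF Xs]]]
    by (simp add: cross_incl_def cross_def)
  then show ?thesis using cross_comparison(3)[OF Xs, of "\<iota> Xs" "cr Xs"] Xs j by (simp add: hom_iff)
qed

lemma cross_lift: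
  assumes Xs: "set Xs \<subseteq> Obj C" and h: "h \<in> hom D W (onObj F (coprod C Xs))"
    and z: "\<And>j. j < length Xs \<Longrightarrow>
      onArr F (omit_map C Xs j) \<cdot>\<^bsub>D\<^esub> h = zero_map D W (onObj F (coprod C (omit j Xs)))"
  obtains u where "u \<in> hom D W (cr Xs)" "\<iota> Xs \<cdot>\<^bsub>D\<^esub> u = h"
proof (rule D.kernel_lift[OF D.kernel_is_kernel[OF cross_comparison(1)[OF Xs]], of h W])
  show "h \<in> hom D W (Dom D (cross_comparison C D F Xs))" using h cross_comparison(2)[OF Xs] by simp
  show "cross_comparison C D F Xs \<cdot>\<^bsub>D\<^esub> h = zero_map D W (Cod D (cross_comparison C D F Xs))"
    using cross_comparison(3)[OF Xs h] z by simp
qed (use that in \<open>simp add: cross_incl_def cross_def\<close>)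

text \<open>By \<open>omit_map_natural\<close>, the restriction of \<open>F(f_1 + ... + f_n)\<close>
  to the cross-effect is again killed by every \<open>F(r_j)\<close>; the inclusion being mono, the
  definite description in \<open>cross_map\<close> is legitimate.\<close>

lemma cross_map:
  assumes fs: "set fs \<subseteq> Arr C"
  shows "crm fs \<in> hom D (cr (map (Dom C) fs)) (cr (map (Cod C) fs))"
    "\<iota> (map (Cod C) fs) \<cdot>\<^bsub>D\<^esub> crm fs = onArr F (coprod_map C fs) \<cdot>\<^bsub>D\<^esub> \<iota> (map (Dom C) fs)"
proof -
  let ?Xs = "map (Dom C) fs" and ?Ys = "map (Cod C) fs"
  have Xs: "set ?Xs \<subseteq> Obj C" "set ?Ys \<subseteq> Obj C" using fs by auto
  have fs': "set (omit j fs) \<subseteq> Arr C" for j using subset_trans[OF set_omit fs] .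
  note cm = C.coprod_map(1)[OF fs, unfolded hom_iff]
  let ?h = "onArr F (coprod_map C fs) \<cdot>\<^bsub>D\<^esub> \<iota> ?Xs"
  have h: "?h \<in> hom D (cr ?Xs) (onObj F (coprod C ?Ys))" using cm Xs by (simp add: hom_iff)
  have z: "onArr F (omit_map C ?Ys j) \<cdot>\<^bsub>D\<^esub> ?h = zero_map D (cr ?Xs) (onObj F (coprod C (omit j ?Ys)))"
    if "j < length ?Ys" for j
  proof -
    have j: "j < length fs" using that by simp
    have cm': "coprod_map C (omit j fs) \<in> hom C (coprod C (omit j ?Xs)) (coprod C (omit j ?Ys))"
      using C.coprod_map(1)[OF fs'] unfolding omit_of_map .
    have om: "omit_map C ?Xs j \<in> hom C (coprod C ?Xs) (coprod C (omit j ?Xs))"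
      "omit_map C ?Ys j \<in> hom C (coprod C ?Ys) (coprod C (omit j ?Ys))"
      using C.omit_map(1)[OF Xs(1)] C.omit_map(1)[OF Xs(2)] j by auto
    have "onArr F (omit_map C ?Ys j) \<cdot>\<^bsub>D\<^esub> ?h =
        onArr F (coprod_map C (omit j fs)) \<cdot>\<^bsub>D\<^esub> (onArr F (omit_map C ?Xs j) \<cdot>\<^bsub>D\<^esub> \<iota> ?Xs)"
      using cm cm' om Xs C.omit_map_natural[OF fs j] by (simp add: hom_iff functor_comp)
    also have "\<dots> = onArr F (coprod_map C (omit j fs)) \<cdot>\<^bsub>D\<^esub> zero_map D (cr ?Xs) (onObj F (coprod C (omit j ?Xs)))"
      using omit_map_cross_incl[OF Xs(1), of j] j by simp
    also have "\<dots> = zero_map D (cr ?Xs) (onObj F (coprod C (omit j ?Ys)))"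
      using cm' Xs by (simp add: hom_iff)
    finally show ?thesis .
  qed
  obtain u where u: "u \<in> hom D (cr ?Xs) (cr ?Ys)" "\<iota> ?Ys \<cdot>\<^bsub>D\<^esub> u = ?h"
    by (rule cross_lift[OF Xs(2) h z])
  have "\<exists>!h. h \<in> hom D (cr ?Xs) (cr ?Ys) \<and> \<iota> ?Ys \<cdot>\<^bsub>D\<^esub> h = ?h"
    using u cross_eqI[OF Xs(2)] by (intro ex1I[of _ u]) auto
  from theI'[OF this, folded cross_map_def[unfolded Let_def]]
  show "crm fs \<in> hom D (cr ?Xs) (cr ?Ys)" "\<iota> ?Ys \<cdot>\<^bsub>D\<^esub> crm fs = ?h"
    unfolding cross_map_def Let_def by auto
qed

section \<open>Binary cross-effects\<close>

lemma cross_map_pair [simp]: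
  assumes "f \<in> Arr C" "g \<in> Arr C"
  shows "crm [f, g] \<in> Arr D" "Dom D (crm [f, g]) = cr [Dom C f, Dom C g]"
    "Cod D (crm [f, g]) = cr [Cod C f, Cod C g]"
    "Cod C f = X \<Longrightarrow> Cod C g = Y \<Longrightarrow>
      \<iota> [X, Y] \<cdot>\<^bsub>D\<^esub> crm [f, g] = onArr F (coprod_map C [f, g]) \<cdot>\<^bsub>D\<^esub> \<iota> [Dom C f, Dom C g]"
  using cross_map[of "[f, g]"] assms by (auto simp: hom_iff)

lemma cross_map_pair_comp [simp]:
  assumes "f \<in> Arr C" "g \<in> Arr C" "Cod C f = X" "Cod C g = Y" "h \<in> Arr D" "Cod D h = cr [Dom C f, Dom C g]"
  shows "\<iota> [X, Y] \<cdot>\<^bsub>D\<^esub> (crm [f, g] \<cdot>\<^bsub>D\<^esub> h) =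
    onArr F (coprod_map C [f, g]) \<cdot>\<^bsub>D\<^esub> (\<iota> [Dom C f, Dom C g] \<cdot>\<^bsub>D\<^esub> h)"
  using D.reassoc[OF cross_map_pair(4)[OF assms(1-4)], of h] assms by (auto simp: D.assoc)

lemma cross_map_pair_cross_map_pair:
  assumes "f \<in> Arr C" "g \<in> Arr C" "f' \<in> Arr C" "g' \<in> Arr C" "Cod C f = Dom C f'" "Cod C g = Dom C g'"
  shows "crm [f', g'] \<cdot>\<^bsub>D\<^esub> crm [f, g] = crm [f' \<cdot>\<^bsub>C\<^esub> f, g' \<cdot>\<^bsub>C\<^esub> g]"
  by (rule cross_eqI[where Xs = "[Cod C f', Cod C g']" and W = "cr [Dom C f, Dom C g]"])
    (use assms in \<open>auto simp: hom_iff functor_comp C.sum_map_sum_map\<close>)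

lemma cross_map_pair_Ident:
  assumes "X \<in> Obj C" "Y \<in> Obj C"
  shows "crm [Ident C X, Ident C Y] = Ident D (cr [X, Y])"
  by (rule cross_eqI[where Xs = "[X, Y]" and W = "cr [X, Y]"])
    (use assms in \<open>auto simp: hom_iff C.sum_map_Ident\<close>)

text \<open>With \<open>cross_pair_lift\<close> this presents \<open>F(X|Y)\<close> as the joint
  kernel of \<open>F(retl)\<close> and \<open>F(retr)\<close>, whose codomains are
  \<open>F(X)\<close> and \<open>F(Y)\<close> themselves.\<close>

lemma ret_cross_incl [simp]:
  assumes "X \<in> Obj C" "Y \<in> Obj C"
  shows "onArr F (C.retl X Y) \<cdot>\<^bsub>D\<^esub> \<iota> [X, Y] = zero_map D (cr [X, Y]) (onObj F X)"
    "onArr F (C.retr X Y) \<cdot>\<^bsub>D\<^esub> \<iota> [X, Y] = zero_map D (cr [X, Y]) (onObj F Y)"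
    "h \<in> Arr D \<Longrightarrow> Cod D h = cr [X, Y] \<Longrightarrow>
      onArr F (C.retl X Y) \<cdot>\<^bsub>D\<^esub> (\<iota> [X, Y] \<cdot>\<^bsub>D\<^esub> h) = zero_map D (Dom D h) (onObj F X)"
    "h \<in> Arr D \<Longrightarrow> Cod D h = cr [X, Y] \<Longrightarrow>
      onArr F (C.retr X Y) \<cdot>\<^bsub>D\<^esub> (\<iota> [X, Y] \<cdot>\<^bsub>D\<^esub> h) = zero_map D (Dom D h) (onObj F Y)"
proof -
  have XY: "set [X, Y] \<subseteq> Obj C" using assms by simp
  have o: "omit 0 [X, Y] = [Y]" "omit 1 [X, Y] = [X]" by (auto simp: omit_def)
  have om: "omit_map C [X, Y] 0 \<in> hom C (coprod C [X, Y]) (coprod C [Y])"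
    "omit_map C [X, Y] 1 \<in> hom C (coprod C [X, Y]) (coprod C [X])"
    using C.omit_map(1)[OF XY, of 0] C.omit_map(1)[OF XY, of 1] unfolding o by auto
  obtain t where t: "t \<in> hom C (coprod C [X]) X" "C.retl X Y = t \<cdot>\<^bsub>C\<^esub> omit_map C [X, Y] 1"
    using C.omit_map_pair(4)[OF assms] by blast
  have "onArr F (C.retl X Y) = onArr F t \<cdot>\<^bsub>D\<^esub> onArr F (omit_map C [X, Y] 1)"
    unfolding t(2) using t(1) om by (simp add: hom_iff functor_comp)
  then show l: "onArr F (C.retl X Y) \<cdot>\<^bsub>D\<^esub> \<iota> [X, Y] = zero_map D (cr [X, Y]) (onObj F X)"
    using omit_map_cross_incl[OF XY, of 1, unfolded o] t(1) om assms by (simp add: hom_iff D.assoc)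
  obtain t where t: "t \<in> hom C (coprod C [Y]) Y" "C.retr X Y = t \<cdot>\<^bsub>C\<^esub> omit_map C [X, Y] 0"
    using C.omit_map_pair(3)[OF assms] by blast
  have "onArr F (C.retr X Y) = onArr F t \<cdot>\<^bsub>D\<^esub> onArr F (omit_map C [X, Y] 0)"
    unfolding t(2) using t(1) om by (simp add: hom_iff functor_comp)
  then show r: "onArr F (C.retr X Y) \<cdot>\<^bsub>D\<^esub> \<iota> [X, Y] = zero_map D (cr [X, Y]) (onObj F Y)"
    using omit_map_cross_incl[OF XY, of 0, unfolded o] t(1) om assms by (simp add: hom_iff D.assoc)
  show "onArr F (C.retl X Y) \<cdot>\<^bsub>D\<^esub> (\<iota> [X, Y] \<cdot>\<^bsub>D\<^esub> h) = zero_map D (Dom D h) (onObj F X)"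
    "onArr F (C.retr X Y) \<cdot>\<^bsub>D\<^esub> (\<iota> [X, Y] \<cdot>\<^bsub>D\<^esub> h) = zero_map D (Dom D h) (onObj F Y)"
    if "h \<in> Arr D" "Cod D h = cr [X, Y]"
    using D.reassoc[OF l, of h] D.reassoc[OF r, of h] that assms by simp_all
qed

lemma cross_pair_lift:
  assumes XY: "X \<in> Obj C" "Y \<in> Obj C" and h: "h \<in> hom D W (onObj F (coprod C [X, Y]))"
    and z: "onArr F (C.retl X Y) \<cdot>\<^bsub>D\<^esub> h = zero_map D W (onObj F X)"
      "onArr F (C.retr X Y) \<cdot>\<^bsub>D\<^esub> h = zero_map D W (onObj F Y)"
  obtains u where "u \<in> hom D W (cr [X, Y])" "\<iota> [X, Y] \<cdot>\<^bsub>D\<^esub> u = h"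
proof (rule cross_lift[OF _ h])
  have o: "omit 0 [X, Y] = [Y]" "omit (Suc 0) [X, Y] = [X]" by (auto simp: omit_def)
  have hs: "h \<in> Arr D" "Dom D h = W" "Cod D h = onObj F (coprod C [X, Y])" "W \<in> Obj D"
    using h by (auto simp: hom_iff)
  have i: "injs C [X] ! 0 \<in> hom C X (coprod C [X])" "injs C [Y] ! 0 \<in> hom C Y (coprod C [Y])"
    using XY by (auto simp: hom_iff)
  have "onArr F (omit_map C [X, Y] 0) \<cdot>\<^bsub>D\<^esub> h = onArr F (injs C [Y] ! 0) \<cdot>\<^bsub>D\<^esub> (onArr F (C.retr X Y) \<cdot>\<^bsub>D\<^esub> h)"
    unfolding C.omit_map_pair(1)[OF XY] using i hs XY by (simp add: hom_iff functor_comp)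
  then have 0: "onArr F (omit_map C [X, Y] 0) \<cdot>\<^bsub>D\<^esub> h = zero_map D W (onObj F (coprod C [Y]))"
    using z i hs by (simp add: hom_iff)
  have "onArr F (omit_map C [X, Y] 1) \<cdot>\<^bsub>D\<^esub> h = onArr F (injs C [X] ! 0) \<cdot>\<^bsub>D\<^esub> (onArr F (C.retl X Y) \<cdot>\<^bsub>D\<^esub> h)"
    unfolding C.omit_map_pair(2)[OF XY] using i hs XY by (simp add: hom_iff functor_comp)
  then have 1: "onArr F (omit_map C [X, Y] 1) \<cdot>\<^bsub>D\<^esub> h = zero_map D W (onObj F (coprod C [X]))"
    using z i hs by (simp add: hom_iff)
  show "onArr F (omit_map C [X, Y] j) \<cdot>\<^bsub>D\<^esub> h = zero_map D W (onObj F (coprod C (omit j [X, Y])))"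
    if "j < length [X, Y]" for j
  proof -
    have "j = 0 \<or> j = 1" using that by auto
    then show ?thesis using 0 1 o by auto
  qed
qed (use that XY in auto)

text \<open>
  \<open>F(X|Y)\<close> is reached from \<open>F(X + Y)\<close> by taking kernels of the split epimorphisms first
  onto \<open>F(Y)\<close> and then onto \<open>F(X)\<close>.
\<close>

lemma cross_map_regular_epi:
  assumes X: "X \<in> Obj C" and g: "g \<in> hom C Y Y'"
    and reg: "is_regular_epi D (onArr F (coprod_map C [Ident C X, g]))"
  shows "is_regular_epi D (crm [Ident C X, g])"
proof -
  have a [simp]: "g \<in> Arr C" "Dom C g = Y" "Cod C g = Y'" "Y \<in> Obj C" "Y' \<in> Obj C" "X \<in> Obj C"
    using X g by (auto simp: hom_iff)
  \<comment> \<open>For each \<open>Z\<close>, \<open>\<tau>\<close> is the kernel of the split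
    epimorphism \<open>F(retr)\<close>; the factorisation \<open>s\<close> of \<open>F(inl)\<close>
    through \<open>\<tau>\<close> will split \<open>F(retl) \<tau>\<close>, and the kernel of the
    latter is \<open>F(X|Z)\<close>.\<close>
  have kernel: "\<exists>\<tau> s \<theta>. is_kernel D \<tau> (onArr F (C.retr X Z)) \<and>
      s \<in> hom D (onObj F X) (Dom D \<tau>) \<and> \<tau> \<cdot>\<^bsub>D\<^esub> s = onArr F (C.inl X Z) \<and>
      \<theta> \<in> hom D (cr [X, Z]) (Dom D \<tau>) \<and> \<tau> \<cdot>\<^bsub>D\<^esub> \<theta> = \<iota> [X, Z] \<and>
      is_kernel D \<theta> (onArr F (C.retl X Z) \<cdot>\<^bsub>D\<^esub> \<tau>)" if Z [simp]: "Z \<in> Obj C" for Z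
  proof -
    define \<tau> where "\<tau> = kernel D (onArr F (C.retr X Z))"
    have \<tau>: "is_kernel D \<tau> (onArr F (C.retr X Z))"
      unfolding \<tau>_def by (rule D.kernel_is_kernel) simp
    note \<tau>d = D.kernelD[OF \<tau>]
    have \<tau>s [simp]: "\<tau> \<in> Arr D" "Cod D \<tau> = onObj F (coprod C [X, Z])" using \<tau>d by auto
    obtain s where s: "s \<in> hom D (onObj F X) (Dom D \<tau>)" "\<tau> \<cdot>\<^bsub>D\<^esub> s = onArr F (C.inl X Z)"
      by (rule D.kernel_lift[OF \<tau>, of "onArr F (C.inl X Z)" "onObj F X"]) (auto simp: hom_iff functor_comp)
    obtain \<theta> where \<theta>: "\<theta> \<in> hom D (cr [X, Z]) (Dom D \<tau>)" "\<tau> \<cdot>\<^bsub>D\<^esub> \<theta> = \<iota> [X, Z]"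
      by (rule D.kernel_lift[OF \<tau>, of "\<iota> [X, Z]" "cr [X, Z]"]) (auto simp: hom_iff)
    have "is_kernel D \<theta> (onArr F (C.retl X Z) \<cdot>\<^bsub>D\<^esub> \<tau>)"
    proof (rule D.kernelI[OF _ \<theta>(1), where Y = "onObj F X"])
      show "(onArr F (C.retl X Z) \<cdot>\<^bsub>D\<^esub> \<tau>) \<cdot>\<^bsub>D\<^esub> \<theta> = zero_map D (cr [X, Z]) (onObj F X)"
        using \<theta> by (simp add: hom_iff D.assoc)
      show "is_mono D \<theta>" unfolding is_mono_def
      proof (intro conjI allI ballI impI)
        fix W u v assume uv: "u \<in> hom D W (Dom D \<theta>)" "v \<in> hom D W (Dom D \<theta>)" "\<theta> \<cdot>\<^bsub>D\<^esub> u = \<theta> \<cdot>\<^bsub>D\<^esub> v"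
        have "\<iota> [X, Z] \<cdot>\<^bsub>D\<^esub> u = \<tau> \<cdot>\<^bsub>D\<^esub> (\<theta> \<cdot>\<^bsub>D\<^esub> u)" "\<iota> [X, Z] \<cdot>\<^bsub>D\<^esub> v = \<tau> \<cdot>\<^bsub>D\<^esub> (\<theta> \<cdot>\<^bsub>D\<^esub> v)"
          using uv(1,2) \<theta>(1) by (simp_all add: hom_iff \<theta>(2)[THEN D.reassoc])
        then show "u = v" using cross_eqI[of "[X, Z]" u W v] uv \<theta>(1) by (simp add: hom_iff)
      qed (use \<theta> in \<open>simp add: hom_iff\<close>)
      fix W x assume x: "x \<in> hom D W (Dom D \<tau>)"
        "(onArr F (C.retl X Z) \<cdot>\<^bsub>D\<^esub> \<tau>) \<cdot>\<^bsub>D\<^esub> x = zero_map D W (onObj F X)"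
      have xs: "x \<in> Arr D" "Dom D x = W" "Cod D x = Dom D \<tau>" using x by (auto simp: hom_iff)
      \<comment> \<open>\<open>\<tau> x\<close> is killed by \<open>F(retr)\<close> because
        \<open>\<tau>\<close> is its kernel, and by \<open>F(retl)\<close> by the choice of
        \<open>x\<close>.\<close>
      obtain u where u: "u \<in> hom D W (cr [X, Z])" "\<iota> [X, Z] \<cdot>\<^bsub>D\<^esub> u = \<tau> \<cdot>\<^bsub>D\<^esub> x"
        by (rule cross_pair_lift[of X Z "\<tau> \<cdot>\<^bsub>D\<^esub> x" W])
          (use x(2) xs \<tau>d(4)[THEN D.reassoc, of x] in \<open>auto simp: hom_iff D.assoc\<close>)
      have us: "u \<in> Arr D" "Dom D u = W" "Cod D u = cr [X, Z]" using u by (auto simp: hom_iff)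
      have "\<tau> \<cdot>\<^bsub>D\<^esub> (\<theta> \<cdot>\<^bsub>D\<^esub> u) = \<tau> \<cdot>\<^bsub>D\<^esub> x"
        using \<theta>(1) us u(2) by (simp add: hom_iff \<theta>(2)[THEN D.reassoc])
      then have "\<theta> \<cdot>\<^bsub>D\<^esub> u = x"
        by (rule D.monoD[OF D.kernel_mono[OF \<tau>], where W = W]) (use us xs \<theta>(1) in \<open>auto simp: hom_iff\<close>)
      then show "\<exists>u \<in> hom D W (cr [X, Z]). \<theta> \<cdot>\<^bsub>D\<^esub> u = x" using u by blast
    qed (simp add: hom_iff)
    then show ?thesis using \<tau> s \<theta> by blast
  qed
  obtain \<tau> s \<theta> where 1: "is_kernel D \<tau> (onArr F (C.retr X Y))"
    "s \<in> hom D (onObj F X) (Dom D \<tau>)" "\<tau> \<cdot>\<^bsub>D\<^esub> s = onArr F (C.inl X Y)"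
    "\<theta> \<in> hom D (cr [X, Y]) (Dom D \<tau>)" "\<tau> \<cdot>\<^bsub>D\<^esub> \<theta> = \<iota> [X, Y]"
    "is_kernel D \<theta> (onArr F (C.retl X Y) \<cdot>\<^bsub>D\<^esub> \<tau>)"
    using kernel[of Y] by auto
  obtain \<tau>' s' \<theta>' where 2: "is_kernel D \<tau>' (onArr F (C.retr X Y'))"
    "s' \<in> hom D (onObj F X) (Dom D \<tau>')" "\<tau>' \<cdot>\<^bsub>D\<^esub> s' = onArr F (C.inl X Y')"
    "\<theta>' \<in> hom D (cr [X, Y']) (Dom D \<tau>')" "\<tau>' \<cdot>\<^bsub>D\<^esub> \<theta>' = \<iota> [X, Y']"
    "is_kernel D \<theta>' (onArr F (C.retl X Y') \<cdot>\<^bsub>D\<^esub> \<tau>')"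
    using kernel[of Y'] by auto
  note \<tau>d = D.kernelD[OF 1(1)] and \<tau>d' = D.kernelD[OF 2(1)]
  have b [simp]: "\<tau> \<in> Arr D" "Cod D \<tau> = onObj F (coprod C [X, Y])" "s \<in> Arr D" "Dom D s = onObj F X"
    "Cod D s = Dom D \<tau>" "\<theta> \<in> Arr D" "Dom D \<theta> = cr [X, Y]" "Cod D \<theta> = Dom D \<tau>"
    "\<tau>' \<in> Arr D" "Cod D \<tau>' = onObj F (coprod C [X, Y'])" "s' \<in> Arr D" "Dom D s' = onObj F X"
    "Cod D s' = Dom D \<tau>'" "\<theta>' \<in> Arr D" "Dom D \<theta>' = cr [X, Y']" "Cod D \<theta>' = Dom D \<tau>'"
    using \<tau>d \<tau>d' 1 2 by (auto simp: hom_iff)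
  let ?\<gamma> = "onArr F (coprod_map C [Ident C X, g])"
  have z: "onArr F (g \<cdot>\<^bsub>C\<^esub> C.retr X Y) \<cdot>\<^bsub>D\<^esub> \<tau> = zero_map D (Dom D \<tau>) (onObj F Y')"
  proof -
    have "onArr F (g \<cdot>\<^bsub>C\<^esub> C.retr X Y) \<cdot>\<^bsub>D\<^esub> \<tau> = onArr F g \<cdot>\<^bsub>D\<^esub> (onArr F (C.retr X Y) \<cdot>\<^bsub>D\<^esub> \<tau>)"
      by (simp add: functor_comp)
    then show ?thesis using \<tau>d(4) by simp
  qed
  obtain u where u: "u \<in> hom D (Dom D \<tau>) (Dom D \<tau>')" "\<tau>' \<cdot>\<^bsub>D\<^esub> u = ?\<gamma> \<cdot>\<^bsub>D\<^esub> \<tau>"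
    by (rule D.kernel_lift[OF 2(1), of "?\<gamma> \<cdot>\<^bsub>D\<^esub> \<tau>" "Dom D \<tau>"])
      (auto simp: hom_iff functor_comp C.ret_sum_map z)
  have ua [simp]: "u \<in> Arr D" "Dom D u = Dom D \<tau>" "Cod D u = Dom D \<tau>'" using u by (auto simp: hom_iff)
  \<comment> \<open>Kernels over \<open>F(Y)\<close> and \<open>F(Y')\<close>: both split
    epimorphisms have \<open>F(inr)\<close> as section, and \<open>F(g)\<close> is the morphism
    between the bases.\<close>
  have ureg: "is_regular_epi D u"
    by (rule D.kernel_map_regular_epi[OF reg, where p = "onArr F (C.retr X Y)" and s = "onArr F (C.inr X Y)"
          and p' = "onArr F (C.retr X Y')" and s' = "onArr F (C.inr X Y')" and h = "onArr F g"
          and E = "onObj F (coprod C [X, Y])" and E' = "onObj F (coprod C [X, Y'])"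
          and P = "onObj F Y" and P' = "onObj F Y'", OF _ _ _ _ _ _ _ _ _ 1(1) 2(1) u])
      (auto simp: hom_iff functor_comp C.ret_sum_map)
  \<comment> \<open>Kernels over \<open>F(X)\<close>: the morphism between the bases is now an
    identity, since \<open>retl\<close> after \<open>1 + g\<close> is \<open>retl\<close>.\<close>
  show ?thesis
  proof (rule D.kernel_map_regular_epi[OF ureg u(1), where p = "onArr F (C.retl X Y) \<cdot>\<^bsub>D\<^esub> \<tau>" and s = s
        and p' = "onArr F (C.retl X Y') \<cdot>\<^bsub>D\<^esub> \<tau>'" and s' = s' and h = "Ident D (onObj F X)"
        and P = "onObj F X" and P' = "onObj F X", OF _ _ _ _ _ _ _ _ 1(6) 2(6)])
    show "(onArr F (C.retl X Y) \<cdot>\<^bsub>D\<^esub> \<tau>) \<cdot>\<^bsub>D\<^esub> s = Ident D (onObj F X)"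
      by (simp add: D.assoc 1(3) functor_comp)
    show "(onArr F (C.retl X Y') \<cdot>\<^bsub>D\<^esub> \<tau>') \<cdot>\<^bsub>D\<^esub> u = Ident D (onObj F X) \<cdot>\<^bsub>D\<^esub> (onArr F (C.retl X Y) \<cdot>\<^bsub>D\<^esub> \<tau>)"
      by (simp add: D.assoc u(2) functor_comp C.ret_sum_map)
    show "u \<cdot>\<^bsub>D\<^esub> s = s' \<cdot>\<^bsub>D\<^esub> Ident D (onObj F X)"
      by (rule D.monoD[OF D.kernel_mono[OF 2(1)], where W = "onObj F X"])
        (auto simp: hom_iff u(2)[THEN D.reassoc] D.assoc 1(3) 2(3) functor_comp)
    show "\<theta>' \<cdot>\<^bsub>D\<^esub> crm [Ident C X, g] = u \<cdot>\<^bsub>D\<^esub> \<theta>"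
      by (rule D.monoD[OF D.kernel_mono[OF 2(1)], where W = "cr [X, Y]"])
        (auto simp: hom_iff u(2)[THEN D.reassoc] D.assoc 1(5) 2(5)[THEN D.reassoc])
  qed (auto simp: hom_iff)
qed

section \<open>Ternary cross-effects and folding\<close>

lemma cross_triple_zero:
  assumes XYZ: "X \<in> Obj C" "Y \<in> Obj C" "Z \<in> Obj C"
  shows "onArr F (C.retr X (coprod C [Y, Z]) \<cdot>\<^bsub>C\<^esub> coprod_assoc C X Y Z) \<cdot>\<^bsub>D\<^esub> \<iota> [X, Y, Z] =
      zero_map D (cr [X, Y, Z]) (onObj F (coprod C [Y, Z]))"
    "onArr F (coprod_map C [Ident C X, C.retr Y Z] \<cdot>\<^bsub>C\<^esub> coprod_assoc C X Y Z) \<cdot>\<^bsub>D\<^esub> \<iota> [X, Y, Z] =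
      zero_map D (cr [X, Y, Z]) (onObj F (coprod C [X, Z]))"
    "onArr F (coprod_map C [Ident C X, C.retl Y Z] \<cdot>\<^bsub>C\<^esub> coprod_assoc C X Y Z) \<cdot>\<^bsub>D\<^esub> \<iota> [X, Y, Z] =
      zero_map D (cr [X, Y, Z]) (onObj F (coprod C [X, Y]))"
proof -
  have o: "omit 0 [X, Y, Z] = [Y, Z]" "omit 1 [X, Y, Z] = [X, Z]" "omit 2 [X, Y, Z] = [X, Y]"
    by (auto simp: omit_def numeral_2_eq_2)
  have "set [X, Y, Z] \<subseteq> Obj C" using XYZ by simp
  note om = omit_map_cross_incl[OF this]
  show "onArr F (C.retr X (coprod C [Y, Z]) \<cdot>\<^bsub>C\<^esub> coprod_assoc C X Y Z) \<cdot>\<^bsub>D\<^esub> \<iota> [X, Y, Z] =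
      zero_map D (cr [X, Y, Z]) (onObj F (coprod C [Y, Z]))"
    using om[of 0] unfolding C.omit_map_triple(1)[OF XYZ] o by simp
  show "onArr F (coprod_map C [Ident C X, C.retr Y Z] \<cdot>\<^bsub>C\<^esub> coprod_assoc C X Y Z) \<cdot>\<^bsub>D\<^esub> \<iota> [X, Y, Z] =
      zero_map D (cr [X, Y, Z]) (onObj F (coprod C [X, Z]))"
    using om[of 1] unfolding C.omit_map_triple(2)[OF XYZ] o by simp
  show "onArr F (coprod_map C [Ident C X, C.retl Y Z] \<cdot>\<^bsub>C\<^esub> coprod_assoc C X Y Z) \<cdot>\<^bsub>D\<^esub> \<iota> [X, Y, Z] =
      zero_map D (cr [X, Y, Z]) (onObj F (coprod C [X, Y]))"
    using om[of 2] unfolding C.omit_map_triple(3)[OF XYZ] o by simp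
qed

lemma cross_triple_lift:
  assumes XYZ: "X \<in> Obj C" "Y \<in> Obj C" "Z \<in> Obj C"
    and h: "h \<in> hom D W (onObj F (coprod C [X, Y, Z]))"
    and z: "onArr F (C.retr X (coprod C [Y, Z]) \<cdot>\<^bsub>C\<^esub> coprod_assoc C X Y Z) \<cdot>\<^bsub>D\<^esub> h =
      zero_map D W (onObj F (coprod C [Y, Z]))"
    "onArr F (coprod_map C [Ident C X, C.retr Y Z] \<cdot>\<^bsub>C\<^esub> coprod_assoc C X Y Z) \<cdot>\<^bsub>D\<^esub> h =
      zero_map D W (onObj F (coprod C [X, Z]))"
    "onArr F (coprod_map C [Ident C X, C.retl Y Z] \<cdot>\<^bsub>C\<^esub> coprod_assoc C X Y Z) \<cdot>\<^bsub>D\<^esub> h =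
      zero_map D W (onObj F (coprod C [X, Y]))"
  obtains u where "u \<in> hom D W (cr [X, Y, Z])" "\<iota> [X, Y, Z] \<cdot>\<^bsub>D\<^esub> u = h"
proof (rule cross_lift[OF _ h])
  have o: "omit 0 [X, Y, Z] = [Y, Z]" "omit 1 [X, Y, Z] = [X, Z]" "omit 2 [X, Y, Z] = [X, Y]"
    by (auto simp: omit_def numeral_2_eq_2)
  fix j assume "j < length [X, Y, Z]"
  then consider "j = 0" | "j = 1" | "j = 2" by force
  then show "onArr F (omit_map C [X, Y, Z] j) \<cdot>\<^bsub>D\<^esub> h = zero_map D W (onObj F (coprod C (omit j [X, Y, Z])))"
    using z C.omit_map_triple[OF XYZ] o by cases simp_all
qed (use that XYZ in auto)

text \<open>For \<open>g\<close> the identity this embeds \<open>F(X|Y|Z)\<close> into \<open>F(X|Y+Z)\<close>, for a codiagonal it is folding.\<close>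

lemma cross_triple_to_pair:
  assumes XYZ [simp]: "X \<in> Obj C" "Y \<in> Obj C" "Z \<in> Obj C" and g: "g \<in> hom C (coprod C [Y, Z]) W"
  obtains u where "u \<in> hom D (cr [X, Y, Z]) (cr [X, W])"
    "\<iota> [X, W] \<cdot>\<^bsub>D\<^esub> u = onArr F (coprod_map C [Ident C X, g] \<cdot>\<^bsub>C\<^esub> coprod_assoc C X Y Z) \<cdot>\<^bsub>D\<^esub> \<iota> [X, Y, Z]"
proof -
  let ?T = "coprod C [Y, Z]" and ?\<alpha> = "coprod_assoc C X Y Z" and ?i = "\<iota> [X, Y, Z]"
  have gs [simp]: "g \<in> Arr C" "Dom C g = ?T" "Cod C g = W" "W \<in> Obj C" using g by (auto simp: hom_iff)
  note z = cross_triple_zero[OF XYZ]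
  \<comment> \<open>Vanishing under \<open>retl\<close> is not one of the three ternary conditions,
    but the retraction onto \<open>X\<close> factors through \<open>X + Z\<close>, where
    \<open>F(1 + retr)\<close> already gives zero.\<close>
  have rl: "C.retl X Z \<cdot>\<^bsub>C\<^esub> coprod_map C [Ident C X, C.retr Y Z] = C.retl X ?T"
    by (simp add: C.ret_sum_map)
  have "onArr F (C.retl X ?T \<cdot>\<^bsub>C\<^esub> ?\<alpha>) \<cdot>\<^bsub>D\<^esub> ?i =
      onArr F (C.retl X Z) \<cdot>\<^bsub>D\<^esub> (onArr F (coprod_map C [Ident C X, C.retr Y Z] \<cdot>\<^bsub>C\<^esub> ?\<alpha>) \<cdot>\<^bsub>D\<^esub> ?i)"
    by (simp add: functor_comp rl[symmetric] C.assoc)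
  then have zl: "onArr F (C.retl X ?T \<cdot>\<^bsub>C\<^esub> ?\<alpha>) \<cdot>\<^bsub>D\<^esub> ?i = zero_map D (cr [X, Y, Z]) (onObj F X)"
    by (simp add: z)
  have "onArr F (g \<cdot>\<^bsub>C\<^esub> (C.retr X ?T \<cdot>\<^bsub>C\<^esub> ?\<alpha>)) \<cdot>\<^bsub>D\<^esub> ?i =
      onArr F g \<cdot>\<^bsub>D\<^esub> (onArr F (C.retr X ?T \<cdot>\<^bsub>C\<^esub> ?\<alpha>) \<cdot>\<^bsub>D\<^esub> ?i)"
    by (simp add: functor_comp)
  then have zr: "onArr F (g \<cdot>\<^bsub>C\<^esub> (C.retr X ?T \<cdot>\<^bsub>C\<^esub> ?\<alpha>)) \<cdot>\<^bsub>D\<^esub> ?i = zero_map D (cr [X, Y, Z]) (onObj F W)"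
    by (simp add: z)
  have l: "C.retl X W \<cdot>\<^bsub>C\<^esub> (coprod_map C [Ident C X, g] \<cdot>\<^bsub>C\<^esub> ?\<alpha>) = C.retl X ?T \<cdot>\<^bsub>C\<^esub> ?\<alpha>"
    and r: "C.retr X W \<cdot>\<^bsub>C\<^esub> (coprod_map C [Ident C X, g] \<cdot>\<^bsub>C\<^esub> ?\<alpha>) = g \<cdot>\<^bsub>C\<^esub> (C.retr X ?T \<cdot>\<^bsub>C\<^esub> ?\<alpha>)"
    by (simp_all add: C.ret_sum_map[THEN C.reassoc] C.assoc)
  show thesis
    by (rule cross_pair_lift[of X W "onArr F (coprod_map C [Ident C X, g] \<cdot>\<^bsub>C\<^esub> ?\<alpha>) \<cdot>\<^bsub>D\<^esub> ?i" "cr [X, Y, Z]"])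
      (use that in \<open>auto simp: hom_iff functor_comp l r zl zr\<close>)
qed

text \<open>The case of the codiagonal in \<open>cross_triple_to_pair\<close>; the mono
  \<open>\<iota> [X, Y]\<close> gives the uniqueness that the definite description requires.\<close>

lemma folding:
  assumes X [simp]: "X \<in> Obj C" "Y \<in> Obj C"
  shows "folding C D F X Y \<in> hom D (cr [X, Y, Y]) (cr [X, Y])"
    "\<iota> [X, Y] \<cdot>\<^bsub>D\<^esub> folding C D F X Y =
      onArr F (coprod_map C [Ident C X, C.copair (Ident C Y) (Ident C Y)] \<cdot>\<^bsub>C\<^esub> coprod_assoc C X Y Y) \<cdot>\<^bsub>D\<^esub> \<iota> [X, Y, Y]"
proof -
  have cd: "codiagonal C Y = C.copair (Ident C Y) (Ident C Y)" by (simp add: codiagonal_def C.copair_def)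
  let ?c = "codiagonal C Y"
  let ?h = "onArr F (coprod_map C [Ident C X, ?c] \<cdot>\<^bsub>C\<^esub> coprod_assoc C X Y Y) \<cdot>\<^bsub>D\<^esub> \<iota> [X, Y, Y]"
  have "?c \<in> hom C (coprod C [Y, Y]) Y" by (simp add: cd hom_iff)
  then obtain u where u: "u \<in> hom D (cr [X, Y, Y]) (cr [X, Y])" "\<iota> [X, Y] \<cdot>\<^bsub>D\<^esub> u = ?h"
    by (rule cross_triple_to_pair[OF X(1) X(2) X(2)])
  have "\<exists>!S. S \<in> hom D (cr [X, Y, Y]) (cr [X, Y]) \<and> \<iota> [X, Y] \<cdot>\<^bsub>D\<^esub> S = ?h"
    using u cross_eqI[of "[X, Y]"] X by (intro ex1I[of _ u]) auto
  from theI'[OF this]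
  show "folding C D F X Y \<in> hom D (cr [X, Y, Y]) (cr [X, Y])"
    "\<iota> [X, Y] \<cdot>\<^bsub>D\<^esub> folding C D F X Y =
      onArr F (coprod_map C [Ident C X, C.copair (Ident C Y) (Ident C Y)] \<cdot>\<^bsub>C\<^esub> coprod_assoc C X Y Y) \<cdot>\<^bsub>D\<^esub> \<iota> [X, Y, Y]"
    unfolding folding_def cd by auto
qed

section \<open>The semi-direct product\<close>

lemma semidirect_incl_kernel:
  assumes [simp]: "X \<in> Obj C" "K \<in> Obj C" "B \<in> Obj C"
  shows "is_kernel D (semidirect_incl C D F X K B) (crm [Ident C X, C.retr K B])"
proof -
  have "cotuple C [K, B] B [zero_map C K B, Ident C B] = C.retr K B"
    by (simp add: C.retr_def C.copair_def)
  then show ?thesis unfolding semidirect_incl_def by (simp add: D.kernel_is_kernel)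
qed

lemma semidirect_incl_simps [simp]:
  assumes [simp]: "X \<in> Obj C" "K \<in> Obj C" "B \<in> Obj C"
  shows "semidirect_incl C D F X K B \<in> Arr D" "semidirect C D F X K B \<in> Obj D"
    "Dom D (semidirect_incl C D F X K B) = semidirect C D F X K B"
    "Cod D (semidirect_incl C D F X K B) = cr [X, coprod C [K, B]]"
  using D.kernelD[OF semidirect_incl_kernel[OF assms]] D.dom_obj[of "semidirect_incl C D F X K B"]
  by (auto simp: semidirect_def)

lemma semidirect_left:
  assumes X [simp]: "X \<in> Obj C" "K \<in> Obj C" "B \<in> Obj C"
  shows "semidirect_left C D F X K B \<in> hom D (cr [X, K, B]) (semidirect C D F X K B)"
    "\<iota> [X, coprod C [K, B]] \<cdot>\<^bsub>D\<^esub> (semidirect_incl C D F X K B \<cdot>\<^bsub>D\<^esub> semidirect_left C D F X K B) =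
      onArr F (coprod_assoc C X K B) \<cdot>\<^bsub>D\<^esub> \<iota> [X, K, B]"
proof -
  let ?T = "coprod C [K, B]" and ?j = "semidirect_incl C D F X K B" and ?V = "semidirect C D F X K B"
  note jk = semidirect_incl_kernel[OF X]
  obtain u where u: "u \<in> hom D (cr [X, K, B]) (cr [X, ?T])"
    "\<iota> [X, ?T] \<cdot>\<^bsub>D\<^esub> u = onArr F (coprod_map C [Ident C X, Ident C ?T] \<cdot>\<^bsub>C\<^esub> coprod_assoc C X K B) \<cdot>\<^bsub>D\<^esub> \<iota> [X, K, B]"
    by (rule cross_triple_to_pair[OF X, of "Ident C ?T" ?T]) (auto simp: hom_iff)
  have us: "u \<in> Arr D" "Dom D u = cr [X, K, B]" "Cod D u = cr [X, ?T]" using u by (auto simp: hom_iff)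
  have iu: "\<iota> [X, ?T] \<cdot>\<^bsub>D\<^esub> u = onArr F (coprod_assoc C X K B) \<cdot>\<^bsub>D\<^esub> \<iota> [X, K, B]"
    using u(2) by (simp add: C.sum_map_Ident)
  \<comment> \<open>By the second ternary condition \<open>F(1 + retr)\<close> kills
    \<open>F(X|K|B)\<close>, so the embedding \<open>u\<close> into \<open>F(X|K+B)\<close> factors
    through the kernel \<open>V\<close>.\<close>
  have "crm [Ident C X, C.retr K B] \<cdot>\<^bsub>D\<^esub> u = zero_map D (cr [X, K, B]) (cr [X, B])"
    by (rule cross_eqI[where Xs = "[X, B]" and W = "cr [X, K, B]"])
      (auto simp: hom_iff us iu functor_comp cross_triple_zero)
  then obtain v where v: "v \<in> hom D (cr [X, K, B]) ?V" "?j \<cdot>\<^bsub>D\<^esub> v = u"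
    using D.kernel_univ[OF jk, of u "cr [X, K, B]"] us by (auto simp: hom_iff)
  let ?P = "\<lambda>h. h \<in> hom D (cr [X, K, B]) ?V \<and>
    \<iota> [X, ?T] \<cdot>\<^bsub>D\<^esub> (?j \<cdot>\<^bsub>D\<^esub> h) = onArr F (coprod_assoc C X K B) \<cdot>\<^bsub>D\<^esub> \<iota> [X, K, B]"
  have "\<exists>!h. ?P h"
  proof (rule ex1I[of _ v])
    show "?P v" using v iu by simp
    fix h assume h: "?P h"
    have "?j \<cdot>\<^bsub>D\<^esub> h = ?j \<cdot>\<^bsub>D\<^esub> v"
      by (rule cross_eqI[where Xs = "[X, ?T]" and W = "cr [X, K, B]"])
        (use h v(2) iu us in \<open>auto simp: hom_iff\<close>)
    then show "h = v"
      by (rule D.monoD[OF D.kernel_mono[OF jk], where W = "cr [X, K, B]"]) (use h v in auto)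
  qed
  from theI'[OF this, folded semidirect_left_def]
  show "semidirect_left C D F X K B \<in> hom D (cr [X, K, B]) ?V"
    "\<iota> [X, ?T] \<cdot>\<^bsub>D\<^esub> (?j \<cdot>\<^bsub>D\<^esub> semidirect_left C D F X K B) =
      onArr F (coprod_assoc C X K B) \<cdot>\<^bsub>D\<^esub> \<iota> [X, K, B]"
    by auto
qed

text \<open>\<open>F(X|inl)\<close> lands in \<open>V\<close> because \<open>retr\<close> after
  \<open>inl\<close> is zero, and \<open>F(X|-)\<close> sends zero morphisms to zero.\<close>

lemma semidirect_splitting:
  assumes X [simp]: "X \<in> Obj C" "K \<in> Obj C" "B \<in> Obj C"
  shows "semidirect_splitting C D F X K B \<in> hom D (cr [X, K]) (semidirect C D F X K B)"
    "semidirect_incl C D F X K B \<cdot>\<^bsub>D\<^esub> semidirect_splitting C D F X K B = crm [Ident C X, C.inl K B]"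
proof -
  let ?j = "semidirect_incl C D F X K B" and ?V = "semidirect C D F X K B"
  note jk = semidirect_incl_kernel[OF X]
  have "crm [Ident C X, C.retr K B] \<cdot>\<^bsub>D\<^esub> crm [Ident C X, C.inl K B] = crm [Ident C X, zero_map C K B]"
    by (simp add: cross_map_pair_cross_map_pair)
  also have "\<dots> = zero_map D (cr [X, K]) (cr [X, B])"
  proof (rule cross_eqI[where Xs = "[X, B]" and W = "cr [X, K]"])
    have "onArr F (C.inl X B \<cdot>\<^bsub>C\<^esub> C.retl X K) \<cdot>\<^bsub>D\<^esub> \<iota> [X, K] =
        onArr F (C.inl X B) \<cdot>\<^bsub>D\<^esub> (onArr F (C.retl X K) \<cdot>\<^bsub>D\<^esub> \<iota> [X, K])"
      by (simp add: functor_comp del: ret_cross_incl)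
    then show "\<iota> [X, B] \<cdot>\<^bsub>D\<^esub> crm [Ident C X, zero_map C K B] = \<iota> [X, B] \<cdot>\<^bsub>D\<^esub> zero_map D (cr [X, K]) (cr [X, B])"
      by (simp add: C.sum_map_zero)
  qed (auto simp: hom_iff)
  finally have "\<exists>!h. h \<in> hom D (cr [X, K]) ?V \<and> ?j \<cdot>\<^bsub>D\<^esub> h = crm [Ident C X, C.inl K B]"
    using D.kernel_univ[OF jk, of "crm [Ident C X, C.inl K B]" "cr [X, K]"] by (simp add: hom_iff)
  from theI'[OF this]
  show "semidirect_splitting C D F X K B \<in> hom D (cr [X, K]) ?V"
    "?j \<cdot>\<^bsub>D\<^esub> semidirect_splitting C D F X K B = crm [Ident C X, C.inl K B]"
    unfolding semidirect_splitting_def C.inl_def by auto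
qed

text \<open>Inside \<open>F(X + (K + B))\<close>, an element of \<open>V\<close> is killed by
  \<open>F(retr)\<close> since it lies in \<open>F(X|K+B)\<close>, and by \<open>F(1 + retr)\<close>
  since \<open>V\<close> is a kernel. Being killed by \<open>p\<close> adds
  \<open>F(1 + retl)\<close>, and these are the three conditions that cut out
  \<open>F(X|K|B)\<close>.\<close>

lemma semidirect_split_exact:
  assumes X [simp]: "X \<in> Obj C" "K \<in> Obj C" "B \<in> Obj C"
  defines "p \<equiv> crm [Ident C X, C.retl K B] \<cdot>\<^bsub>D\<^esub> semidirect_incl C D F X K B"
  shows "p \<in> hom D (semidirect C D F X K B) (cr [X, K])"
    "p \<cdot>\<^bsub>D\<^esub> semidirect_splitting C D F X K B = Ident D (cr [X, K])"
    "is_kernel D (semidirect_left C D F X K B) p"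
proof -
  let ?T = "coprod C [K, B]" and ?\<alpha> = "coprod_assoc C X K B" and ?S = "coprod C [X, K, B]"
  define j l V where "j = semidirect_incl C D F X K B" and "l = semidirect_left C D F X K B"
    and "V = semidirect C D F X K B"
  note jk = semidirect_incl_kernel[OF X, folded j_def]
  note l = semidirect_left[OF X, folded j_def l_def V_def]
  note s = semidirect_splitting[OF X, folded j_def V_def]
  note p_def = p_def[folded j_def]
  have a [simp]: "j \<in> Arr D" "Dom D j = V" "Cod D j = cr [X, ?T]" "l \<in> Arr D" "Dom D l = cr [X, K, B]"
    "Cod D l = V" "V \<in> Obj D"
    using l unfolding j_def V_def by (auto simp: hom_iff)
  show p: "p \<in> hom D (semidirect C D F X K B) (cr [X, K])"
    by (simp add: p_def V_def[symmetric] hom_iff)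
  have ps: "p \<in> Arr D" "Dom D p = V" "Cod D p = cr [X, K]" using p by (auto simp: hom_iff V_def)
  show "p \<cdot>\<^bsub>D\<^esub> semidirect_splitting C D F X K B = Ident D (cr [X, K])"
    using s by (simp add: p_def hom_iff D.assoc cross_map_pair_cross_map_pair cross_map_pair_Ident)
  obtain \<beta> where \<beta>: "\<beta> \<in> hom C (coprod C [X, ?T]) ?S" "\<beta> \<cdot>\<^bsub>C\<^esub> ?\<alpha> = Ident C ?S"
    "?\<alpha> \<cdot>\<^bsub>C\<^esub> \<beta> = Ident C (coprod C [X, ?T])"
    by (rule C.coprod_assoc_iso[OF X])
  have \<beta>s [simp]: "\<beta> \<in> Arr C" "Dom C \<beta> = coprod C [X, ?T]" "Cod C \<beta> = ?S" using \<beta> by (auto simp: hom_iff)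
  have l2: "\<iota> [X, ?T] \<cdot>\<^bsub>D\<^esub> (j \<cdot>\<^bsub>D\<^esub> (l \<cdot>\<^bsub>D\<^esub> u)) = onArr F ?\<alpha> \<cdot>\<^bsub>D\<^esub> (\<iota> [X, K, B] \<cdot>\<^bsub>D\<^esub> u)"
    if "u \<in> hom D W (cr [X, K, B])" for u W
    using l(2)[THEN D.reassoc, of u] that by (simp add: hom_iff D.assoc)
  have "is_kernel D l p"
  proof (rule D.kernelI[OF p[folded V_def] l(1)])
    show "p \<cdot>\<^bsub>D\<^esub> l = zero_map D (cr [X, K, B]) (cr [X, K])"
      by (rule cross_eqI[where Xs = "[X, K]" and W = "cr [X, K, B]"])
        (auto simp: hom_iff ps p_def D.assoc l(2) functor_comp cross_triple_zero)
    show "is_mono D l"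
      unfolding is_mono_def
    proof (intro conjI allI ballI impI)
      fix W u v assume uv: "u \<in> hom D W (Dom D l)" "v \<in> hom D W (Dom D l)" "l \<cdot>\<^bsub>D\<^esub> u = l \<cdot>\<^bsub>D\<^esub> v"
      have us: "u \<in> Arr D" "Dom D u = W" "Cod D u = cr [X, K, B]" "v \<in> Arr D" "Dom D v = W" "Cod D v = cr [X, K, B]"
        using uv by (auto simp: hom_iff)
      \<comment> \<open>\<open>F(\<alpha>)\<close> has the left inverse \<open>F(\<beta>)\<close>,
        so \<open>l\<close> inherits being mono from the inclusion of the ternary
        cross-effect.\<close>
      have "onArr F ?\<alpha> \<cdot>\<^bsub>D\<^esub> (\<iota> [X, K, B] \<cdot>\<^bsub>D\<^esub> u) = onArr F ?\<alpha> \<cdot>\<^bsub>D\<^esub> (\<iota> [X, K, B] \<cdot>\<^bsub>D\<^esub> v)"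
        using l2[of u W] l2[of v W] uv by simp
      then have "onArr F \<beta> \<cdot>\<^bsub>D\<^esub> (onArr F ?\<alpha> \<cdot>\<^bsub>D\<^esub> (\<iota> [X, K, B] \<cdot>\<^bsub>D\<^esub> u)) =
          onArr F \<beta> \<cdot>\<^bsub>D\<^esub> (onArr F ?\<alpha> \<cdot>\<^bsub>D\<^esub> (\<iota> [X, K, B] \<cdot>\<^bsub>D\<^esub> v))"
        by simp
      then have "\<iota> [X, K, B] \<cdot>\<^bsub>D\<^esub> u = \<iota> [X, K, B] \<cdot>\<^bsub>D\<^esub> v"
        using us by (simp add: functor_comp \<beta>(2))
      then show "u = v"
        by (rule cross_eqI[where Xs = "[X, K, B]" and W = W, rotated -1]) (use uv in auto)
    qed simp
    fix W x assume x: "x \<in> hom D W V" "p \<cdot>\<^bsub>D\<^esub> x = zero_map D W (cr [X, K])"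
    have xs: "x \<in> Arr D" "Dom D x = W" "Cod D x = V" "W \<in> Obj D" using x by (auto simp: hom_iff)
    \<comment> \<open>\<open>?y\<close> is \<open>x\<close> regarded in
      \<open>F(X + (K + B))\<close>; \<open>F(\<beta>)\<close> moves it to
      \<open>F(X + K + B)\<close>, where the lift is taken.\<close>
    let ?y = "\<iota> [X, ?T] \<cdot>\<^bsub>D\<^esub> (j \<cdot>\<^bsub>D\<^esub> x)"
    have \<alpha>\<beta>: "g \<cdot>\<^bsub>C\<^esub> (?\<alpha> \<cdot>\<^bsub>C\<^esub> \<beta>) = g" if "g \<in> Arr C" "Dom C g = coprod C [X, ?T]" for g
      using that \<beta>(3) by simp
    \<comment> \<open>Naturality of \<open>\<iota>\<close> turns \<open>F(1 + retr)\<close> into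
      \<open>F(X|retr)\<close>, which kills \<open>j\<close>.\<close>
    have y1: "onArr F (coprod_map C [Ident C X, C.retr K B]) \<cdot>\<^bsub>D\<^esub> ?y = zero_map D W (onObj F (coprod C [X, B]))"
    proof -
      have "onArr F (coprod_map C [Ident C X, C.retr K B]) \<cdot>\<^bsub>D\<^esub> ?y =
          \<iota> [X, B] \<cdot>\<^bsub>D\<^esub> (crm [Ident C X, C.retr K B] \<cdot>\<^bsub>D\<^esub> (j \<cdot>\<^bsub>D\<^esub> x))"
        using xs by simp
      also have "\<dots> = zero_map D W (onObj F (coprod C [X, B]))"
        using xs D.kernelD(4)[OF jk, THEN D.reassoc, of x] by (simp del: cross_map_pair_comp)
      finally show ?thesis .
    qed
    have y2: "onArr F (coprod_map C [Ident C X, C.retl K B]) \<cdot>\<^bsub>D\<^esub> ?y = zero_map D W (onObj F (coprod C [X, K]))"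
    proof -
      have "onArr F (coprod_map C [Ident C X, C.retl K B]) \<cdot>\<^bsub>D\<^esub> ?y =
          \<iota> [X, K] \<cdot>\<^bsub>D\<^esub> (crm [Ident C X, C.retl K B] \<cdot>\<^bsub>D\<^esub> (j \<cdot>\<^bsub>D\<^esub> x))"
        using xs by simp
      also have "\<dots> = \<iota> [X, K] \<cdot>\<^bsub>D\<^esub> (p \<cdot>\<^bsub>D\<^esub> x)" using xs by (simp add: p_def D.assoc)
      also have "\<dots> = zero_map D W (onObj F (coprod C [X, K]))" using xs by (simp add: x(2))
      finally show ?thesis .
    qed
    obtain u where u: "u \<in> hom D W (cr [X, K, B])" "\<iota> [X, K, B] \<cdot>\<^bsub>D\<^esub> u = onArr F \<beta> \<cdot>\<^bsub>D\<^esub> ?y"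
      by (rule cross_triple_lift[OF X, of "onArr F \<beta> \<cdot>\<^bsub>D\<^esub> ?y" W])
        (use xs in \<open>auto simp: hom_iff functor_comp C.assoc \<alpha>\<beta> y1 y2\<close>)
    have us: "u \<in> Arr D" "Dom D u = W" "Cod D u = cr [X, K, B]" using u by (auto simp: hom_iff)
    have "\<iota> [X, ?T] \<cdot>\<^bsub>D\<^esub> (j \<cdot>\<^bsub>D\<^esub> (l \<cdot>\<^bsub>D\<^esub> u)) = ?y"
      using l2[OF u(1)] u(2) xs by (simp add: functor_comp \<beta>(3))
    then have "j \<cdot>\<^bsub>D\<^esub> (l \<cdot>\<^bsub>D\<^esub> u) = j \<cdot>\<^bsub>D\<^esub> x"
      by (rule cross_eqI[where Xs = "[X, ?T]" and W = W, rotated -1]) (use us xs in \<open>auto simp: hom_iff\<close>)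
    then have "l \<cdot>\<^bsub>D\<^esub> u = x"
      by (rule D.monoD[OF D.kernel_mono[OF jk], where W = W]) (use us xs in \<open>auto simp: hom_iff\<close>)
    then show "\<exists>u \<in> hom D W (cr [X, K, B]). l \<cdot>\<^bsub>D\<^esub> u = x" using u by blast
  qed
  then show "is_kernel D (semidirect_left C D F X K B) p" by (simp add: l_def)
qed

section \<open>Comparison of kernels and right exactness\<close>

text \<open>Interchange of kernels. An element of the kernel of \<open>F(1 + g)\<close> is already
  killed by \<open>F(retl)\<close>, because \<open>retl\<close> after \<open>1 + g\<close> is
  \<open>retl\<close>. So lying in \<open>F(X|Y)\<close> is one further condition, to be killed by
  \<open>F(retr)\<close>, that is by \<open>p\<close>; and \<open>p\<close> is split by the
  restriction of \<open>F(inr)\<close>.\<close>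

lemma kernel_of_kernels:
  assumes X [simp]: "X \<in> Obj C" and g: "g \<in> hom C Y Y'"
    and \<nu>: "is_kernel D \<nu> (onArr F (coprod_map C [Ident C X, g]))" and \<mu>: "is_kernel D \<mu> (onArr F g)"
    and \<theta>: "is_kernel D \<theta> (crm [Ident C X, g])"
  obtains p s \<kappa> where
    "p \<in> hom D (Dom D \<nu>) (Dom D \<mu>)" "\<mu> \<cdot>\<^bsub>D\<^esub> p = onArr F (C.retr X Y) \<cdot>\<^bsub>D\<^esub> \<nu>"
    "s \<in> hom D (Dom D \<mu>) (Dom D \<nu>)" "\<nu> \<cdot>\<^bsub>D\<^esub> s = onArr F (C.inr X Y) \<cdot>\<^bsub>D\<^esub> \<mu>"
    "p \<cdot>\<^bsub>D\<^esub> s = Ident D (Dom D \<mu>)"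
    "\<kappa> \<in> hom D (Dom D \<theta>) (Dom D \<nu>)" "\<nu> \<cdot>\<^bsub>D\<^esub> \<kappa> = \<iota> [X, Y] \<cdot>\<^bsub>D\<^esub> \<theta>" "is_kernel D \<kappa> p"
proof -
  let ?g = "coprod_map C [Ident C X, g]"
  have gs [simp]: "g \<in> Arr C" "Dom C g = Y" "Cod C g = Y'" "Y \<in> Obj C" "Y' \<in> Obj C"
    using g by (auto simp: hom_iff)
  note \<nu>d = D.kernelD[OF \<nu>] and \<mu>d = D.kernelD[OF \<mu>] and \<theta>d = D.kernelD[OF \<theta>]
  have a [simp]: "\<nu> \<in> Arr D" "Cod D \<nu> = onObj F (coprod C [X, Y])" "\<mu> \<in> Arr D" "Cod D \<mu> = onObj F Y"
    "\<theta> \<in> Arr D" "Cod D \<theta> = cr [X, Y]"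
    using \<nu>d \<mu>d \<theta>d by auto
  have zn: "onArr F (t \<cdot>\<^bsub>C\<^esub> ?g) \<cdot>\<^bsub>D\<^esub> \<nu> = zero_map D (Dom D \<nu>) (onObj F (Cod C t))"
    if "t \<in> Arr C" "Dom C t = coprod C [X, Y']" for t
  proof -
    have "onArr F (t \<cdot>\<^bsub>C\<^esub> ?g) \<cdot>\<^bsub>D\<^esub> \<nu> = onArr F t \<cdot>\<^bsub>D\<^esub> (onArr F ?g \<cdot>\<^bsub>D\<^esub> \<nu>)"
      using that by (simp add: functor_comp)
    then show ?thesis using that \<nu>d(4) by simp
  qed
  have zm: "onArr F (t \<cdot>\<^bsub>C\<^esub> g) \<cdot>\<^bsub>D\<^esub> \<mu> = zero_map D (Dom D \<mu>) (onObj F (Cod C t))"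
    if "t \<in> Arr C" "Dom C t = Y'" for t
  proof -
    have "onArr F (t \<cdot>\<^bsub>C\<^esub> g) \<cdot>\<^bsub>D\<^esub> \<mu> = onArr F t \<cdot>\<^bsub>D\<^esub> (onArr F g \<cdot>\<^bsub>D\<^esub> \<mu>)"
      using that by (simp add: functor_comp)
    then show ?thesis using that \<mu>d(4) by simp
  qed
  \<comment> \<open>Naturality of \<open>retr\<close> in \<open>g\<close> makes
    \<open>F(retr)\<close> send the kernel of \<open>F(1 + g)\<close> into that of
    \<open>F(g)\<close>.\<close>
  have zr: "onArr F (g \<cdot>\<^bsub>C\<^esub> C.retr X Y) \<cdot>\<^bsub>D\<^esub> \<nu> = zero_map D (Dom D \<nu>) (onObj F Y')"
    using zn[of "C.retr X Y'"] by (simp add: C.ret_sum_map)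
  have zl: "onArr F (C.retl X Y) \<cdot>\<^bsub>D\<^esub> \<nu> = zero_map D (Dom D \<nu>) (onObj F X)"
    using zn[of "C.retl X Y'"] by (simp add: C.ret_sum_map)
  obtain p where p: "p \<in> hom D (Dom D \<nu>) (Dom D \<mu>)" "\<mu> \<cdot>\<^bsub>D\<^esub> p = onArr F (C.retr X Y) \<cdot>\<^bsub>D\<^esub> \<nu>"
    by (rule D.kernel_lift[OF \<mu>, of "onArr F (C.retr X Y) \<cdot>\<^bsub>D\<^esub> \<nu>" "Dom D \<nu>"])
      (auto simp: hom_iff functor_comp zr)
  obtain s where s: "s \<in> hom D (Dom D \<mu>) (Dom D \<nu>)" "\<nu> \<cdot>\<^bsub>D\<^esub> s = onArr F (C.inr X Y) \<cdot>\<^bsub>D\<^esub> \<mu>"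
    by (rule D.kernel_lift[OF \<nu>, of "onArr F (C.inr X Y) \<cdot>\<^bsub>D\<^esub> \<mu>" "Dom D \<mu>"])
      (auto simp: hom_iff functor_comp zm)
  have gi: "onArr F ?g \<cdot>\<^bsub>D\<^esub> (\<iota> [X, Y] \<cdot>\<^bsub>D\<^esub> u) = \<iota> [X, Y'] \<cdot>\<^bsub>D\<^esub> (crm [Ident C X, g] \<cdot>\<^bsub>D\<^esub> u)"
    if "u \<in> Arr D" "Cod D u = cr [X, Y]" for u
    using that by simp
  have z\<theta>: "onArr F ?g \<cdot>\<^bsub>D\<^esub> (\<iota> [X, Y] \<cdot>\<^bsub>D\<^esub> \<theta>) = zero_map D (Dom D \<theta>) (onObj F (coprod C [X, Y']))"
    using gi[of \<theta>] \<theta>d(4) by simp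
  obtain \<kappa> where \<kappa>: "\<kappa> \<in> hom D (Dom D \<theta>) (Dom D \<nu>)" "\<nu> \<cdot>\<^bsub>D\<^esub> \<kappa> = \<iota> [X, Y] \<cdot>\<^bsub>D\<^esub> \<theta>"
    by (rule D.kernel_lift[OF \<nu>, of "\<iota> [X, Y] \<cdot>\<^bsub>D\<^esub> \<theta>" "Dom D \<theta>"]) (auto simp: hom_iff z\<theta>)
  have b [simp]: "p \<in> Arr D" "Dom D p = Dom D \<nu>" "Cod D p = Dom D \<mu>" "s \<in> Arr D" "Dom D s = Dom D \<mu>"
    "Cod D s = Dom D \<nu>" "\<kappa> \<in> Arr D" "Dom D \<kappa> = Dom D \<theta>" "Cod D \<kappa> = Dom D \<nu>"
    using p s \<kappa> by (auto simp: hom_iff)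
  have ps: "p \<cdot>\<^bsub>D\<^esub> s = Ident D (Dom D \<mu>)"
    by (rule D.monoD[OF D.kernel_mono[OF \<mu>], where W = "Dom D \<mu>"])
      (auto simp: hom_iff p(2)[THEN D.reassoc] D.assoc s(2) functor_comp)
  have \<nu>\<kappa>: "\<nu> \<cdot>\<^bsub>D\<^esub> (\<kappa> \<cdot>\<^bsub>D\<^esub> u) = \<iota> [X, Y] \<cdot>\<^bsub>D\<^esub> (\<theta> \<cdot>\<^bsub>D\<^esub> u)" if "u \<in> hom D W (Dom D \<theta>)" for u W
    using that by (simp add: hom_iff \<kappa>(2)[THEN D.reassoc] D.assoc)
  have "is_kernel D \<kappa> p"
  proof (rule D.kernelI[OF p(1) \<kappa>(1)])
    show "p \<cdot>\<^bsub>D\<^esub> \<kappa> = zero_map D (Dom D \<theta>) (Dom D \<mu>)"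
      by (rule D.monoD[OF D.kernel_mono[OF \<mu>], where W = "Dom D \<theta>"])
        (auto simp: hom_iff p(2)[THEN D.reassoc] D.assoc \<kappa>(2))
    show "is_mono D \<kappa>"
      unfolding is_mono_def
    proof (intro conjI allI ballI impI)
      fix W u v assume uv: "u \<in> hom D W (Dom D \<kappa>)" "v \<in> hom D W (Dom D \<kappa>)" "\<kappa> \<cdot>\<^bsub>D\<^esub> u = \<kappa> \<cdot>\<^bsub>D\<^esub> v"
      have "\<iota> [X, Y] \<cdot>\<^bsub>D\<^esub> (\<theta> \<cdot>\<^bsub>D\<^esub> u) = \<iota> [X, Y] \<cdot>\<^bsub>D\<^esub> (\<theta> \<cdot>\<^bsub>D\<^esub> v)"
        using \<nu>\<kappa>[of u W] \<nu>\<kappa>[of v W] uv by simp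
      then have "\<theta> \<cdot>\<^bsub>D\<^esub> u = \<theta> \<cdot>\<^bsub>D\<^esub> v"
        by (rule cross_eqI[where Xs = "[X, Y]" and W = W, rotated -1]) (use uv in \<open>auto simp: hom_iff\<close>)
      then show "u = v" by (rule D.monoD[OF D.kernel_mono[OF \<theta>], where W = W]) (use uv in auto)
    qed simp
    fix W x assume x: "x \<in> hom D W (Dom D \<nu>)" "p \<cdot>\<^bsub>D\<^esub> x = zero_map D W (Dom D \<mu>)"
    have xs: "x \<in> Arr D" "Dom D x = W" "Cod D x = Dom D \<nu>" "W \<in> Obj D" using x by (auto simp: hom_iff)
    have "onArr F (C.retr X Y) \<cdot>\<^bsub>D\<^esub> (\<nu> \<cdot>\<^bsub>D\<^esub> x) = \<mu> \<cdot>\<^bsub>D\<^esub> (p \<cdot>\<^bsub>D\<^esub> x)"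
      using xs by (simp add: p(2)[THEN D.reassoc] D.assoc)
    then have r: "onArr F (C.retr X Y) \<cdot>\<^bsub>D\<^esub> (\<nu> \<cdot>\<^bsub>D\<^esub> x) = zero_map D W (onObj F Y)"
      using xs x(2) by simp
    have l: "onArr F (C.retl X Y) \<cdot>\<^bsub>D\<^esub> (\<nu> \<cdot>\<^bsub>D\<^esub> x) = zero_map D W (onObj F X)"
      using xs by (simp add: zl[THEN D.reassoc])
    obtain z where z: "z \<in> hom D W (cr [X, Y])" "\<iota> [X, Y] \<cdot>\<^bsub>D\<^esub> z = \<nu> \<cdot>\<^bsub>D\<^esub> x"
      by (rule cross_pair_lift[OF X gs(4) _ l r]) (use xs in \<open>auto simp: hom_iff\<close>)
    have zs: "z \<in> Arr D" "Dom D z = W" "Cod D z = cr [X, Y]" using z by (auto simp: hom_iff)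
    \<comment> \<open>\<open>z\<close> represents \<open>\<nu> x\<close>, which is killed by
      \<open>F(1 + g)\<close>; hence \<open>F(X|g)\<close> kills \<open>z\<close>, which therefore
      factors through \<open>\<theta>\<close>.\<close>
    have cz: "crm [Ident C X, g] \<cdot>\<^bsub>D\<^esub> z = zero_map D W (cr [X, Y'])"
      by (rule cross_eqI[where Xs = "[X, Y']" and W = W])
        (use zs xs z(2) in \<open>auto simp: hom_iff \<nu>d(4)[THEN D.reassoc]\<close>)
    obtain t where t: "t \<in> hom D W (Dom D \<theta>)" "\<theta> \<cdot>\<^bsub>D\<^esub> t = z"
      by (rule D.kernel_lift[OF \<theta>, of z W]) (use zs cz in \<open>auto simp: hom_iff\<close>)
    have "\<nu> \<cdot>\<^bsub>D\<^esub> (\<kappa> \<cdot>\<^bsub>D\<^esub> t) = \<nu> \<cdot>\<^bsub>D\<^esub> x" using \<nu>\<kappa>[OF t(1)] t(2) z(2) by simp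
    then have "\<kappa> \<cdot>\<^bsub>D\<^esub> t = x"
      by (rule D.monoD[OF D.kernel_mono[OF \<nu>], where W = W]) (use t xs in \<open>auto simp: hom_iff\<close>)
    then show "\<exists>u \<in> hom D W (Dom D \<theta>). \<kappa> \<cdot>\<^bsub>D\<^esub> u = x" using t by blast
  qed
  then show thesis using that p s ps \<kappa> by blast
qed

text \<open>Concerns the restriction of \<open>F(X|(k,1))\<close> to \<open>V\<close> as a whole;
  how this arrow acts on the two parts of \<open>V\<close> is a separate computation with
  coproducts.\<close>

lemma semidirect_right_exact:
  assumes refl: "preserves_reflexive_coequalisers C D F"
    and X [simp]: "X \<in> Obj C" and k: "k \<in> hom C K B" and f: "f \<in> hom C B A" and fk: "is_cokernel C f k"
  shows "right_exact D (crm [Ident C X, C.copair k (Ident C B)] \<cdot>\<^bsub>D\<^esub> semidirect_incl C D F X K B)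
    (crm [Ident C X, f])"
proof -
  have a [simp]: "k \<in> Arr C" "Dom C k = K" "Cod C k = B" "f \<in> Arr C" "Dom C f = B" "Cod C f = A"
    "K \<in> Obj C" "B \<in> Obj C" "A \<in> Obj C"
    using k f by (auto simp: hom_iff)
  let ?T = "coprod C [K, B]"
  define d c d\<^sub>1 c\<^sub>1 f\<^sub>1 where "d = C.retr K B" and "c = C.copair k (Ident C B)"
    and "d\<^sub>1 = coprod_map C [Ident C X, d]" and "c\<^sub>1 = coprod_map C [Ident C X, c]"
    and "f\<^sub>1 = coprod_map C [Ident C X, f]"
  define e\<^sub>1 where "e\<^sub>1 = coprod_map C [Ident C X, C.inr K B]"
  have dc [simp]: "d \<in> Arr C" "Dom C d = ?T" "Cod C d = B" "c \<in> Arr C" "Dom C c = ?T" "Cod C c = B"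
    by (auto simp: d_def c_def)
  have dc1 [simp]: "d\<^sub>1 \<in> Arr C" "Dom C d\<^sub>1 = coprod C [X, ?T]" "Cod C d\<^sub>1 = coprod C [X, B]"
    "c\<^sub>1 \<in> Arr C" "Dom C c\<^sub>1 = coprod C [X, ?T]" "Cod C c\<^sub>1 = coprod C [X, B]"
    "f\<^sub>1 \<in> Arr C" "Dom C f\<^sub>1 = coprod C [X, B]" "Cod C f\<^sub>1 = coprod C [X, A]"
    "e\<^sub>1 \<in> Arr C" "Dom C e\<^sub>1 = coprod C [X, B]" "Cod C e\<^sub>1 = coprod C [X, ?T]"
    by (auto simp: d\<^sub>1_def c\<^sub>1_def f\<^sub>1_def e\<^sub>1_def)
  have de: "d\<^sub>1 \<cdot>\<^bsub>C\<^esub> e\<^sub>1 = Ident C (coprod C [X, B])" "c\<^sub>1 \<cdot>\<^bsub>C\<^esub> e\<^sub>1 = Ident C (coprod C [X, B])"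
    by (simp_all add: d\<^sub>1_def c\<^sub>1_def e\<^sub>1_def C.sum_map_sum_map C.sum_map_Ident d_def c_def)
  have "is_coequaliser C d\<^sub>1 c\<^sub>1 f\<^sub>1"
    unfolding d\<^sub>1_def c\<^sub>1_def f\<^sub>1_def d_def c_def by (rule C.sum_map_coequaliser[OF X k f fk])
  moreover have "is_reflexive_graph C d\<^sub>1 c\<^sub>1 e\<^sub>1"
    unfolding is_reflexive_graph_def
    by (intro exI[of _ "coprod C [X, B]"] exI[of _ "coprod C [X, ?T]"]) (simp add: hom_iff de)
  ultimately have coeq: "is_coequaliser D (onArr F d\<^sub>1) (onArr F c\<^sub>1) (onArr F f\<^sub>1)"
    using refl unfolding preserves_reflexive_coequalisers_def by blast
  have fd: "f \<cdot>\<^bsub>C\<^esub> d = f \<cdot>\<^bsub>C\<^esub> c"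
  proof (rule C.pair_eqI[where X = K and Y = B and Z = A])
    have "f \<cdot>\<^bsub>C\<^esub> k = zero_map C K A" using fk by (simp add: is_cokernel_def)
    then show "(f \<cdot>\<^bsub>C\<^esub> d) \<cdot>\<^bsub>C\<^esub> C.inl K B = (f \<cdot>\<^bsub>C\<^esub> c) \<cdot>\<^bsub>C\<^esub> C.inl K B"
      by (simp add: C.assoc) (simp add: d_def c_def)
    show "(f \<cdot>\<^bsub>C\<^esub> d) \<cdot>\<^bsub>C\<^esub> C.inr K B = (f \<cdot>\<^bsub>C\<^esub> c) \<cdot>\<^bsub>C\<^esub> C.inr K B"
      by (simp add: C.assoc) (simp add: d_def c_def)
  qed (auto simp: hom_iff)
  have reg: "is_regular_epi D (crm [Ident C X, f])"
    by (rule cross_map_regular_epi[OF X f]) (use coeq in \<open>auto simp: is_regular_epi_def f\<^sub>1_def\<close>)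
  define \<nu>\<^sub>1 \<nu>\<^sub>0 \<mu>\<^sub>1 \<mu>\<^sub>0 \<theta>\<^sub>1 \<theta>\<^sub>0 where "\<nu>\<^sub>1 = kernel D (onArr F d\<^sub>1)" and "\<nu>\<^sub>0 = kernel D (onArr F f\<^sub>1)"
    and "\<mu>\<^sub>1 = kernel D (onArr F d)" and "\<mu>\<^sub>0 = kernel D (onArr F f)"
    and "\<theta>\<^sub>1 = semidirect_incl C D F X K B" and "\<theta>\<^sub>0 = kernel D (crm [Ident C X, f])"
  have ker: "is_kernel D \<nu>\<^sub>1 (onArr F d\<^sub>1)" "is_kernel D \<nu>\<^sub>0 (onArr F f\<^sub>1)" "is_kernel D \<mu>\<^sub>1 (onArr F d)"
    "is_kernel D \<mu>\<^sub>0 (onArr F f)" "is_kernel D \<theta>\<^sub>0 (crm [Ident C X, f])"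
    unfolding \<nu>\<^sub>1_def \<nu>\<^sub>0_def \<mu>\<^sub>1_def \<mu>\<^sub>0_def \<theta>\<^sub>0_def by (auto intro: D.kernel_is_kernel)
  have ker\<theta>: "is_kernel D \<theta>\<^sub>1 (crm [Ident C X, d])"
    unfolding \<theta>\<^sub>1_def d_def by (rule semidirect_incl_kernel) auto
  note kd = D.kernelD(2,3)[OF ker(1)] D.kernelD(2,3)[OF ker(2)] D.kernelD(2,3)[OF ker(3)]
    D.kernelD(2,3)[OF ker(4)] D.kernelD(2,3)[OF ker(5)] D.kernelD(2,3)[OF ker\<theta>]
  have b [simp]: "\<nu>\<^sub>1 \<in> Arr D" "Cod D \<nu>\<^sub>1 = onObj F (coprod C [X, ?T])" "\<nu>\<^sub>0 \<in> Arr D"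
    "Cod D \<nu>\<^sub>0 = onObj F (coprod C [X, B])" "\<mu>\<^sub>1 \<in> Arr D" "Cod D \<mu>\<^sub>1 = onObj F ?T" "\<mu>\<^sub>0 \<in> Arr D"
    "Cod D \<mu>\<^sub>0 = onObj F B" "\<theta>\<^sub>0 \<in> Arr D" "Cod D \<theta>\<^sub>0 = cr [X, B]" "\<theta>\<^sub>1 \<in> Arr D" "Cod D \<theta>\<^sub>1 = cr [X, ?T]"
    using kd by auto
  \<comment> \<open>The domains of \<open>\<nu>\<^sub>1\<close> and \<open>\<nu>\<^sub>0\<close> are
    \<open>N\<^sub>1\<close> and \<open>N\<^sub>0\<close>. The \<open>\<mu>\<^sub>1\<close> and
    \<open>\<mu>\<^sub>0\<close> are the corresponding kernels without \<open>X\<close>; their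
    domains are the bases of the split epimorphisms \<open>p\<^sub>1\<close> and
    \<open>p\<^sub>0\<close>.\<close>
  obtain \<epsilon> where \<epsilon>: "is_regular_epi D \<epsilon>" "\<epsilon> \<in> hom D (Dom D \<nu>\<^sub>1) (Dom D \<nu>\<^sub>0)" "\<nu>\<^sub>0 \<cdot>\<^bsub>D\<^esub> \<epsilon> = onArr F c\<^sub>1 \<cdot>\<^bsub>D\<^esub> \<nu>\<^sub>1"
    by (rule D.reflexive_graph_normalisation[where e = "onArr F e\<^sub>1", OF _ _ _ _ _ coeq ker(2) ker(1)])
      (auto simp: hom_iff functor_comp de)
  obtain p\<^sub>1 s\<^sub>1 \<kappa>\<^sub>1 where 1: "p\<^sub>1 \<in> hom D (Dom D \<nu>\<^sub>1) (Dom D \<mu>\<^sub>1)" "\<mu>\<^sub>1 \<cdot>\<^bsub>D\<^esub> p\<^sub>1 = onArr F (C.retr X ?T) \<cdot>\<^bsub>D\<^esub> \<nu>\<^sub>1"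
    "s\<^sub>1 \<in> hom D (Dom D \<mu>\<^sub>1) (Dom D \<nu>\<^sub>1)" "\<nu>\<^sub>1 \<cdot>\<^bsub>D\<^esub> s\<^sub>1 = onArr F (C.inr X ?T) \<cdot>\<^bsub>D\<^esub> \<mu>\<^sub>1"
    "p\<^sub>1 \<cdot>\<^bsub>D\<^esub> s\<^sub>1 = Ident D (Dom D \<mu>\<^sub>1)" "\<kappa>\<^sub>1 \<in> hom D (Dom D \<theta>\<^sub>1) (Dom D \<nu>\<^sub>1)"
    "\<nu>\<^sub>1 \<cdot>\<^bsub>D\<^esub> \<kappa>\<^sub>1 = \<iota> [X, ?T] \<cdot>\<^bsub>D\<^esub> \<theta>\<^sub>1" "is_kernel D \<kappa>\<^sub>1 p\<^sub>1"
    by (rule kernel_of_kernels[OF X _ ker(1)[unfolded d\<^sub>1_def] ker(3) ker\<theta>]) (auto simp: hom_iff)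
  obtain p\<^sub>0 s\<^sub>0 \<kappa>\<^sub>0 where 0: "p\<^sub>0 \<in> hom D (Dom D \<nu>\<^sub>0) (Dom D \<mu>\<^sub>0)" "\<mu>\<^sub>0 \<cdot>\<^bsub>D\<^esub> p\<^sub>0 = onArr F (C.retr X B) \<cdot>\<^bsub>D\<^esub> \<nu>\<^sub>0"
    "s\<^sub>0 \<in> hom D (Dom D \<mu>\<^sub>0) (Dom D \<nu>\<^sub>0)" "\<nu>\<^sub>0 \<cdot>\<^bsub>D\<^esub> s\<^sub>0 = onArr F (C.inr X B) \<cdot>\<^bsub>D\<^esub> \<mu>\<^sub>0"
    "p\<^sub>0 \<cdot>\<^bsub>D\<^esub> s\<^sub>0 = Ident D (Dom D \<mu>\<^sub>0)" "\<kappa>\<^sub>0 \<in> hom D (Dom D \<theta>\<^sub>0) (Dom D \<nu>\<^sub>0)"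
    "\<nu>\<^sub>0 \<cdot>\<^bsub>D\<^esub> \<kappa>\<^sub>0 = \<iota> [X, B] \<cdot>\<^bsub>D\<^esub> \<theta>\<^sub>0" "is_kernel D \<kappa>\<^sub>0 p\<^sub>0"
    by (rule kernel_of_kernels[OF X f ker(2)[unfolded f\<^sub>1_def] ker(4,5)])
  have m [simp]: "\<epsilon> \<in> Arr D" "Dom D \<epsilon> = Dom D \<nu>\<^sub>1" "Cod D \<epsilon> = Dom D \<nu>\<^sub>0"
    "p\<^sub>1 \<in> Arr D" "Dom D p\<^sub>1 = Dom D \<nu>\<^sub>1" "Cod D p\<^sub>1 = Dom D \<mu>\<^sub>1"
    "s\<^sub>1 \<in> Arr D" "Dom D s\<^sub>1 = Dom D \<mu>\<^sub>1" "Cod D s\<^sub>1 = Dom D \<nu>\<^sub>1"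
    "\<kappa>\<^sub>1 \<in> Arr D" "Dom D \<kappa>\<^sub>1 = Dom D \<theta>\<^sub>1" "Cod D \<kappa>\<^sub>1 = Dom D \<nu>\<^sub>1"
    "p\<^sub>0 \<in> Arr D" "Dom D p\<^sub>0 = Dom D \<nu>\<^sub>0" "Cod D p\<^sub>0 = Dom D \<mu>\<^sub>0"
    "s\<^sub>0 \<in> Arr D" "Dom D s\<^sub>0 = Dom D \<mu>\<^sub>0" "Cod D s\<^sub>0 = Dom D \<nu>\<^sub>0"
    "\<kappa>\<^sub>0 \<in> Arr D" "Dom D \<kappa>\<^sub>0 = Dom D \<theta>\<^sub>0" "Cod D \<kappa>\<^sub>0 = Dom D \<nu>\<^sub>0"
    using \<epsilon> 1 0 by (auto simp: hom_iff)
  \<comment> \<open>The morphism \<open>h\<close> between the bases is the restriction of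
    \<open>F(c)\<close>. It lands in the kernel of \<open>F(f)\<close> because
    \<open>f c = f d\<close> and \<open>F(d)\<close> vanishes on its kernel.\<close>
  have "onArr F f \<cdot>\<^bsub>D\<^esub> (onArr F c \<cdot>\<^bsub>D\<^esub> \<mu>\<^sub>1) = onArr F f \<cdot>\<^bsub>D\<^esub> (onArr F d \<cdot>\<^bsub>D\<^esub> \<mu>\<^sub>1)"
    by (simp add: functor_comp fd)
  then have z: "onArr F f \<cdot>\<^bsub>D\<^esub> (onArr F c \<cdot>\<^bsub>D\<^esub> \<mu>\<^sub>1) = zero_map D (Dom D \<mu>\<^sub>1) (onObj F A)"
    using D.kernelD(4)[OF ker(3)] by simp
  obtain h where h: "h \<in> hom D (Dom D \<mu>\<^sub>1) (Dom D \<mu>\<^sub>0)" "\<mu>\<^sub>0 \<cdot>\<^bsub>D\<^esub> h = onArr F c \<cdot>\<^bsub>D\<^esub> \<mu>\<^sub>1"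
    by (rule D.kernel_lift[OF ker(4), of "onArr F c \<cdot>\<^bsub>D\<^esub> \<mu>\<^sub>1" "Dom D \<mu>\<^sub>1"]) (use z in \<open>auto simp: hom_iff\<close>)
  have hs [simp]: "h \<in> Arr D" "Dom D h = Dom D \<mu>\<^sub>1" "Cod D h = Dom D \<mu>\<^sub>0" using h by (auto simp: hom_iff)
  \<comment> \<open>Naturality of \<open>retr\<close> and \<open>inr\<close> in \<open>c\<close>
    yields the two squares that make \<open>\<epsilon>\<close> a morphism of split epimorphisms over
    \<open>h\<close>.\<close>
  have rc: "C.retr X B \<cdot>\<^bsub>C\<^esub> c\<^sub>1 = c \<cdot>\<^bsub>C\<^esub> C.retr X ?T" "c\<^sub>1 \<cdot>\<^bsub>C\<^esub> C.inr X ?T = C.inr X B \<cdot>\<^bsub>C\<^esub> c"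
    by (simp_all add: c\<^sub>1_def C.ret_sum_map)
  have p\<epsilon>: "p\<^sub>0 \<cdot>\<^bsub>D\<^esub> \<epsilon> = h \<cdot>\<^bsub>D\<^esub> p\<^sub>1"
    by (rule D.monoD[OF D.kernel_mono[OF ker(4)], where W = "Dom D \<nu>\<^sub>1"])
      (auto simp: hom_iff 0(2)[THEN D.reassoc] h(2)[THEN D.reassoc] D.assoc \<epsilon>(3) 1(2) functor_comp rc)
  have \<epsilon>s: "\<epsilon> \<cdot>\<^bsub>D\<^esub> s\<^sub>1 = s\<^sub>0 \<cdot>\<^bsub>D\<^esub> h"
    by (rule D.monoD[OF D.kernel_mono[OF ker(2)], where W = "Dom D \<mu>\<^sub>1"])
      (auto simp: hom_iff 0(4)[THEN D.reassoc] h(2) D.assoc \<epsilon>(3)[THEN D.reassoc] 1(4) functor_comp rc)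
  have "p\<^sub>0 \<cdot>\<^bsub>D\<^esub> (\<epsilon> \<cdot>\<^bsub>D\<^esub> \<kappa>\<^sub>1) = zero_map D (Dom D \<theta>\<^sub>1) (Cod D p\<^sub>0)"
    using D.kernelD(4)[OF 1(8)] by (simp add: p\<epsilon>[THEN D.reassoc] D.assoc)
  then obtain u where u: "u \<in> hom D (Dom D \<theta>\<^sub>1) (Dom D \<theta>\<^sub>0)" "\<kappa>\<^sub>0 \<cdot>\<^bsub>D\<^esub> u = \<epsilon> \<cdot>\<^bsub>D\<^esub> \<kappa>\<^sub>1"
    using D.kernel_univ[OF 0(8), of "\<epsilon> \<cdot>\<^bsub>D\<^esub> \<kappa>\<^sub>1" "Dom D \<theta>\<^sub>1"] by (auto simp: hom_iff)
  have us [simp]: "u \<in> Arr D" "Dom D u = Dom D \<theta>\<^sub>1" "Cod D u = Dom D \<theta>\<^sub>0" using u by (auto simp: hom_iff)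
  have ureg: "is_regular_epi D u"
    by (rule D.kernel_map_regular_epi[OF \<epsilon>(1,2) 1(1,3,5) 0(1,3) h(1) p\<epsilon> \<epsilon>s 1(8) 0(8)])
      (use u in auto)
  \<comment> \<open>The arrow in question is thus the kernel of \<open>F(X|f)\<close> after the
    regular epimorphism \<open>u\<close>, the shape required by \<open>right_exactI\<close>; the
    equality is tested in \<open>F(X + B)\<close>.\<close>
  have "\<theta>\<^sub>0 \<cdot>\<^bsub>D\<^esub> u = crm [Ident C X, c] \<cdot>\<^bsub>D\<^esub> \<theta>\<^sub>1"
  proof (rule cross_eqI[where Xs = "[X, B]" and W = "Dom D \<theta>\<^sub>1"])
    have "\<iota> [X, B] \<cdot>\<^bsub>D\<^esub> (\<theta>\<^sub>0 \<cdot>\<^bsub>D\<^esub> u) = \<nu>\<^sub>0 \<cdot>\<^bsub>D\<^esub> (\<epsilon> \<cdot>\<^bsub>D\<^esub> \<kappa>\<^sub>1)"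
      using 0(7)[THEN D.reassoc, of u] u(2) by (simp add: D.assoc)
    also have "\<dots> = onArr F c\<^sub>1 \<cdot>\<^bsub>D\<^esub> (\<iota> [X, ?T] \<cdot>\<^bsub>D\<^esub> \<theta>\<^sub>1)"
      by (simp add: \<epsilon>(3)[THEN D.reassoc] D.assoc 1(7))
    finally show "\<iota> [X, B] \<cdot>\<^bsub>D\<^esub> (\<theta>\<^sub>0 \<cdot>\<^bsub>D\<^esub> u) = \<iota> [X, B] \<cdot>\<^bsub>D\<^esub> (crm [Ident C X, c] \<cdot>\<^bsub>D\<^esub> \<theta>\<^sub>1)"
      by (simp add: c\<^sub>1_def)
  qed (auto simp: hom_iff)
  then show ?thesis
    using D.right_exactI[OF reg ker(5) ureg] by (simp add: c_def \<theta>\<^sub>1_def)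
qed

end

theorem theorem9p9:
  fixes C :: "('a, 'f) cat" and D :: "('b, 'g) cat" and F :: "('a, 'f, 'b, 'g) funct"
    and X K B A :: 'a and k f :: 'f
  assumes "pointed_category C" and "has_binary_coproducts C"
    and "semi_abelian_category D"
    and "cat_functor C D F"
    and "preserves_zero C D F"
    and "preserves_reflexive_coequalisers C D F"
    and "X \<in> Obj C"
    and "k \<in> hom C K B" and "f \<in> hom C B A" and "is_cokernel C f k"
  shows "\<exists>\<phi>.
    (\<forall>\<psi>. \<psi> \<in> hom D (semidirect C D F X K B) (cross C D F [X, B]) \<and>
         restricts_to C D F X K B \<psi>
           (folding C D F X B \<cdot>\<^bsub>D\<^esub> cross_map C D F [Ident C X, k, Ident C B])
           (cross_map C D F [Ident C X, k])
       \<longleftrightarrow> \<psi> = \<phi>) \<and>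
    right_exact D \<phi> (cross_map C D F [Ident C X, f])"
proof -
  interpret C: pointed_category C by fact
  interpret C: pointed_cocartesian_category C
    by unfold_locales (rule C.finite_coproducts_if_binary[OF assms(2)])
  interpret D: semi_abelian_category D by fact
  interpret cat_functor C D F by fact
  interpret zero_preserving_functor C D F by unfold_locales (rule assms(5))
  note X [simp] = assms(7)
  have a [simp]: "k \<in> Arr C" "Dom C k = K" "Cod C k = B" "f \<in> Arr C" "Dom C f = B" "Cod C f = A"
    "K \<in> Obj C" "B \<in> Obj C" "A \<in> Obj C"
    using assms(8,9) by (auto simp: hom_iff)
  let ?T = "coprod C [K, B]" and ?V = "semidirect C D F X K B" and ?j = "semidirect_incl C D F X K B"
  let ?l = "semidirect_left C D F X K B" and ?s = "semidirect_splitting C D F X K B"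
  let ?k = "[Ident C X, k, Ident C B]" and ?c = "C.copair k (Ident C B)"
  define \<phi> where "\<phi> = crm [Ident C X, ?c] \<cdot>\<^bsub>D\<^esub> ?j"
  note l = semidirect_left[OF X a(7,8)] and s = semidirect_splitting[OF X a(7,8)]
  have ls [simp]: "?l \<in> Arr D" "Dom D ?l = cr [X, K, B]" "Cod D ?l = ?V" "?s \<in> Arr D" "Dom D ?s = cr [X, K]"
    "Cod D ?s = ?V"
    using l s by (auto simp: hom_iff)
  have \<phi>: "\<phi> \<in> hom D ?V (cr [X, B])" by (simp add: \<phi>_def hom_iff)
  have \<phi>l: "\<phi> \<cdot>\<^bsub>D\<^esub> ?l = folding C D F X B \<cdot>\<^bsub>D\<^esub> crm ?k"
  proof (rule cross_eqI[where Xs = "[X, B]" and W = "cr [X, K, B]"])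
    have km: "set ?k \<subseteq> Arr C" by simp
    have cm: "coprod_map C ?k \<in> hom C (coprod C [X, K, B]) (coprod C [X, B, B])"
      and ci: "coprod_map C ?k \<cdot>\<^bsub>C\<^esub> injs C [X, K, B] ! 0 = injs C [X, B, B] ! 0 \<cdot>\<^bsub>C\<^esub> Ident C X"
      "coprod_map C ?k \<cdot>\<^bsub>C\<^esub> injs C [X, K, B] ! 1 = injs C [X, B, B] ! 1 \<cdot>\<^bsub>C\<^esub> k"
      "coprod_map C ?k \<cdot>\<^bsub>C\<^esub> injs C [X, K, B] ! 2 = injs C [X, B, B] ! 2 \<cdot>\<^bsub>C\<^esub> Ident C B"
      using C.coprod_map(1)[OF km] C.coprod_map(2)[OF km, of 0] C.coprod_map(2)[OF km, of 1]
        C.coprod_map(2)[OF km, of 2] by auto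
    have cr: "crm ?k \<in> hom D (cr [X, K, B]) (cr [X, B, B])"
      "\<iota> [X, B, B] \<cdot>\<^bsub>D\<^esub> crm ?k = onArr F (coprod_map C ?k) \<cdot>\<^bsub>D\<^esub> \<iota> [X, K, B]"
      using cross_map[OF km] by auto
    note fo = folding[OF X a(8)]
    let ?fold = "coprod_map C [Ident C X, C.copair (Ident C B) (Ident C B)]"
    note inj = C.triple_injs[OF X a(7,8), unfolded hom_iff] C.triple_injs[OF X a(8,8), unfolded hom_iff]
    \<comment> \<open>Both morphisms go from the threefold sum to \<open>X + B\<close> and have the
      components \<open>inl\<close>, \<open>inr k\<close> and \<open>inr\<close>.\<close>
    have eq: "(?fold \<cdot>\<^bsub>C\<^esub> coprod_assoc C X B B) \<cdot>\<^bsub>C\<^esub> coprod_map C ?k =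
        coprod_map C [Ident C X, ?c] \<cdot>\<^bsub>C\<^esub> coprod_assoc C X K B"
      by (rule C.triple_eqI[OF X a(7,8), where W = "coprod C [X, B]"])
        (use cm ci inj C.coprod_assoc(2-4)[OF X a(7,8)] C.coprod_assoc(2-4)[OF X a(8,8), THEN C.reassoc]
            C.coprod_assoc(2-4)[OF X a(8,8)] in \<open>auto simp: hom_iff C.assoc\<close>)
    have "\<iota> [X, B] \<cdot>\<^bsub>D\<^esub> (folding C D F X B \<cdot>\<^bsub>D\<^esub> crm ?k) =
        onArr F (?fold \<cdot>\<^bsub>C\<^esub> coprod_assoc C X B B) \<cdot>\<^bsub>D\<^esub> (\<iota> [X, B, B] \<cdot>\<^bsub>D\<^esub> crm ?k)"
      using cr fo(1) by (simp add: hom_iff fo(2)[THEN D.reassoc] D.assoc)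
    also have "\<dots> = onArr F (coprod_map C [Ident C X, ?c] \<cdot>\<^bsub>C\<^esub> coprod_assoc C X K B) \<cdot>\<^bsub>D\<^esub> \<iota> [X, K, B]"
      unfolding cr(2) using cm by (simp add: hom_iff functor_comp eq)
    finally show "\<iota> [X, B] \<cdot>\<^bsub>D\<^esub> (\<phi> \<cdot>\<^bsub>D\<^esub> ?l) = \<iota> [X, B] \<cdot>\<^bsub>D\<^esub> (folding C D F X B \<cdot>\<^bsub>D\<^esub> crm ?k)"
      by (simp add: \<phi>_def D.assoc l(2) functor_comp)
    show "folding C D F X B \<cdot>\<^bsub>D\<^esub> crm ?k \<in> hom D (cr [X, K, B]) (cr [X, B])"
      using cr(1) fo(1) by (rule D.comp_hom)
    show "\<phi> \<cdot>\<^bsub>D\<^esub> ?l \<in> hom D (cr [X, K, B]) (cr [X, B])"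
      using l(1) \<phi> by (rule D.comp_hom)
  qed simp
  have \<phi>s: "\<phi> \<cdot>\<^bsub>D\<^esub> ?s = crm [Ident C X, k]"
    by (simp add: \<phi>_def D.assoc s(2) cross_map_pair_cross_map_pair)
  have unique: "\<psi> = \<phi>" if "\<psi> \<in> hom D ?V (cr [X, B])" "\<psi> \<cdot>\<^bsub>D\<^esub> ?l = \<phi> \<cdot>\<^bsub>D\<^esub> ?l" "\<psi> \<cdot>\<^bsub>D\<^esub> ?s = \<phi> \<cdot>\<^bsub>D\<^esub> ?s" for \<psi>
    using semidirect_split_exact[OF X a(7,8)] s(1) D.kernel_section_epi[OF _ s(1)] that \<phi> by blast
  show ?thesis
  proof (rule exI[of _ \<phi>], rule conjI, rule allI)
    show "\<psi> \<in> hom D ?V (cr [X, B]) \<and> restricts_to C D F X K B \<psi>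
        (folding C D F X B \<cdot>\<^bsub>D\<^esub> crm ?k) (crm [Ident C X, k]) \<longleftrightarrow> \<psi> = \<phi>" for \<psi>
      unfolding restricts_to_def \<phi>l[symmetric] \<phi>s[symmetric] using unique[of \<psi>] \<phi> by blast
    show "right_exact D \<phi> (crm [Ident C X, f])"
      unfolding \<phi>_def by (rule semidirect_right_exact[OF assms(6-10)])
  qed
qed

end
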